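(* Let $\mathscr{H}$ be a complex Hilbert space. Let $f:[0,\infty)\to[0,\infty)$ be an operator monotone function with $f(1)=1$, $f'(1)=\mu$, and associated operator mean $\sigma$. If $A,B$ are positive operators on $\mathscr{H}$ such that $0<A,B\le\frac12 I$, then $$A'\nabla_\mu B'-A'\sigma B'\le A\nabla_\mu B-A\sigma B,$$ where $A':=I-A$ and $B':=I-B$. Moreover, when $f$ is non-linear, equality holds if and only if $A=B$.
   Context: $I$ is the identity operator on $\mathscr{H}$. $A\ge0$ (positive) means $\langle Ax,x\rangle\ge0$ for all $x\in\mathscr{H}$; $A>0$ means $A$ is positive and invertible; for self-adjoint bounded $A,B$, $A\le B$ means $B-A\ge0$. Operator monotone function: a continuous real-valued function $f$ on an interval $J\subseteq\mathbb{R}$ such that $A\ge B$ implies $f(A)\ge f(B)$ for all self-adjoint operators $A,B$ (on complex Hilbert spaces) with spectra in $J$. The operator mean $\sigma$ associated (in the sense of Kubo--Ando) with an operator monotone $f:[0,\infty)\to[0,\infty)$, $f(1)=1$, is given for positive invertible operators $A,B$ by $$A\sigma B=A^{1/2}f(A^{-1/2}BA^{-1/2})A^{1/2}.$$ For $0\le\mu\le1$, $A\nabla_\mu B:=(1-\mu)A+\mu B$ (for $f$ as in the claim, $0\le\mu=f'(1)\le1$ always holds). "Linear" means of the form $t\mapsto a+bt$; non-linear means not of this form. *)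

theory Defs
  imports "HOL-Analysis.Analysis" "HOL-Computational_Algebra.Polynomial"
begin

section \<open>Complex Hilbert spaces\<close>

text \<open>The inner product is linear in its first argument.\<close>

class chilbert_space = banach +
  fixes scaleC :: "complex \<Rightarrow> 'a \<Rightarrow> 'a"  (infixr \<open>*\<^sub>C\<close> 75)
    and cinner :: "'a \<Rightarrow> 'a \<Rightarrow> complex"
  assumes scaleC_add_right: "c *\<^sub>C (x + y) = c *\<^sub>C x + c *\<^sub>C y"
    and scaleC_add_left: "(c + d) *\<^sub>C x = c *\<^sub>C x + d *\<^sub>C x"
    and scaleC_scaleC: "c *\<^sub>C (d *\<^sub>C x) = (c * d) *\<^sub>C x"
    and scaleR_scaleC: "r *\<^sub>R x = complex_of_real r *\<^sub>C x"
    and cinner_commute: "cinner x y = cnj (cinner y x)"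
    and cinner_add_left: "cinner (x + y) z = cinner x z + cinner y z"
    and cinner_scaleC_left: "cinner (c *\<^sub>C x) y = c * cinner x y"
    and cinner_self: "cinner x x = complex_of_real ((norm x)\<^sup>2)"

lemma norm_scaleC: "norm (c *\<^sub>C x) = norm c * norm (x :: 'a :: chilbert_space)"
proof -
  have "complex_of_real ((norm (c *\<^sub>C x))\<^sup>2) = c * cinner x (c *\<^sub>C x)"
    by (simp only: cinner_self [symmetric] cinner_scaleC_left)
  also have "cinner x (c *\<^sub>C x) = cnj c * cnj (cinner x x)"
    by (subst cinner_commute) (simp add: cinner_scaleC_left)
  also have "c * (cnj c * cnj (cinner x x)) = complex_of_real ((norm c * norm x)\<^sup>2)"
    by (simp add: cinner_self power_mult_distrib complex_norm_square del: of_real_power)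
  finally have "(norm (c *\<^sub>C x))\<^sup>2 = (norm c * norm x)\<^sup>2"
    using of_real_eq_iff by blast
  then show ?thesis
    by (simp add: power2_eq_iff_nonneg)
qed

lemma bounded_linear_scaleC: "bounded_linear ((*\<^sub>C) c :: 'a \<Rightarrow> 'a :: chilbert_space)"
proof (rule bounded_linear_intro [where K = "norm c"])
  show "c *\<^sub>C (x + y) = c *\<^sub>C x + c *\<^sub>C y" for x y :: 'a
    by (rule scaleC_add_right)
  show "c *\<^sub>C (r *\<^sub>R x) = r *\<^sub>R (c *\<^sub>C x)" for r and x :: 'a
    by (simp add: scaleR_scaleC scaleC_scaleC mult.commute)
  show "norm (c *\<^sub>C x) \<le> norm x * norm c" for x :: 'a
    by (simp add: norm_scaleC)
qed

subsection \<open>The space of square-summable complex sequences\<close>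

typedef ell2 = "{x :: nat \<Rightarrow> complex. summable (\<lambda>n. (norm (x n))\<^sup>2)}"
  morphisms coord Ell2
  by (rule exI [of _ "\<lambda>_. 0"]) simp

setup_lifting type_definition_ell2

lemma summable_coord: "summable (\<lambda>n. (norm (coord x n))\<^sup>2)"
  using coord [of x] by simp

lemma square_summable_add:
  fixes x y :: "nat \<Rightarrow> complex"
  assumes "summable (\<lambda>n. (norm (x n))\<^sup>2)" "summable (\<lambda>n. (norm (y n))\<^sup>2)"
  shows "summable (\<lambda>n. (norm (x n + y n))\<^sup>2)"
proof (rule summable_comparison_test')
  show "summable (\<lambda>n. 2 * (norm (x n))\<^sup>2 + 2 * (norm (y n))\<^sup>2)"
    by (intro summable_add summable_mult assms)
  show "norm ((norm (x n + y n))\<^sup>2) \<le> 2 * (norm (x n))\<^sup>2 + 2 * (norm (y n))\<^sup>2" for n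
  proof -
    have "(norm (x n + y n))\<^sup>2 \<le> (norm (x n) + norm (y n))\<^sup>2"
      by (intro power_mono norm_triangle_ineq norm_ge_zero)
    also have "\<dots> \<le> 2 * (norm (x n))\<^sup>2 + 2 * (norm (y n))\<^sup>2"
      using zero_le_power2 [of "norm (x n) - norm (y n)"] by (simp add: power2_eq_square algebra_simps)
    finally show ?thesis by simp
  qed
qed

lemma square_summable_mult:
  fixes x :: "nat \<Rightarrow> complex"
  assumes "summable (\<lambda>n. (norm (x n))\<^sup>2)"
  shows "summable (\<lambda>n. (norm (c * x n))\<^sup>2)"
  using summable_mult [OF assms, of "(norm c)\<^sup>2"] by (simp add: norm_mult power_mult_distrib)

instantiation ell2 :: real_normed_vector
begin

lift_definition zero_ell2 :: ell2 is "\<lambda>_. 0" by simp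

lift_definition plus_ell2 :: "ell2 \<Rightarrow> ell2 \<Rightarrow> ell2" is "\<lambda>x y n. x n + y n"
  by (rule square_summable_add)

lift_definition uminus_ell2 :: "ell2 \<Rightarrow> ell2" is "\<lambda>x n. - x n" by simp

lift_definition minus_ell2 :: "ell2 \<Rightarrow> ell2 \<Rightarrow> ell2" is "\<lambda>x y n. x n - y n"
  using square_summable_add [of _ "\<lambda>n. - _ n"] by simp

lift_definition scaleR_ell2 :: "real \<Rightarrow> ell2 \<Rightarrow> ell2" is "\<lambda>r x n. complex_of_real r * x n"
  by (rule square_summable_mult)

definition norm_ell2 :: "ell2 \<Rightarrow> real" where
  "norm_ell2 x = sqrt (\<Sum>n. (norm (coord x n))\<^sup>2)"

definition dist_ell2 :: "ell2 \<Rightarrow> ell2 \<Rightarrow> real" where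
  "dist_ell2 x y = norm (x - y)"

definition sgn_ell2 :: "ell2 \<Rightarrow> ell2" where
  "sgn_ell2 x = inverse (norm x) *\<^sub>R x"

definition uniformity_ell2 :: "(ell2 \<times> ell2) filter" where
  "uniformity_ell2 = (INF e\<in>{0<..}. principal {(x, y). dist x y < e})"

definition open_ell2 :: "ell2 set \<Rightarrow> bool" where
  "open_ell2 U \<longleftrightarrow> (\<forall>x\<in>U. \<forall>\<^sub>F (x', y) in uniformity. x' = x \<longrightarrow> y \<in> U)"

lemma L2_set_coord_le: "L2_set (\<lambda>n. norm (coord x n)) {..<N} \<le> norm x"
  unfolding L2_set_def norm_ell2_def
  by (intro real_sqrt_le_mono sum_le_suminf summable_coord) auto

lemma norm_ell2_leI:
  assumes "\<And>N. L2_set (\<lambda>n. norm (coord x n)) {..<N} \<le> e"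
  shows "norm x \<le> e"
proof -
  have e: "0 \<le> e" using assms [of 0] by simp
  have "(\<Sum>n. (norm (coord x n))\<^sup>2) \<le> e\<^sup>2"
  proof (rule suminf_le_const [OF summable_coord])
    fix N
    show "(\<Sum>n<N. (norm (coord x n))\<^sup>2) \<le> e\<^sup>2"
      using assms [of N] e by (simp add: L2_set_def real_sqrt_le_iff' sum_nonneg)
  qed
  then show ?thesis
    using e by (simp add: norm_ell2_def real_le_lsqrt)
qed

instance
proof
  fix x y z :: ell2 and r s :: real
  show "x + y + z = x + (y + z)" by transfer (simp add: add.assoc)
  show "x + y = y + x" by transfer (simp add: add.commute)
  show "0 + x = x" by transfer simp
  show "- x + x = 0" by transfer simp
  show "x - y = x + - y" by transfer simp
  show "r *\<^sub>R (x + y) = r *\<^sub>R x + r *\<^sub>R y" by transfer (simp add: distrib_left)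
  show "(r + s) *\<^sub>R x = r *\<^sub>R x + s *\<^sub>R x" by transfer (simp add: distrib_right)
  show "r *\<^sub>R s *\<^sub>R x = (r * s) *\<^sub>R x" by transfer (simp add: mult.assoc)
  show "1 *\<^sub>R x = x" by transfer simp
  show "dist x y = norm (x - y)" by (rule dist_ell2_def)
  show "sgn x = inverse (norm x) *\<^sub>R x" by (rule sgn_ell2_def)
  show "uniformity = (INF e\<in>{0<..}. principal {(x :: ell2, y). dist x y < e})"
    by (rule uniformity_ell2_def)
  show "open U \<longleftrightarrow> (\<forall>x\<in>U. \<forall>\<^sub>F (x', y) in uniformity. x' = x \<longrightarrow> y \<in> U)" for U :: "ell2 set"
    by (rule open_ell2_def)
  show "norm x = 0 \<longleftrightarrow> x = 0"
  proof -
    have "norm x = 0 \<longleftrightarrow> (\<forall>n. (norm (coord x n))\<^sup>2 = 0)"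
      unfolding norm_ell2_def real_sqrt_eq_zero_cancel_iff
      by (rule suminf_eq_zero_iff [OF summable_coord]) simp
    also have "\<dots> \<longleftrightarrow> x = 0"
      by (auto simp: coord_inject [symmetric] zero_ell2.rep_eq fun_eq_iff)
    finally show ?thesis .
  qed
  show "norm (x + y) \<le> norm x + norm y"
  proof (rule norm_ell2_leI)
    fix N
    have "L2_set (\<lambda>n. norm (coord (x + y) n)) {..<N}
        \<le> L2_set (\<lambda>n. norm (coord x n) + norm (coord y n)) {..<N}"
      by (intro L2_set_mono) (auto simp: plus_ell2.rep_eq norm_triangle_ineq)
    also have "\<dots> \<le> L2_set (\<lambda>n. norm (coord x n)) {..<N} + L2_set (\<lambda>n. norm (coord y n)) {..<N}"
      by (rule L2_set_triangle_ineq)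
    also have "\<dots> \<le> norm x + norm y"
      by (intro add_mono L2_set_coord_le)
    finally show "L2_set (\<lambda>n. norm (coord (x + y) n)) {..<N} \<le> norm x + norm y" .
  qed
  show "norm (r *\<^sub>R x) = \<bar>r\<bar> * norm x"
    by (simp add: norm_ell2_def scaleR_ell2.rep_eq norm_mult power_mult_distrib
        suminf_mult summable_coord real_sqrt_mult)
qed

end

lemma norm_coord_le: "norm (coord x n) \<le> norm x"
proof -
  have "norm (coord x n) \<le> L2_set (\<lambda>n. norm (coord x n)) {..<Suc n}"
    by (rule member_le_L2_set) auto
  also have "\<dots> \<le> norm x" by (rule L2_set_coord_le)
  finally show ?thesis .
qed

instance ell2 :: banach
proof
  fix X :: "nat \<Rightarrow> ell2"
  assume X: "Cauchy X"
  have "Cauchy (\<lambda>m. coord (X m) n)" for n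
  proof (rule metric_CauchyI)
    fix e :: real assume "0 < e"
    then obtain M where M: "\<And>k l. k \<ge> M \<Longrightarrow> l \<ge> M \<Longrightarrow> dist (X k) (X l) < e"
      using metric_CauchyD [OF X] by blast
    have "dist (coord (X k) n) (coord (X l) n) < e" if "k \<ge> M" "l \<ge> M" for k l
      using M [OF that] norm_coord_le [of "X k - X l" n]
      by (simp add: dist_norm minus_ell2.rep_eq)
    then show "\<exists>M. \<forall>k\<ge>M. \<forall>l\<ge>M. dist (coord (X k) n) (coord (X l) n) < e" by blast
  qed
  then have "\<forall>n. \<exists>l. (\<lambda>m. coord (X m) n) \<longlonglongrightarrow> l"
    by (simp add: Cauchy_convergent_iff convergent_def)
  then obtain L where L: "\<And>n. (\<lambda>m. coord (X m) n) \<longlonglongrightarrow> L n" by metis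
  have tail: "L2_set (\<lambda>n. norm (coord (X k) n - L n)) {..<N} \<le> e"
    if M: "\<And>l. l \<ge> M \<Longrightarrow> dist (X k) (X l) < e" for k M N e
  proof (rule tendsto_upperbound)
    show "(\<lambda>l. L2_set (\<lambda>n. norm (coord (X k) n - coord (X l) n)) {..<N})
        \<longlonglongrightarrow> L2_set (\<lambda>n. norm (coord (X k) n - L n)) {..<N}"
      unfolding L2_set_def by (intro tendsto_intros L)
    show "\<forall>\<^sub>F l in sequentially. L2_set (\<lambda>n. norm (coord (X k) n - coord (X l) n)) {..<N} \<le> e"
      unfolding eventually_sequentially
    proof (intro exI allI impI)
      fix l assume "M \<le> l"
      have "L2_set (\<lambda>n. norm (coord (X k) n - coord (X l) n)) {..<N} \<le> norm (X k - X l)"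
        using L2_set_coord_le [of "X k - X l" N] by (simp add: minus_ell2.rep_eq)
      then show "L2_set (\<lambda>n. norm (coord (X k) n - coord (X l) n)) {..<N} \<le> e"
        using M [OF \<open>M \<le> l\<close>] by (simp add: dist_norm)
    qed
  qed simp
  obtain M where M: "\<And>k l. k \<ge> M \<Longrightarrow> l \<ge> M \<Longrightarrow> dist (X k) (X l) < 1"
    using metric_CauchyD [OF X zero_less_one] by blast
  have "summable (\<lambda>n. (norm (L n - coord (X M) n))\<^sup>2)"
  proof (rule summableI_nonneg_bounded)
    fix N
    have "L2_set (\<lambda>n. norm (coord (X M) n - L n)) {..<N} \<le> 1"
      using tail [of M M 1 N] M by blast
    then show "(\<Sum>n<N. (norm (L n - coord (X M) n))\<^sup>2) \<le> 1"
      by (simp add: L2_set_def norm_minus_commute)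
  qed simp
  from square_summable_add [OF this summable_coord [of "X M"]]
  have "summable (\<lambda>n. (norm (L n))\<^sup>2)" by simp
  then have coord_L: "coord (Ell2 L) = L" by (simp add: Ell2_inverse)
  have "X \<longlonglongrightarrow> Ell2 L"
  proof (rule metric_LIMSEQ_I)
    fix e :: real assume "0 < e"
    then obtain M where M: "\<And>k l. k \<ge> M \<Longrightarrow> l \<ge> M \<Longrightarrow> dist (X k) (X l) < e / 2"
      using metric_CauchyD [OF X, of "e / 2"] by auto
    have "dist (X k) (Ell2 L) < e" if "k \<ge> M" for k
    proof -
      have "norm (X k - Ell2 L) \<le> e / 2"
        by (rule norm_ell2_leI) (use tail [of M k "e / 2"] M that in \<open>simp add: minus_ell2.rep_eq coord_L\<close>)
      then show ?thesis using \<open>0 < e\<close> by (simp add: dist_norm)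
    qed
    then show "\<exists>M. \<forall>k\<ge>M. dist (X k) (Ell2 L) < e" by blast
  qed
  then show "convergent X" by (rule convergentI)
qed

lemma summable_coord_mult: "summable (\<lambda>n. coord x n * cnj (coord y n))"
proof (rule summable_comparison_test')
  show "summable (\<lambda>n. (norm (coord x n))\<^sup>2 + (norm (coord y n))\<^sup>2)"
    by (intro summable_add summable_coord)
  show "norm (coord x n * cnj (coord y n)) \<le> (norm (coord x n))\<^sup>2 + (norm (coord y n))\<^sup>2" for n
  proof -
    have "2 * (norm (coord x n) * norm (coord y n)) \<le> (norm (coord x n))\<^sup>2 + (norm (coord y n))\<^sup>2"
      using zero_le_power2 [of "norm (coord x n) - norm (coord y n)"] by (simp add: power2_diff)
    moreover have "0 \<le> norm (coord x n) * norm (coord y n)" by simp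
    ultimately have "norm (coord x n) * norm (coord y n) \<le> (norm (coord x n))\<^sup>2 + (norm (coord y n))\<^sup>2"
      by linarith
    then show ?thesis by (simp add: norm_mult)
  qed
qed

instantiation ell2 :: chilbert_space
begin

lift_definition scaleC_ell2 :: "complex \<Rightarrow> ell2 \<Rightarrow> ell2" is "\<lambda>c x n. c * x n"
  by (rule square_summable_mult)

definition cinner_ell2 :: "ell2 \<Rightarrow> ell2 \<Rightarrow> complex" where
  "cinner_ell2 x y = (\<Sum>n. coord x n * cnj (coord y n))"

instance
proof
  fix x y z :: ell2 and c d :: complex and r :: real
  show "c *\<^sub>C (x + y) = c *\<^sub>C x + c *\<^sub>C y" by transfer (simp add: distrib_left)
  show "(c + d) *\<^sub>C x = c *\<^sub>C x + d *\<^sub>C x" by transfer (simp add: distrib_right)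
  show "c *\<^sub>C (d *\<^sub>C x) = (c * d) *\<^sub>C x" by transfer (simp add: mult.assoc)
  show "r *\<^sub>R x = complex_of_real r *\<^sub>C x" by transfer simp
  show "cinner x y = cnj (cinner y x)"
  proof -
    have "(\<lambda>n. coord y n * cnj (coord x n)) sums cinner y x"
      unfolding cinner_ell2_def by (rule summable_sums [OF summable_coord_mult])
    then have "(\<lambda>n. cnj (coord y n * cnj (coord x n))) sums cnj (cinner y x)"
      by (simp only: sums_cnj)
    then show ?thesis
      unfolding cinner_ell2_def [of x] by (simp add: sums_iff mult.commute)
  qed
  show "cinner (x + y) z = cinner x z + cinner y z"
    by (simp add: cinner_ell2_def plus_ell2.rep_eq distrib_right suminf_add summable_coord_mult)
  show "cinner (c *\<^sub>C x) y = c * cinner x y"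
    by (simp add: cinner_ell2_def scaleC_ell2.rep_eq mult.assoc suminf_mult summable_coord_mult)
  show "cinner x x = complex_of_real ((norm x)\<^sup>2)"
  proof -
    have "(norm x)\<^sup>2 = (\<Sum>n. (norm (coord x n))\<^sup>2)"
      by (simp add: norm_ell2_def suminf_nonneg summable_coord)
    then show ?thesis
      unfolding cinner_ell2_def
      by (simp add: suminf_of_real summable_coord complex_norm_square [symmetric] del: of_real_power)
  qed
qed

end

section \<open>Bounded operators\<close>

text \<open>
  \<open>'h \<Rightarrow>\<^sub>L 'h\<close> consists of the bounded real-linear maps; the bounded operators on a complex
  Hilbert space are the elements satisfying \<open>clinear_op\<close>.
\<close>

definition clinear_op :: "('h :: chilbert_space \<Rightarrow>\<^sub>L 'h) \<Rightarrow> bool" where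
  "clinear_op A \<longleftrightarrow> (\<forall>c x. A (c *\<^sub>C x) = c *\<^sub>C A x)"

definition selfadjoint_op :: "('h :: chilbert_space \<Rightarrow>\<^sub>L 'h) \<Rightarrow> bool" where
  "selfadjoint_op A \<longleftrightarrow> clinear_op A \<and> (\<forall>x y. cinner (A x) y = cinner x (A y))"

definition positive_op :: "('h :: chilbert_space \<Rightarrow>\<^sub>L 'h) \<Rightarrow> bool" where
  "positive_op A \<longleftrightarrow> clinear_op A \<and> (\<forall>x. cinner (A x) x \<in> \<real>\<^sub>\<ge>\<^sub>0)"

definition invertible_op :: "('h :: chilbert_space \<Rightarrow>\<^sub>L 'h) \<Rightarrow> bool" where
  "invertible_op A \<longleftrightarrow> (\<exists>C. clinear_op C \<and> A o\<^sub>L C = id_blinfun \<and> C o\<^sub>L A = id_blinfun)"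

definition strictly_positive_op :: "('h :: chilbert_space \<Rightarrow>\<^sub>L 'h) \<Rightarrow> bool" where
  "strictly_positive_op A \<longleftrightarrow> positive_op A \<and> invertible_op A"

definition op_le :: "('h :: chilbert_space \<Rightarrow>\<^sub>L 'h) \<Rightarrow> ('h \<Rightarrow>\<^sub>L 'h) \<Rightarrow> bool"  (infix \<open>\<preceq>\<close> 50) where
  "A \<preceq> B \<longleftrightarrow> positive_op (B - A)"

lift_definition scalar_op :: "complex \<Rightarrow> 'h :: chilbert_space \<Rightarrow>\<^sub>L 'h" is "(*\<^sub>C)"
  by (rule bounded_linear_scaleC)

definition spectrum :: "('h :: chilbert_space \<Rightarrow>\<^sub>L 'h) \<Rightarrow> complex set" where
  "spectrum A = {z. \<not> invertible_op (A - scalar_op z)}"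

section \<open>Continuous functional calculus\<close>

definition poly_op :: "real poly \<Rightarrow> ('h :: chilbert_space \<Rightarrow>\<^sub>L 'h) \<Rightarrow> 'h \<Rightarrow>\<^sub>L 'h" where
  "poly_op p A = (\<Sum>i\<le>degree p. coeff p i *\<^sub>R ((\<lambda>T. A o\<^sub>L T) ^^ i) id_blinfun)"

text \<open>
  For self-adjoint \<open>A\<close> and real \<open>f\<close> continuous on the (real) spectrum of \<open>A\<close>, the operator
  \<open>cfc f A\<close> is the norm limit of \<open>p\<^sub>n(A)\<close> for any polynomials \<open>p\<^sub>n\<close> converging to \<open>f\<close> uniformly on
  the spectrum. For other arguments the value is unspecified.
\<close>

definition cfc :: "(real \<Rightarrow> real) \<Rightarrow> ('h :: chilbert_space \<Rightarrow>\<^sub>L 'h) \<Rightarrow> 'h \<Rightarrow>\<^sub>L 'h" where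
  "cfc f A = (THE T. \<exists>p :: nat \<Rightarrow> real poly.
     uniform_limit {t. complex_of_real t \<in> spectrum A} (\<lambda>n. poly (p n)) f sequentially \<and>
     (\<lambda>n. poly_op (p n) A) \<longlonglongrightarrow> T)"

definition op_powr :: "('h :: chilbert_space \<Rightarrow>\<^sub>L 'h) \<Rightarrow> real \<Rightarrow> 'h \<Rightarrow>\<^sub>L 'h" where
  "op_powr A r = cfc (\<lambda>t. t powr r) A"

section \<open>Operator monotone functions and operator means\<close>

text \<open>
  HOL cannot quantify over all Hilbert spaces (types) within a formula, so the monotonicity
  condition is relative to a space, which is passed as a type argument. A function is operator
  monotone on every complex Hilbert space iff it is so on \<^typ>\<open>ell2\<close>; the forward implication, which
  is the one needed to apply results that assume \<open>operator_monotone_on\<close>, is mere instantiation.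
\<close>

definition operator_monotone_on_space ::
    "'h :: chilbert_space itself \<Rightarrow> real set \<Rightarrow> (real \<Rightarrow> real) \<Rightarrow> bool" where
  "operator_monotone_on_space _ J f \<longleftrightarrow>
     is_interval J \<and> continuous_on J f \<and>
     (\<forall>A B :: 'h \<Rightarrow>\<^sub>L 'h. selfadjoint_op A \<longrightarrow> selfadjoint_op B \<longrightarrow>
        spectrum A \<subseteq> complex_of_real ` J \<longrightarrow> spectrum B \<subseteq> complex_of_real ` J \<longrightarrow>
        B \<preceq> A \<longrightarrow> cfc f B \<preceq> cfc f A)"

definition operator_monotone_on :: "real set \<Rightarrow> (real \<Rightarrow> real) \<Rightarrow> bool" where
  "operator_monotone_on J f \<longleftrightarrow> operator_monotone_on_space TYPE(ell2) J f"

definition op_mean :: "(real \<Rightarrow> real) \<Rightarrow>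
    ('h :: chilbert_space \<Rightarrow>\<^sub>L 'h) \<Rightarrow> ('h \<Rightarrow>\<^sub>L 'h) \<Rightarrow> 'h \<Rightarrow>\<^sub>L 'h" where
  "op_mean f A B =
     op_powr A (1/2) o\<^sub>L cfc f (op_powr A (-1/2) o\<^sub>L B o\<^sub>L op_powr A (-1/2)) o\<^sub>L op_powr A (1/2)"

definition weighted_arith_mean :: "real \<Rightarrow>
    ('h :: chilbert_space \<Rightarrow>\<^sub>L 'h) \<Rightarrow> ('h \<Rightarrow>\<^sub>L 'h) \<Rightarrow> 'h \<Rightarrow>\<^sub>L 'h" where
  "weighted_arith_mean \<mu> A B = (1 - \<mu>) *\<^sub>R A + \<mu> *\<^sub>R B"

definition linear_on_nonneg :: "(real \<Rightarrow> real) \<Rightarrow> bool" where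
  "linear_on_nonneg f \<longleftrightarrow> (\<exists>a b. \<forall>t\<ge>0. f t = a + b * t)"

end

theory Submission
  imports Defs "HOL-Computational_Algebra.Fundamental_Theorem_Algebra"
begin

text \<open> For the weighted harmonic mean, that is for \<open>f t = t / ((1 - l) t + l)\<close> with \<open>0 \<le> l \<le> 1\<close>, everything
  can be computed. Put \<open>X = (1 - l) B + l A\<close> and \<open>D = A - B\<close>. The mean is \<open>B X\<^sup>-\<^sup>1 A\<close>, and it differs from
  the arithmetic mean by \<open>l (1 - l) D X\<^sup>-\<^sup>1 D\<close> (\<open>mean_gap_harmonic\<close>). Passing to the complements \<open>1 - A\<close>
  and \<open>1 - B\<close> replaces \<open>D\<close> by \<open>- D\<close> and \<open>X\<close> by \<open>1 - X\<close>, so the assertion becomes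
  \<open>(1 - X)\<^sup>-\<^sup>1 \<le> X\<^sup>-\<^sup>1\<close>, which is clear from \<open>X \<le> 1/2\<close>. The estimate even leaves the margin
  \<open>4 (l (1 - l))\<^sup>2 D (1 - A - B) D\<close> (\<open>mean_gap_harmonic_compl\<close>). Both sides are affine in \<open>f\<close>, so the
  inequality, with its margin, holds for finite convex combinations of these functions.

  By Loewner's theorem an operator monotone \<open>f\<close> with \<open>f 1 = 1\<close> is an average of such functions. A weaker
  form suffices: on every compact subinterval of the positive half-line \<open>f\<close> is a uniform limit of finite
  convex combinations (\<open>mixture_approx\<close>). This is proved by duality. A linear functional of the
  values at finitely many points that is nonnegative on all weighted harmonic means must be shown to be
  nonnegative at \<open>f\<close> (\<open>functional_nonneg\<close>). Its values on the harmonic means are those of a polynomial \<open>P\<close>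
  divided by a positive product; so \<open>P\<close> is nonnegative on a half-line and hence a sum of terms \<open>q\<^sup>2\<close>
  and \<open>y q\<^sup>2\<close> (\<open>halfline_sos_if_nonneg\<close>). The functional that belongs to such a term is a divided difference of
  \<open>f q\<^sup>2\<close>, whose sign is determined by applying the monotonicity of \<open>f\<close> to a diagonal operator and a
  rank-one perturbation of it with prescribed eigenvalues (\<open>interlacing_divided_diff_nonneg\<close>,
  \<open>divided_diff_sign\<close>).

  For the case of equality, a nonlinear \<open>f\<close> lies strictly below its tangent at \<open>1\<close> at some point \<open>t\<close>. This bounds
  the mean of \<open>l (1 - l)\<close>, and therefore that of \<open>(l (1 - l))\<^sup>2\<close>, away from zero along the approximation. Hence a
  positive multiple of the margin survives in the limit (\<open>mean_gap_compl_le\<close>). If equality holds, the form of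
  \<open>1 - A - B = (1/2 - A) + (1/2 - B)\<close> vanishes on the range of \<open>D\<close>, so \<open>A\<close> and \<open>B\<close> both act there as
  multiplication by \<open>1/2\<close>, and \<open>D\<^sup>2 = 0\<close>.
\<close>

section \<open>Quadratic forms of operators on a complex Hilbert space\<close>

lemma cinner_add_right: "cinner x (y + z) = cinner x y + cinner x z"
  by (metis cinner_commute cinner_add_left complex_cnj_add)

lemma cinner_scaleC_right: "cinner x (c *\<^sub>C y) = cnj c * cinner x y"
  by (metis cinner_commute cinner_scaleC_left complex_cnj_mult)

lemma cinner_scaleR_left: "cinner (r *\<^sub>R x) y = complex_of_real r * cinner x y"
  by (simp only: scaleR_scaleC cinner_scaleC_left)

lemma cinner_scaleR_right: "cinner x (r *\<^sub>R y) = complex_of_real r * cinner x y"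
  by (simp only: scaleR_scaleC cinner_scaleC_right complex_cnj_complex_of_real)

lemma cinner_uminus_left: "cinner (- x) y = - cinner x y"
  using cinner_scaleR_left [of "- 1" x y] by simp

lemma cinner_uminus_right: "cinner x (- y) = - cinner x y"
  using cinner_scaleR_right [of x "- 1" y] by simp

lemma cinner_diff_left: "cinner (x - y) z = cinner x z - cinner y z"
  using cinner_add_left [of x "- y" z] by (simp add: cinner_uminus_left)

lemma cinner_diff_right: "cinner x (y - z) = cinner x y - cinner x z"
  using cinner_add_right [of x y "- z"] by (simp add: cinner_uminus_right)

lemma cinner_zero_left [simp]: "cinner 0 y = 0"
  using cinner_scaleR_left [of 0 0 y] by simp

lemma cinner_zero_right [simp]: "cinner x 0 = 0"
  using cinner_scaleR_right [of x 0 0] by simp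

lemma cinner_sum_left: "cinner (\<Sum>i\<in>S. g i) y = (\<Sum>i\<in>S. cinner (g i) y)"
  by (induction S rule: infinite_finite_induct) (simp_all add: cinner_add_left)

lemma cinner_sum_right: "cinner x (\<Sum>i\<in>S. g i) = (\<Sum>i\<in>S. cinner x (g i))"
  by (induction S rule: infinite_finite_induct) (simp_all add: cinner_add_right)

lemmas cinner_simps = cinner_add_left cinner_add_right cinner_diff_left cinner_diff_right
  cinner_uminus_left cinner_uminus_right cinner_scaleC_left cinner_scaleC_right
  cinner_scaleR_left cinner_scaleR_right

lemma scaleC_diff_right: "c *\<^sub>C (x - y) = c *\<^sub>C x - c *\<^sub>C (y :: 'h :: chilbert_space)"
  using bounded_linear.linear [OF bounded_linear_scaleC] by (rule linear_diff)

lemma scaleC_one [simp]: "1 *\<^sub>C x = (x :: 'h :: chilbert_space)"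
  using scaleR_scaleC [of 1 x] by simp

lemma scaleC_zero_right [simp]: "c *\<^sub>C (0 :: 'h :: chilbert_space) = 0"
  using bounded_linear.linear [OF bounded_linear_scaleC] by (rule linear_0)

lemma scaleC_scaleR_commute: "c *\<^sub>C (r *\<^sub>R x) = r *\<^sub>R (c *\<^sub>C (x :: 'h :: chilbert_space))"
  by (simp add: scaleR_scaleC scaleC_scaleC mult.commute)

definition qform :: "('h :: chilbert_space \<Rightarrow>\<^sub>L 'h) \<Rightarrow> 'h \<Rightarrow> real" where
  "qform A x = Re (cinner (A x) x)"

lemma qform_add: "qform (A + B) x = qform A x + qform B x"
  by (simp add: qform_def blinfun.bilinear_simps cinner_simps)

lemma qform_diff: "qform (A - B) x = qform A x - qform B x"
  by (simp add: qform_def blinfun.bilinear_simps cinner_simps)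

lemma qform_scaleR: "qform (r *\<^sub>R A) x = r * qform A x"
  by (simp add: qform_def blinfun.bilinear_simps cinner_simps)

lemma qform_id: "qform id_blinfun x = (norm x)\<^sup>2"
  by (simp add: qform_def cinner_self del: of_real_power)

lemmas qform_simps = qform_add qform_diff qform_scaleR qform_id

lemma clinear_opD: "clinear_op A \<Longrightarrow> A (c *\<^sub>C x) = c *\<^sub>C A x"
  by (simp add: clinear_op_def)

lemma clinear_op_intros:
  "clinear_op id_blinfun"
  "clinear_op (scalar_op z)"
  "clinear_op A \<Longrightarrow> clinear_op B \<Longrightarrow> clinear_op (A + B)"
  "clinear_op A \<Longrightarrow> clinear_op B \<Longrightarrow> clinear_op (A - B)"
  "clinear_op A \<Longrightarrow> clinear_op (r *\<^sub>R A)"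
  "clinear_op A \<Longrightarrow> clinear_op B \<Longrightarrow> clinear_op (A o\<^sub>L B)"
  by (simp_all add: clinear_op_def blinfun.bilinear_simps scaleC_add_right scaleC_diff_right
      scaleC_scaleR_commute scalar_op.rep_eq scaleC_scaleC mult.commute)

lemma selfadjoint_opD: "selfadjoint_op A \<Longrightarrow> cinner (A x) y = cinner x (A y)"
  by (simp add: selfadjoint_op_def)

lemma selfadjoint_clinear: "selfadjoint_op A \<Longrightarrow> clinear_op A"
  by (simp add: selfadjoint_op_def)

lemma selfadjoint_op_intros:
  "selfadjoint_op id_blinfun"
  "selfadjoint_op A \<Longrightarrow> selfadjoint_op B \<Longrightarrow> selfadjoint_op (A + B)"
  "selfadjoint_op A \<Longrightarrow> selfadjoint_op B \<Longrightarrow> selfadjoint_op (A - B)"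
  "selfadjoint_op A \<Longrightarrow> selfadjoint_op (r *\<^sub>R A)"
  by (auto simp add: selfadjoint_op_def blinfun.bilinear_simps cinner_simps intro!: clinear_op_intros)

lemma selfadjoint_op_compose_commute:
  "selfadjoint_op A \<Longrightarrow> selfadjoint_op B \<Longrightarrow> A o\<^sub>L B = B o\<^sub>L A \<Longrightarrow> selfadjoint_op (A o\<^sub>L B)"
  unfolding selfadjoint_op_def
  by (metis blinfun_apply_blinfun_compose clinear_op_intros(6))

lemma selfadjoint_op_sandwich:
  "selfadjoint_op R \<Longrightarrow> selfadjoint_op B \<Longrightarrow> selfadjoint_op (R o\<^sub>L B o\<^sub>L R)"
  by (auto simp: selfadjoint_op_def clinear_op_intros)

lemma qform_sandwich: "selfadjoint_op R \<Longrightarrow> qform (R o\<^sub>L B o\<^sub>L R) x = qform B (R x)"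
  by (simp add: qform_def selfadjoint_opD)

lemma cinner_selfadjoint_real: "selfadjoint_op A \<Longrightarrow> cinner (A x) x = complex_of_real (qform A x)"
  by (metis Reals_cnj_iff cinner_commute of_real_Re qform_def selfadjoint_opD)

lemma polarization_Re:
  assumes "selfadjoint_op S"
  shows "4 * Re (cinner (S x) y) = qform S (x + y) - qform S (x - y)"
proof -
  have "Re (cinner (S y) x) = Re (cinner (S x) y)"
    unfolding selfadjoint_opD [OF assms, of y] cinner_commute [of y] by simp
  then show ?thesis by (simp add: qform_def blinfun.bilinear_simps cinner_simps)
qed

text \<open>
  On a complex space a bounded operator with real quadratic form is self-adjoint; this is
  polarization along \<open>x + y\<close> and \<open>x + \<i> y\<close>.
\<close>

lemma positive_op_iff: "positive_op A \<longleftrightarrow> selfadjoint_op A \<and> (\<forall>x. 0 \<le> qform A x)"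
proof
  assume A: "positive_op A"
  then have lin: "clinear_op A" by (simp add: positive_op_def)
  have im: "Im (cinner (A x) x) = 0" and re: "0 \<le> qform A x" for x
    using A by (auto simp: positive_op_def qform_def complex_nonneg_Reals_iff)
  have "cinner (A x) y = cinner x (A y)" for x y
  proof -
    have 1: "Im (cinner (A x) y) + Im (cinner (A y) x) = 0"
      using im [of "x + y"] im [of x] im [of y] by (simp add: blinfun.bilinear_simps cinner_simps)
    have 2: "Re (cinner (A y) x) = Re (cinner (A x) y)"
      using im [of "x + \<i> *\<^sub>C y"] im [of x] im [of y]
      by (simp add: blinfun.bilinear_simps cinner_simps clinear_opD [OF lin])
    have "cinner (A x) y = cnj (cinner (A y) x)"
      using 1 2 by (intro complex_eqI) auto
    then show ?thesis by (metis cinner_commute)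
  qed
  then show "selfadjoint_op A \<and> (\<forall>x. 0 \<le> qform A x)" using lin re by (simp add: selfadjoint_op_def)
next
  assume "selfadjoint_op A \<and> (\<forall>x. 0 \<le> qform A x)"
  then show "positive_op A"
    by (auto simp: positive_op_def selfadjoint_clinear cinner_selfadjoint_real)
qed

text \<open>
  With \<open>b = \<langle>P x, y\<rangle>\<close>, the form is nonnegative at \<open>x - s b y\<close> for every real \<open>s\<close>; the factor \<open>b\<close> makes the
  cross terms real. This is a quadratic polynomial in \<open>s\<close>.
\<close>

lemma form_Cauchy_Schwarz:
  assumes P: "positive_op P"
  shows "(cmod (cinner (P x) y))\<^sup>2 \<le> qform P x * qform P y"
proof -
  have sa: "selfadjoint_op P" and pos: "\<And>x. 0 \<le> qform P x"
    using P by (auto simp: positive_op_iff)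
  define b where "b = cinner (P x) y"
  define B where "B = (cmod b)\<^sup>2"
  have bc: "cinner (P y) x = cnj b"
    by (metis b_def cinner_commute sa selfadjoint_opD)
  have bb: "b * cnj b = complex_of_real B"
    unfolding B_def by (rule complex_norm_square [symmetric])
  have expand: "qform P (x - (of_real s * b) *\<^sub>C y) = qform P x - 2 * s * B + s\<^sup>2 * B * qform P y" for s
  proof -
    let ?d = "complex_of_real s * b"
    have "cinner (P (x - ?d *\<^sub>C y)) (x - ?d *\<^sub>C y)
        = cinner (P x) x - cnj ?d * b - ?d * cnj b + ?d * cnj ?d * cinner (P y) y"
      by (simp add: blinfun.bilinear_simps cinner_simps clinear_opD [OF selfadjoint_clinear [OF sa]]
          bc b_def [symmetric] algebra_simps)
    also have "\<dots> = cinner (P x) x - 2 * of_real s * (b * cnj b) + (of_real s)\<^sup>2 * (b * cnj b) * cinner (P y) y"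
      by (simp add: algebra_simps power2_eq_square)
    also have "\<dots> = of_real (qform P x - 2 * s * B + s\<^sup>2 * B * qform P y)"
      unfolding bb cinner_selfadjoint_real [OF sa] by simp
    finally show ?thesis by (metis Re_complex_of_real qform_def)
  qed
  have nn: "0 \<le> qform P x - 2 * s * B + s\<^sup>2 * B * qform P y" for s
    using pos expand by metis
  show ?thesis
  proof (cases "qform P y = 0")
    case True
    have "B = 0"
    proof (rule ccontr)
      assume "B \<noteq> 0"
      then have "0 < B" by (simp add: B_def)
      \<comment> \<open>The polynomial is affine with slope \<open>- 2 B\<close>, so it is negative for large \<open>s\<close>.\<close>
      then have "(qform P x + 1) / B * B = qform P x + 1" by simp
      then show False using nn [of "(qform P x + 1) / B"] pos [of x]
        unfolding True mult.assoc by simp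
    qed
    then show ?thesis by (simp add: True B_def [symmetric] b_def [symmetric])
  next
    case False
    then have "0 < qform P y" using pos [of y] by simp
    then show ?thesis using nn [of "1 / qform P y"]
      by (simp add: field_simps power2_eq_square B_def b_def)
  qed
qed

lemma positive_op_id: "positive_op id_blinfun"
  by (simp add: positive_op_iff selfadjoint_op_intros qform_id)

lemma Cauchy_Schwarz_cinner: "cmod (cinner x y) \<le> norm x * norm y"
proof (rule power2_le_imp_le)
  show "(cmod (cinner x y))\<^sup>2 \<le> (norm x * norm y)\<^sup>2"
    using form_Cauchy_Schwarz [OF positive_op_id, of x y]
    by (simp add: qform_id power_mult_distrib)
qed simp

lemma cinner_bounded_bilinear: "bounded_bilinear (cinner :: 'h :: chilbert_space \<Rightarrow> 'h \<Rightarrow> complex)"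
proof
  show "\<exists>K. \<forall>a b :: 'h. norm (cinner a b) \<le> norm a * norm b * K"
    by (rule exI [of _ 1]) (simp add: Cauchy_Schwarz_cinner)
qed (simp_all add: cinner_simps scaleR_conv_of_real)

lemma qform_abs_le: "\<bar>qform A x\<bar> \<le> norm A * (norm x)\<^sup>2"
proof -
  have "\<bar>qform A x\<bar> \<le> norm (A x) * norm x"
    unfolding qform_def by (rule order_trans [OF abs_Re_le_cmod Cauchy_Schwarz_cinner])
  also have "\<dots> \<le> norm A * norm x * norm x"
    by (intro mult_right_mono norm_blinfun) auto
  finally show ?thesis by (simp add: power2_eq_square mult.assoc)
qed

text \<open>
  The form version of the Cauchy--Schwarz inequality for \<open>x\<close> and \<open>P x\<close>. In particular, a positive operator
  annihilates every vector at which its form vanishes.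
\<close>

lemma positive_op_norm_le:
  assumes P: "positive_op P"
  shows "(norm (P x))\<^sup>2 \<le> norm P * qform P x"
proof (cases "P x = 0")
  case False
  have "((norm (P x))\<^sup>2)\<^sup>2 = (cmod (cinner (P x) (P x)))\<^sup>2"
    by (simp add: cinner_self norm_power)
  also have "\<dots> \<le> qform P x * qform P (P x)" by (rule form_Cauchy_Schwarz [OF P])
  also have "\<dots> \<le> qform P x * (norm P * (norm (P x))\<^sup>2)"
    using P qform_abs_le [of P "P x"] by (intro mult_left_mono) (auto simp: positive_op_iff)
  finally have "(norm (P x))\<^sup>2 * (norm (P x))\<^sup>2 \<le> (norm P * qform P x) * (norm (P x))\<^sup>2"
    by (simp add: power2_eq_square mult_ac)
  then show ?thesis by (rule mult_right_le_imp_le) (use False in simp)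
qed (use P in \<open>auto simp: positive_op_iff\<close>)

lemma tendsto_blinfun_apply_left: "(X \<longlongrightarrow> T) F \<Longrightarrow> ((\<lambda>n. blinfun_apply (X n) x) \<longlongrightarrow> T x) F"
  by (intro tendsto_intros)

lemma tendsto_qform: "(X \<longlongrightarrow> T) F \<Longrightarrow> ((\<lambda>n. qform (X n) x) \<longlongrightarrow> qform T x) F"
  unfolding qform_def
  by (intro tendsto_Re bounded_bilinear.tendsto [OF cinner_bounded_bilinear] tendsto_blinfun_apply_left tendsto_const)

lemma selfadjoint_op_limit:
  assumes "X \<longlonglongrightarrow> T" "\<And>n. selfadjoint_op (X n)"
  shows "selfadjoint_op T"
proof -
  have "T (c *\<^sub>C x) = c *\<^sub>C T x" for c x
  proof (rule LIMSEQ_unique)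
    show "(\<lambda>n. X n (c *\<^sub>C x)) \<longlonglongrightarrow> T (c *\<^sub>C x)" by (intro tendsto_blinfun_apply_left assms)
    have "(\<lambda>n. c *\<^sub>C X n x) \<longlonglongrightarrow> c *\<^sub>C T x"
      by (intro bounded_linear.tendsto [OF bounded_linear_scaleC] tendsto_blinfun_apply_left assms)
    then show "(\<lambda>n. X n (c *\<^sub>C x)) \<longlonglongrightarrow> c *\<^sub>C T x"
      by (simp add: clinear_opD [OF selfadjoint_clinear [OF assms(2)]])
  qed
  moreover have "cinner (T x) y = cinner x (T y)" for x y
  proof (rule LIMSEQ_unique)
    show "(\<lambda>n. cinner (X n x) y) \<longlonglongrightarrow> cinner (T x) y"
      by (intro bounded_bilinear.tendsto [OF cinner_bounded_bilinear] tendsto_blinfun_apply_left assms tendsto_const)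
    show "(\<lambda>n. cinner (X n x) y) \<longlonglongrightarrow> cinner x (T y)"
      unfolding selfadjoint_opD [OF assms(2)]
      by (intro bounded_bilinear.tendsto [OF cinner_bounded_bilinear] tendsto_blinfun_apply_left assms tendsto_const)
  qed
  ultimately show ?thesis by (simp add: selfadjoint_op_def clinear_op_def)
qed

text \<open>
  The norm of a self-adjoint operator is controlled by its quadratic form: polarize \<open>\<langle>S x, y\<rangle>\<close> for
  the multiple \<open>y\<close> of \<open>S x\<close> that is as long as \<open>x\<close>, and use the parallelogram law.
\<close>

lemma norm_selfadjoint_le:
  assumes S: "selfadjoint_op S" and c: "\<And>x. \<bar>qform S x\<bar> \<le> c * (norm x)\<^sup>2" and c0: "0 \<le> c"
  shows "norm S \<le> c"
proof (rule norm_blinfun_bound [OF c0])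
  fix x
  show "norm (S x) \<le> c * norm x"
  proof (cases "S x = 0 \<or> x = 0")
    case False
    define r where "r = norm x / norm (S x)"
    define y where "y = r *\<^sub>R S x"
    have r: "0 < r" and nx: "0 < norm x" and nS: "0 < norm (S x)" using False by (auto simp: r_def)
    have ny: "norm y = norm x" using nS by (simp add: y_def r_def)
    have par: "(norm (x + y))\<^sup>2 + (norm (x - y))\<^sup>2 = 2 * (norm x)\<^sup>2 + 2 * (norm y)\<^sup>2"
    proof -
      have "complex_of_real ((norm (x + y))\<^sup>2 + (norm (x - y))\<^sup>2) = of_real (2 * (norm x)\<^sup>2 + 2 * (norm y)\<^sup>2)"
        unfolding of_real_add of_real_mult cinner_self [symmetric] by (simp add: cinner_simps)
      then show ?thesis using of_real_eq_iff by blast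
    qed
    have "Re (cinner (S x) y) = r * (norm (S x))\<^sup>2"
      by (simp add: y_def cinner_simps cinner_self del: of_real_power)
    then have e: "Re (cinner (S x) y) = norm x * norm (S x)"
      using nS by (simp add: r_def power2_eq_square)
    have "4 * (norm x * norm (S x)) \<le> c * (norm (x + y))\<^sup>2 + c * (norm (x - y))\<^sup>2"
      using polarization_Re [OF S, of x y] c [of "x + y"] c [of "x - y"] e by linarith
    also have "\<dots> = 4 * (norm x * (c * norm x))"
      using par unfolding ny by (simp add: distrib_left [symmetric] power2_eq_square)
    finally show ?thesis using nx by simp
  qed (use c0 in auto)
qed

section \<open>Invertibility and spectra of self-adjoint operators\<close>

lemma compose_add_left: "(A + B) o\<^sub>L C = (A o\<^sub>L C) + (B o\<^sub>L C)"
  by (rule bounded_bilinear.add_left [OF bounded_bilinear_blinfun_compose])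
lemma compose_add_right: "C o\<^sub>L (A + B) = (C o\<^sub>L A) + (C o\<^sub>L B)"
  by (rule bounded_bilinear.add_right [OF bounded_bilinear_blinfun_compose])
lemma compose_diff_left: "(A - B) o\<^sub>L C = (A o\<^sub>L C) - (B o\<^sub>L C)"
  by (rule bounded_bilinear.diff_left [OF bounded_bilinear_blinfun_compose])
lemma compose_diff_right: "C o\<^sub>L (A - B) = (C o\<^sub>L A) - (C o\<^sub>L B)"
  by (rule bounded_bilinear.diff_right [OF bounded_bilinear_blinfun_compose])
lemma compose_scaleR_left: "(r *\<^sub>R A) o\<^sub>L C = r *\<^sub>R (A o\<^sub>L C)"
  by (rule bounded_bilinear.scaleR_left [OF bounded_bilinear_blinfun_compose])
lemma compose_scaleR_right: "C o\<^sub>L (r *\<^sub>R A) = r *\<^sub>R (C o\<^sub>L A)"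
  by (rule bounded_bilinear.scaleR_right [OF bounded_bilinear_blinfun_compose])
lemma compose_id_left [simp]: "id_blinfun o\<^sub>L A = A"
  by (simp add: blinfun_eqI)
lemma compose_id_right [simp]: "A o\<^sub>L id_blinfun = A"
  by (simp add: blinfun_eqI)

lemma compose_assoc: "(A o\<^sub>L B) o\<^sub>L C = A o\<^sub>L (B o\<^sub>L C)"
  by (simp add: blinfun_eqI)

lemmas compose_simps = compose_add_left compose_add_right compose_diff_left compose_diff_right
  compose_scaleR_left compose_scaleR_right

lemma scalar_op_of_real: "scalar_op (complex_of_real t) = t *\<^sub>R id_blinfun"
  by (rule blinfun_eqI) (simp add: scalar_op.rep_eq blinfun.scaleR_left scaleR_scaleC)

lemma invertible_op_compose:
  assumes "invertible_op A" "invertible_op B"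
  shows "invertible_op (A o\<^sub>L B)"
proof -
  obtain C D where "clinear_op C" "A o\<^sub>L C = id_blinfun" "C o\<^sub>L A = id_blinfun"
      "clinear_op D" "B o\<^sub>L D = id_blinfun" "D o\<^sub>L B = id_blinfun"
    using assms by (auto simp: invertible_op_def)
  then have "clinear_op (D o\<^sub>L C)" "(A o\<^sub>L B) o\<^sub>L (D o\<^sub>L C) = id_blinfun"
      "(D o\<^sub>L C) o\<^sub>L (A o\<^sub>L B) = id_blinfun"
    by (auto simp: clinear_op_intros) (metis compose_assoc compose_id_right)+
  then show ?thesis unfolding invertible_op_def by blast
qed

lemma invertible_op_scaleR_id: "c \<noteq> 0 \<Longrightarrow> invertible_op (c *\<^sub>R id_blinfun)"
  unfolding invertible_op_def
  by (intro exI [of _ "inverse c *\<^sub>R id_blinfun"]) (simp add: compose_simps clinear_op_intros)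

lemma invertible_op_scalar_op: "z \<noteq> 0 \<Longrightarrow> invertible_op (scalar_op z)"
  unfolding invertible_op_def
  by (intro exI [of _ "scalar_op (inverse z)"])
    (auto simp: clinear_op_intros scalar_op.rep_eq scaleC_scaleC intro!: blinfun_eqI)

text \<open>
  The Lax--Milgram lemma: for small \<open>\<epsilon>\<close> the map \<open>x \<mapsto> x - \<epsilon> (P x - y)\<close> is a contraction, and its
  fixed point solves \<open>P x = y\<close>.
\<close>

lemma coercive_invertible:
  fixes P :: "'h :: chilbert_space \<Rightarrow>\<^sub>L 'h"
  assumes lin: "clinear_op P" and d: "0 < d" and coercive: "\<And>x. d * (norm x)\<^sup>2 \<le> qform P x"
  shows "invertible_op P"
proof -
  define M where "M = norm P + d"
  \<comment> \<open>This step size minimizes \<open>1 - 2 e d + e\<^sup>2 M\<^sup>2\<close>, the bound for the squared contraction factor.\<close>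
  define e where "e = d / M\<^sup>2"
  define c where "c = sqrt (1 - d\<^sup>2 / M\<^sup>2)"
  have M: "0 < M" "d \<le> M" using d by (auto simp: M_def add_nonneg_pos)
  have e: "0 < e" using d M by (simp add: e_def)
  have dM: "d\<^sup>2 \<le> M\<^sup>2" "0 < d\<^sup>2 / M\<^sup>2" using d M by (auto simp: power_mono)
  have c: "0 \<le> c" "c < 1" "c\<^sup>2 = 1 - d\<^sup>2 / M\<^sup>2"
    using dM M by (simp_all add: c_def)
  have below: "d * norm x \<le> norm (P x)" for x
  proof (cases "x = 0")
    case False
    have "d * (norm x)\<^sup>2 \<le> norm (P x) * norm x"
      using coercive [of x] order_trans [OF abs_Re_le_cmod Cauchy_Schwarz_cinner, of "P x" x]
      unfolding qform_def by linarith
    then have "(d * norm x) * norm x \<le> norm (P x) * norm x" by (simp add: power2_eq_square mult.assoc)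
    then show ?thesis by (rule mult_right_le_imp_le) (use False in simp)
  qed simp
  have inj: "inj (blinfun_apply P)"
  proof (rule injI)
    fix x y assume "P x = P y"
    then have "d * norm (x - y) \<le> 0" using below [of "x - y"] by (simp add: blinfun.diff_right)
    then show "x = y" using d by (simp add: mult_le_0_iff)
  qed
  have contr: "norm (x - e *\<^sub>R P x) \<le> c * norm x" for x
  proof (rule power2_le_imp_le)
    have "complex_of_real ((norm (x - e *\<^sub>R P x))\<^sup>2)
        = cinner x x - of_real e * (cinner (P x) x + cnj (cinner (P x) x)) + of_real (e\<^sup>2) * cinner (P x) (P x)"
      unfolding cinner_self [symmetric]
      by (simp add: cinner_simps algebra_simps power2_eq_square cinner_commute [of x "P x"])
    also have "\<dots> = of_real ((norm x)\<^sup>2 - 2 * e * qform P x + e\<^sup>2 * (norm (P x))\<^sup>2)"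
      by (simp add: complex_add_cnj cinner_self qform_def del: of_real_power) 
    finally have "(norm (x - e *\<^sub>R P x))\<^sup>2 = (norm x)\<^sup>2 - 2 * e * qform P x + e\<^sup>2 * (norm (P x))\<^sup>2"
      using of_real_eq_iff by blast
    also have "\<dots> \<le> (norm x)\<^sup>2 - 2 * e * (d * (norm x)\<^sup>2) + e\<^sup>2 * (M * norm x)\<^sup>2"
    proof -
      have "norm (P x) \<le> M * norm x"
        using norm_blinfun [of P x] d mult_right_mono [of "norm P" M "norm x"] by (simp add: M_def)
      then have "(norm (P x))\<^sup>2 \<le> (M * norm x)\<^sup>2" by (intro power_mono) auto
      then have "e\<^sup>2 * (norm (P x))\<^sup>2 \<le> e\<^sup>2 * (M * norm x)\<^sup>2" by (intro mult_left_mono) auto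
      moreover have "2 * e * (d * (norm x)\<^sup>2) \<le> 2 * e * qform P x"
        using coercive [of x] e by (intro mult_left_mono) auto
      ultimately show ?thesis by linarith
    qed
    also have "\<dots> = (c * norm x)\<^sup>2"
      using M unfolding power_mult_distrib c(3) e_def by (simp add: field_simps power2_eq_square)
    finally show "(norm (x - e *\<^sub>R P x))\<^sup>2 \<le> (c * norm x)\<^sup>2" .
  qed (use c in simp)
  have surj: "\<exists>x. P x = y" for y
  proof -
    have "\<exists>!x. x - e *\<^sub>R (P x - y) = x"
    proof (rule banach_fix_type [OF c(1,2)], intro allI)
      fix x x'
      have "x - e *\<^sub>R (P x - y) - (x' - e *\<^sub>R (P x' - y)) = (x - x') - e *\<^sub>R P (x - x')"
        by (simp add: blinfun.diff_right scaleR_diff_right)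
      then show "dist (x - e *\<^sub>R (P x - y)) (x' - e *\<^sub>R (P x' - y)) \<le> c * dist x x'"
        using contr [of "x - x'"] unfolding dist_norm by (simp only:)
    qed
    then obtain x where "x - e *\<^sub>R (P x - y) = x" by auto
    then have "P x = y" using e by simp
    then show ?thesis ..
  qed
  define g where "g = inv (blinfun_apply P)"
  have Pg: "P (g y) = y" for y
    using surj [of y] by (auto simp: g_def inv_f_f [OF inj])
  have gP: "g (P x) = x" for x
    by (simp add: g_def inj)
  have bl: "bounded_linear g"
  proof (rule bounded_linear_intro [where K = "1 / d"])
    show "g (x + y) = g x + g y" for x y
      by (rule injD [OF inj]) (simp add: Pg blinfun.add_right)
    show "g (r *\<^sub>R x) = r *\<^sub>R g x" for r x
      by (rule injD [OF inj]) (simp add: Pg blinfun.scaleR_right)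
    show "norm (g x) \<le> norm x * (1 / d)" for x
      using below [of "g x"] d by (simp add: Pg field_simps)
  qed
  define C where "C = Blinfun g"
  have C: "blinfun_apply C = g" by (simp add: C_def bounded_linear_Blinfun_apply bl)
  have "clinear_op C"
    unfolding clinear_op_def C
  proof (intro allI)
    show "g (c *\<^sub>C x) = c *\<^sub>C g x" for c x
      by (rule injD [OF inj]) (simp add: Pg clinear_opD [OF lin])
  qed
  moreover have "P o\<^sub>L C = id_blinfun" "C o\<^sub>L P = id_blinfun"
    by (auto intro!: blinfun_eqI simp: C Pg gP)
  ultimately show ?thesis unfolding invertible_op_def by blast
qed

text \<open>
  Invertibility bounds \<open>\<parallel>x\<parallel>\<close> by \<open>\<parallel>P x\<parallel>\<close>, and \<open>\<parallel>P x\<parallel>\<^sup>2\<close> is at most \<open>\<parallel>P\<parallel>\<close> times the form.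
\<close>

lemma positive_invertible_coercive:
  assumes P: "positive_op P" and inv: "invertible_op P"
  obtains d where "0 < d" "\<And>x. d * (norm x)\<^sup>2 \<le> qform P x"
proof -
  obtain C where C: "C o\<^sub>L P = id_blinfun" using inv by (auto simp: invertible_op_def)
  define K where "K = (norm P + 1) * (norm C + 1)\<^sup>2"
  have K: "0 < K" unfolding K_def by (intro mult_pos_pos zero_less_power add_nonneg_pos) auto
  have "1 / K * (norm x)\<^sup>2 \<le> qform P x" for x
  proof -
    have q: "0 \<le> qform P x" using P by (simp add: positive_op_iff)
    have "x = C (P x)" by (metis C blinfun_apply_blinfun_compose blinfun_apply_id_blinfun)
    then have "norm x \<le> norm C * norm (P x)" by (metis norm_blinfun)
    also have "\<dots> \<le> (norm C + 1) * norm (P x)" by (intro mult_right_mono) auto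
    finally have "(norm x)\<^sup>2 \<le> ((norm C + 1) * norm (P x))\<^sup>2" by (intro power_mono) auto
    also have "\<dots> \<le> (norm C + 1)\<^sup>2 * (norm P * qform P x)"
      unfolding power_mult_distrib by (intro mult_left_mono positive_op_norm_le P) auto
    also have "\<dots> \<le> (norm C + 1)\<^sup>2 * ((norm P + 1) * qform P x)"
      using q by (intro mult_left_mono mult_right_mono) auto
    finally show ?thesis using K by (simp add: K_def field_simps)
  qed
  with K show ?thesis by (intro that [of "1 / K"]) auto
qed

definition real_spectrum :: "('h :: chilbert_space \<Rightarrow>\<^sub>L 'h) \<Rightarrow> real set" where
  "real_spectrum A = {t. complex_of_real t \<in> spectrum A}"

lemma real_spectrum_iff: "t \<in> real_spectrum A \<longleftrightarrow> \<not> invertible_op (A - t *\<^sub>R id_blinfun)"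
  by (simp add: real_spectrum_def spectrum_def scalar_op_of_real)

text \<open>
  If \<open>z\<close> is not real, then multiplication by \<open>\<i> / Im z\<close> turns \<open>T - z\<close> into an operator whose form has
  real part \<open>\<parallel>x\<parallel>\<^sup>2\<close>.
\<close>

lemma spectrum_selfadjoint_real:
  assumes T: "selfadjoint_op T" and z: "z \<in> spectrum T"
  shows "z \<in> \<real>"
proof (rule ccontr)
  assume "z \<notin> \<real>"
  then have y: "Im z \<noteq> 0" by (simp add: complex_is_Real_iff)
  define u where "u = \<i> / of_real (Im z)"
  define W where "W = scalar_op u o\<^sub>L (T - scalar_op z)"
  have "qform W x = (norm x)\<^sup>2" for x
  proof -
    have "cinner (W x) x = u * (cinner (T x) x - z * cinner x x)"
      by (simp add: W_def scalar_op.rep_eq blinfun.bilinear_simps cinner_simps)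
    then have "qform W x = Re (u * (of_real (qform T x) - z * of_real ((norm x)\<^sup>2)))"
      unfolding qform_def [of W] by (simp add: cinner_selfadjoint_real [OF T] cinner_self)
    then show ?thesis using y by (simp add: u_def Re_divide power2_eq_square)
  qed
  then have "invertible_op W"
    by (intro coercive_invertible [of W 1]) (auto simp: W_def intro!: clinear_op_intros selfadjoint_clinear [OF T])
  then have "invertible_op (scalar_op (inverse u) o\<^sub>L W)"
    using y by (intro invertible_op_compose invertible_op_scalar_op) (auto simp: u_def)
  moreover have "scalar_op (inverse u) o\<^sub>L W = T - scalar_op z"
    using y by (auto intro!: blinfun_eqI simp: W_def scalar_op.rep_eq scaleC_scaleC u_def)
  ultimately show False using z by (simp add: spectrum_def)
qed

text \<open>
  Bounds \<open>a \<le> T \<le> b\<close> in the sense of forms. They enclose the spectrum in \<open>{a..b}\<close>, so that a function continuous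
  on \<open>{a..b}\<close> can be applied to \<open>T\<close>, and unlike the spectrum they are easily followed through sums.
\<close>

definition form_between :: "real \<Rightarrow> real \<Rightarrow> ('h :: chilbert_space \<Rightarrow>\<^sub>L 'h) \<Rightarrow> bool" where
  "form_between a b T \<longleftrightarrow>
     selfadjoint_op T \<and> (\<forall>x. a * (norm x)\<^sup>2 \<le> qform T x \<and> qform T x \<le> b * (norm x)\<^sup>2)"

lemma form_between_selfadjoint: "form_between a b T \<Longrightarrow> selfadjoint_op T"
  by (simp add: form_between_def)

lemma real_spectrum_between:
  assumes "form_between a b T"
  shows "real_spectrum T \<subseteq> {a..b}"
proof
  fix t assume t: "t \<in> real_spectrum T"
  have T: "selfadjoint_op T" and lo: "a * (norm x)\<^sup>2 \<le> qform T x" and hi: "qform T x \<le> b * (norm x)\<^sup>2" for x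
    using assms by (auto simp: form_between_def)
  have "a \<le> t"
  proof (rule ccontr)
    assume "\<not> a \<le> t"
    then have "invertible_op (T - t *\<^sub>R id_blinfun)"
      using lo by (intro coercive_invertible [of _ "a - t"])
        (auto simp: qform_simps left_diff_distrib intro!: clinear_op_intros selfadjoint_clinear [OF T])
    then show False using t by (simp add: real_spectrum_iff)
  qed
  moreover have "t \<le> b"
  proof (rule ccontr)
    assume "\<not> t \<le> b"
    then have "invertible_op (t *\<^sub>R id_blinfun - T)"
      using hi by (intro coercive_invertible [of _ "t - b"])
        (auto simp: qform_simps left_diff_distrib intro!: clinear_op_intros selfadjoint_clinear [OF T])
    then have "invertible_op (((-1) *\<^sub>R id_blinfun) o\<^sub>L (t *\<^sub>R id_blinfun - T))"
      by (intro invertible_op_compose invertible_op_scaleR_id) auto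
    moreover have "((-1) *\<^sub>R id_blinfun) o\<^sub>L (t *\<^sub>R id_blinfun - T) = T - t *\<^sub>R id_blinfun"
      by (auto intro!: blinfun_eqI simp: blinfun.bilinear_simps)
    ultimately show False using t by (simp add: real_spectrum_iff)
  qed
  ultimately show "t \<in> {a..b}" by simp
qed

lemma spectrum_between:
  assumes "form_between a b T"
  shows "spectrum T \<subseteq> complex_of_real ` {a..b}"
proof
  fix z assume z: "z \<in> spectrum T"
  then obtain t where "z = of_real t"
    using spectrum_selfadjoint_real [OF form_between_selfadjoint [OF assms]] by (auto elim: Reals_cases)
  then show "z \<in> complex_of_real ` {a..b}"
    using z real_spectrum_between [OF assms] by (auto simp: real_spectrum_def)
qed

text \<open>
  Among the shifts \<open>c \<ge> 0\<close> making \<open>S + c\<close> positive there is a smallest one. If it were positive,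
  \<open>S + c\<close> would be positive and invertible, hence bounded below, and a smaller shift would do.
\<close>

lemma positive_if_shifts_invertible:
  assumes S: "selfadjoint_op S" and inv: "\<And>c. 0 < c \<Longrightarrow> invertible_op (S + c *\<^sub>R id_blinfun)"
  shows "positive_op S"
proof -
  define K where "K = {c. 0 \<le> c \<and> (\<forall>x. 0 \<le> qform S x + c * (norm x)\<^sup>2)}"
  have "norm S \<in> K"
    using qform_abs_le [of S] by (auto simp: K_def) (smt (verit))
  then have ne: "K \<noteq> {}" by auto
  have bdd: "bdd_below K" by (rule bdd_belowI [of _ 0]) (simp add: K_def)
  define c where "c = Inf K"
  have cK: "c \<in> K"
    unfolding K_def mem_Collect_eq
  proof (intro conjI allI)
    show "0 \<le> c" unfolding c_def by (rule cInf_greatest [OF ne]) (simp add: K_def)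
    fix x
    show "0 \<le> qform S x + c * (norm x)\<^sup>2"
    proof (cases "x = 0")
      case False
      have "- qform S x / (norm x)\<^sup>2 \<le> c"
        unfolding c_def
      proof (rule cInf_greatest [OF ne])
        fix k assume "k \<in> K"
        then have "0 \<le> qform S x + k * (norm x)\<^sup>2" by (simp add: K_def)
        then have "- qform S x \<le> k * (norm x)\<^sup>2" by simp
        then show "- qform S x / (norm x)\<^sup>2 \<le> k" by (subst pos_divide_le_eq) (use False in auto)
      qed
      then have "- qform S x \<le> c * (norm x)\<^sup>2" by (subst (asm) pos_divide_le_eq) (use False in auto)
      then show ?thesis by simp
    qed (simp add: qform_def)
  qed
  have "c = 0"
  proof (rule ccontr)
    assume "c \<noteq> 0"
    then have c0: "0 < c" using cK by (simp add: K_def)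
    have "positive_op (S + c *\<^sub>R id_blinfun)"
      using cK S by (auto simp: positive_op_iff K_def qform_simps intro!: selfadjoint_op_intros)
    then obtain d where d: "0 < d" "\<And>x. d * (norm x)\<^sup>2 \<le> qform (S + c *\<^sub>R id_blinfun) x"
      using positive_invertible_coercive inv [OF c0] by blast
    define k where "k = max 0 (c - d)"
    have "k \<in> K"
    proof -
      have "0 \<le> qform S x + k * (norm x)\<^sup>2" for x
      proof -
        have "(c - d) * (norm x)\<^sup>2 \<le> k * (norm x)\<^sup>2" by (intro mult_right_mono) (auto simp: k_def)
        then show ?thesis using d(2) [of x] by (simp add: qform_simps left_diff_distrib)
      qed
      then show ?thesis by (simp add: K_def k_def)
    qed
    then have "c \<le> k" unfolding c_def by (rule cInf_lower [OF _ bdd])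
    then show False using c0 d(1) by (simp add: k_def)
  qed
  then show ?thesis using cK S by (simp add: K_def positive_op_iff)
qed

section \<open>Polynomials of a self-adjoint operator\<close>

lemma poly_op_eq_sum:
  assumes "degree p \<le> n"
  shows "poly_op p A = (\<Sum>i\<le>n. coeff p i *\<^sub>R ((\<lambda>T. A o\<^sub>L T) ^^ i) id_blinfun)"
  unfolding poly_op_def
  by (rule sum.mono_neutral_left) (use assms in \<open>auto simp: coeff_eq_0\<close>)

lemma poly_op_0 [simp]: "poly_op 0 A = 0"
  by (simp add: poly_op_def)

lemma poly_op_add: "poly_op (p + q) A = poly_op p A + poly_op q A"
  using degree_add_le_max [of p q]
  by (simp add: poly_op_eq_sum [of _ "max (degree p) (degree q)"] scaleR_add_left sum.distrib)

lemma poly_op_smult: "poly_op (smult c p) A = c *\<^sub>R poly_op p A"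
  using degree_smult_le [of c p]
  by (simp add: poly_op_eq_sum [of _ "degree p"] scaleR_sum_right)

lemma poly_op_diff: "poly_op (p - q) A = poly_op p A - poly_op q A"
  by (simp add: poly_op_eq_sum [of _ "max (degree p) (degree q)"] degree_diff_le
      scaleR_diff_left sum_subtractf)

lemma poly_op_pCons: "poly_op (pCons a p) A = a *\<^sub>R id_blinfun + (A o\<^sub>L poly_op p A)"
proof -
  have "poly_op (pCons a p) A = (\<Sum>i\<le>Suc (degree p). coeff (pCons a p) i *\<^sub>R ((\<lambda>T. A o\<^sub>L T) ^^ i) id_blinfun)"
    by (rule poly_op_eq_sum) (simp add: degree_pCons_le)
  also have "\<dots> = a *\<^sub>R id_blinfun + (\<Sum>i\<le>degree p. coeff p i *\<^sub>R (A o\<^sub>L ((\<lambda>T. A o\<^sub>L T) ^^ i) id_blinfun))"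
    by (simp add: sum.atMost_Suc_shift del: sum.atMost_Suc)
  also have "(\<Sum>i\<le>degree p. coeff p i *\<^sub>R (A o\<^sub>L ((\<lambda>T. A o\<^sub>L T) ^^ i) id_blinfun)) = A o\<^sub>L poly_op p A"
    by (simp add: poly_op_def bounded_bilinear.sum_right [OF bounded_bilinear_blinfun_compose] compose_scaleR_right)
  finally show ?thesis .
qed

lemma poly_op_const: "poly_op [:c:] A = c *\<^sub>R id_blinfun"
  by (simp add: poly_op_pCons)

lemma poly_op_mult: "poly_op (p * q) A = poly_op p A o\<^sub>L poly_op q A"
  by (induction p) (simp_all add: poly_op_pCons poly_op_add poly_op_smult compose_simps compose_assoc)

lemma poly_op_commute: "poly_op p A o\<^sub>L poly_op q A = poly_op q A o\<^sub>L poly_op p A"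
  by (metis mult.commute poly_op_mult)

lemma poly_op_X: "poly_op [:0, 1:] A = A"
  by (simp add: poly_op_pCons)

lemma selfadjoint_poly_op:
  assumes "selfadjoint_op T"
  shows "selfadjoint_op (poly_op p T)"
proof (induction p)
  case 0
  show ?case using selfadjoint_op_intros(4) [OF assms, of 0] by simp
next
  case (pCons a p)
  have "T o\<^sub>L poly_op p T = poly_op p T o\<^sub>L T"
    by (metis poly_op_X poly_op_commute)
  then show ?case
    unfolding poly_op_pCons
    by (intro selfadjoint_op_intros selfadjoint_op_compose_commute assms pCons)
qed

lemma poly_op_eigenvector: "blinfun_apply T x = t *\<^sub>R x \<Longrightarrow> blinfun_apply (poly_op p T) x = poly p t *\<^sub>R x"
  by (induction p) (simp_all add: poly_op_pCons blinfun.bilinear_simps scaleR_add_left)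

lemma map_poly_of_real_add:
  "map_poly complex_of_real (p + q) = map_poly of_real p + map_poly of_real q"
  by (rule poly_eqI) (simp add: coeff_map_poly)

lemma map_poly_of_real_mult:
  "map_poly complex_of_real (p * q) = map_poly of_real p * map_poly of_real q"
  by (induction p) (simp_all add: map_poly_pCons map_poly_of_real_add map_poly_smult)

lemma poly_map_poly_of_real: "poly (map_poly complex_of_real p) (of_real x) = of_real (poly p x)"
  by (induction p) (simp_all add: map_poly_pCons)

lemma real_poly_factor:
  fixes p :: "real poly"
  assumes "0 < degree p"
  obtains c r where "p = [:- c, 1:] * r"
  | a b r where "b \<noteq> 0" "p = [:a\<^sup>2 + b\<^sup>2, - 2 * a, 1:] * r"
proof -
  let ?P = "map_poly complex_of_real p"
  have "degree ?P = degree p" by (rule degree_map_poly) simp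
  then have "\<not> constant (poly ?P)"
    using assms by (simp add: constant_degree)
  then obtain z where z: "poly ?P z = 0"
    using fundamental_theorem_of_algebra by blast
  show thesis
  proof (cases "Im z = 0")
    case True
    then have "z = of_real (Re z)" by (simp add: complex_eq_iff)
    then have "complex_of_real (poly p (Re z)) = 0" using z by (metis poly_map_poly_of_real)
    then have "[:- Re z, 1:] dvd p" by (simp add: poly_eq_0_iff_dvd)
    then show thesis using that(1) by (auto elim: dvdE)
  next
    case False
    define q where "q = [:(Re z)\<^sup>2 + (Im z)\<^sup>2, - 2 * Re z, 1:]"
    have q: "degree q = 2" by (simp add: q_def)
    have qz: "poly (map_poly complex_of_real q) z = 0"
      by (simp add: q_def map_poly_pCons complex_eq_iff power2_eq_square algebra_simps)
    have q0: "q \<noteq> 0" by (simp add: q_def)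
    have deg: "degree (p mod q) \<le> 1"
      using degree_mod_less [OF q0, of p] q by auto
    define u where "u = coeff (p mod q) 0"
    define v where "v = coeff (p mod q) 1"
    have uv: "p mod q = [:u, v:]"
      by (rule poly_eqI) (use deg in \<open>auto simp: u_def v_def coeff_pCons intro!: coeff_eq_0 split: nat.split\<close>)
    have "map_poly complex_of_real p
        = map_poly of_real (p div q) * map_poly of_real q + map_poly of_real (p mod q)"
      by (metis div_mult_mod_eq map_poly_of_real_add map_poly_of_real_mult)
    then have "poly (map_poly complex_of_real (p mod q)) z = 0"
      using z qz by simp
    then have "of_real u + z * of_real v = 0" by (simp add: uv map_poly_pCons)
    then have "v = 0" "u = 0" using False by (auto simp: complex_eq_iff)
    then have "p mod q = 0" by (simp add: uv)
    then have "p = q * (p div q)" by (metis add.right_neutral mult_div_mod_eq)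
    then show thesis using that(2) [of "Im z" "Re z"] False by (simp add: q_def)
  qed
qed

text \<open>
  Spectral mapping, in the form needed here: factor \<open>p\<close> over the reals. A linear factor is
  invertible at \<open>T\<close> because its root is not in the spectrum, a factor \<open>(t - a)\<^sup>2 + b\<^sup>2\<close> because
  it is coercive.
\<close>

lemma invertible_poly_op:
  assumes T: "selfadjoint_op T" and "p \<noteq> 0" "\<And>t. t \<in> real_spectrum T \<Longrightarrow> poly p t \<noteq> 0"
  shows "invertible_op (poly_op p T)"
  using assms(2,3)
proof (induction "degree p" arbitrary: p rule: less_induct)
  case less
  show ?case
  proof (cases "degree p = 0")
    case True
    then obtain c where "p = [:c:]" by (rule degree_eq_zeroE)
    then show ?thesis using less.prems(1) by (simp add: poly_op_const invertible_op_scaleR_id)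
  next
    case False
    then have "0 < degree p" by simp
    then show ?thesis
    proof (cases rule: real_poly_factor)
      case (1 c r)
      have r: "r \<noteq> 0" using less.prems(1) 1 by auto
      have "degree p = Suc (degree r)" unfolding 1 by (subst degree_mult_eq) (use r in auto)
      then have "invertible_op (poly_op r T)"
        using less.hyps [of r] r less.prems(2) unfolding 1 by auto
      moreover have "invertible_op (poly_op [:- c, 1:] T)"
      proof -
        have "c \<notin> real_spectrum T" using less.prems(2) [of c] unfolding 1 by auto
        moreover have "poly_op [:- c, 1:] T = T - c *\<^sub>R id_blinfun" by (simp add: poly_op_pCons)
        ultimately show ?thesis by (simp add: real_spectrum_iff)
      qed
      ultimately show ?thesis unfolding 1 poly_op_mult by (intro invertible_op_compose)
    next
      case (2 a b r)
      define Q where "Q = [:a\<^sup>2 + b\<^sup>2, - 2 * a, 1:]"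
      have p: "p = Q * r" unfolding Q_def by (rule 2(2))
      have r: "r \<noteq> 0" "Q \<noteq> 0" using less.prems(1) by (auto simp: p)
      have "degree Q = 2" by (simp add: Q_def)
      then have "degree r < degree p" by (simp add: p degree_mult_eq r)
      then have "invertible_op (poly_op r T)"
        by (rule less.hyps) (use r less.prems(2) in \<open>auto simp: p\<close>)
      moreover have "invertible_op (poly_op Q T)"
      proof (rule coercive_invertible [of _ "b\<^sup>2"])
        show "clinear_op (poly_op Q T)"
          by (intro selfadjoint_clinear selfadjoint_poly_op T)
        show "0 < b\<^sup>2" using 2 by simp
        fix x
        let ?S = "T - a *\<^sub>R id_blinfun"
        have S: "selfadjoint_op ?S" by (intro selfadjoint_op_intros T)
        have "poly_op Q T = (?S o\<^sub>L id_blinfun o\<^sub>L ?S) + b\<^sup>2 *\<^sub>R id_blinfun"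
          by (simp add: Q_def poly_op_pCons compose_simps algebra_simps power2_eq_square scaleR_2 flip: scaleR_scaleR)
        then show "b\<^sup>2 * (norm x)\<^sup>2 \<le> qform (poly_op Q T) x"
          by (simp only: qform_simps qform_sandwich [OF S]) simp
      qed
      ultimately show ?thesis unfolding p poly_op_mult by (intro invertible_op_compose)
    qed
  qed
qed

text \<open>
  If the spectrum were empty, all translates of \<open>T\<close> would be invertible, and \<open>T - (\<parallel>T\<parallel> + 1)\<close> would be
  positive.
\<close>

lemma real_spectrum_nonempty:
  assumes T: "selfadjoint_op (T :: 'h :: chilbert_space \<Rightarrow>\<^sub>L 'h)" and x: "(x :: 'h) \<noteq> 0"
  shows "real_spectrum T \<noteq> {}"
proof
  assume empty: "real_spectrum T = {}"
  define S where "S = T - (norm T + 1) *\<^sub>R id_blinfun"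
  have "invertible_op (S + c *\<^sub>R id_blinfun)" for c
  proof -
    have "S + c *\<^sub>R id_blinfun = T - (norm T + 1 - c) *\<^sub>R id_blinfun"
      by (simp add: S_def algebra_simps)
    then show ?thesis using empty real_spectrum_iff [of "norm T + 1 - c" T] by auto
  qed
  moreover have "selfadjoint_op S" unfolding S_def by (intro selfadjoint_op_intros T)
  ultimately have "positive_op S" by (intro positive_if_shifts_invertible)
  then have "0 \<le> qform S x" by (simp add: positive_op_iff)
  then have "(norm x)\<^sup>2 \<le> 0"
    using qform_abs_le [of T x] unfolding S_def qform_simps distrib_right by linarith
  then show False using x by simp
qed

text \<open>
  By spectral mapping, \<open>p(T) + c\<close> is invertible for all \<open>c > 0\<close>. An empty spectrum has to be treated
  separately, because then \<open>p + c\<close> may be the zero polynomial; this happens only on the zero space.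
\<close>

lemma positive_poly_op:
  assumes T: "selfadjoint_op T" and nn: "\<And>t. t \<in> real_spectrum T \<Longrightarrow> 0 \<le> poly p t"
  shows "positive_op (poly_op p T)"
proof (cases "real_spectrum T = {}")
  case True
  then have "x = 0" for x :: 'a using real_spectrum_nonempty [OF T] by blast
  then have "qform (poly_op p T) x = 0" for x by (metis cinner_zero_right qform_def zero_complex.sel(1))
  then show ?thesis using selfadjoint_poly_op [OF T] by (simp add: positive_op_iff)
next
  case False
  show ?thesis
  proof (rule positive_if_shifts_invertible [OF selfadjoint_poly_op [OF T]])
    fix c :: real assume c: "0 < c"
    have "invertible_op (poly_op (p + [:c:]) T)"
    proof (rule invertible_poly_op [OF T])
      show *: "poly (p + [:c:]) t \<noteq> 0" if "t \<in> real_spectrum T" for t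
        using nn [OF that] c by simp
      then show "p + [:c:] \<noteq> 0" using False by (metis all_not_in_conv poly_0)
    qed
    then show "invertible_op (poly_op p T + c *\<^sub>R id_blinfun)"
      by (simp add: poly_op_add poly_op_const)
  qed
qed

lemma norm_poly_op_le:
  assumes T: "selfadjoint_op T" and c: "\<And>t. t \<in> real_spectrum T \<Longrightarrow> \<bar>poly p t\<bar> \<le> c" and "0 \<le> c"
  shows "norm (poly_op p T) \<le> c"
proof (rule norm_selfadjoint_le [OF selfadjoint_poly_op [OF T] _ \<open>0 \<le> c\<close>])
  fix x
  have "positive_op (poly_op ([:c:] - p) T)" "positive_op (poly_op ([:c:] + p) T)"
    using c by (intro positive_poly_op [OF T]; force simp: abs_le_iff)+
  then have "0 \<le> qform (poly_op ([:c:] - p) T) x" "0 \<le> qform (poly_op ([:c:] + p) T) x"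
    by (auto simp: positive_op_iff)
  then show "\<bar>qform (poly_op p T) x\<bar> \<le> c * (norm x)\<^sup>2"
    by (simp add: poly_op_add poly_op_diff poly_op_const qform_simps abs_le_iff)
qed

section \<open>The continuous functional calculus\<close>

lemma poly_approx:
  fixes f :: "real \<Rightarrow> real"
  assumes "continuous_on {a..b} f"
  obtains p :: "nat \<Rightarrow> real poly" where "uniform_limit {a..b} (\<lambda>n. poly (p n)) f sequentially"
proof -
  obtain g where g: "uniform_limit {a..b} g f sequentially" "\<And>n. polynomial_function (g n)"
    using Stone_Weierstrass_uniform_limit [OF compact_Icc assms] by blast
  have "\<exists>p. g n = poly p" for n
  proof -
    obtain c m where "g n = (\<lambda>x. \<Sum>i\<le>m. c i * x ^ i)"
      using g(2) [of n] by (auto simp: real_polynomial_function_eq [symmetric] real_polynomial_function_iff_sum)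
    then have "g n = poly (\<Sum>i\<le>m. monom (c i) i)"
      by (simp add: poly_sum poly_monom fun_eq_iff)
    then show ?thesis ..
  qed
  then obtain p where "\<And>n. g n = poly (p n)" by metis
  then have "g = (\<lambda>n. poly (p n))" by (rule ext)
  then show ?thesis using g(1) that by blast
qed

text \<open>
  Two sequences of polynomials with the same uniform limit on the spectrum become equal in the limit when
  evaluated at \<open>T\<close>. Taking \<open>p = q\<close> gives convergence, and the general case shows that the limit
  depends on \<open>f\<close> only, so that \<open>cfc\<close> is well defined.
\<close>

lemma poly_op_uniform_Cauchy:
  assumes T: "selfadjoint_op T"
    and p: "uniform_limit (real_spectrum T) (\<lambda>n. poly (p n)) f sequentially"
    and q: "uniform_limit (real_spectrum T) (\<lambda>n. poly (q n)) f sequentially"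
    and e: "0 < e"
  shows "\<exists>N. \<forall>m\<ge>N. \<forall>n\<ge>N. norm (poly_op (p m) T - poly_op (q n) T) \<le> e"
proof -
  have e2: "0 < e / 2" using e by simp
  obtain N where N: "\<And>n t. N \<le> n \<Longrightarrow> t \<in> real_spectrum T \<Longrightarrow> \<bar>poly (p n) t - f t\<bar> < e / 2"
    using uniform_limitD [OF p e2] by (auto simp: eventually_sequentially dist_real_def)
  obtain M where M: "\<And>n t. M \<le> n \<Longrightarrow> t \<in> real_spectrum T \<Longrightarrow> \<bar>poly (q n) t - f t\<bar> < e / 2"
    using uniform_limitD [OF q e2] by (auto simp: eventually_sequentially dist_real_def)
  have "norm (poly_op (p m) T - poly_op (q n) T) \<le> e" if "max N M \<le> m" "max N M \<le> n" for m n
    unfolding poly_op_diff [symmetric]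
  proof (rule norm_poly_op_le [OF T])
    fix t assume "t \<in> real_spectrum T"
    then show "\<bar>poly (p m - q n) t\<bar> \<le> e"
      using N [of m t] M [of n t] that unfolding poly_diff by (simp add: abs_if split: if_splits)
  qed (use e in simp)
  then show ?thesis by blast
qed

lemma cfc_limit:
  assumes T: "selfadjoint_op T"
    and p: "uniform_limit (real_spectrum T) (\<lambda>n. poly (p n)) f sequentially"
  shows "(\<lambda>n. poly_op (p n) T) \<longlonglongrightarrow> cfc f T"
proof -
  have "Cauchy (\<lambda>n. poly_op (p n) T)"
  proof (rule CauchyI)
    fix e :: real assume e: "0 < e"
    then have "0 < e / 2" by simp
    then obtain N where N: "\<And>m n. N \<le> m \<Longrightarrow> N \<le> n \<Longrightarrow> norm (poly_op (p m) T - poly_op (p n) T) \<le> e / 2"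
      using poly_op_uniform_Cauchy [OF T p p] by blast
    have "norm (poly_op (p m) T - poly_op (p n) T) < e" if "N \<le> m" "N \<le> n" for m n
      using N [OF that] e by linarith
    then show "\<exists>N. \<forall>m\<ge>N. \<forall>n\<ge>N. norm (poly_op (p m) T - poly_op (p n) T) < e" by blast
  qed
  then obtain L where L: "(\<lambda>n. poly_op (p n) T) \<longlonglongrightarrow> L"
    using Cauchy_convergent_iff convergent_def by blast
  have unique: "L' = L" if q: "uniform_limit (real_spectrum T) (\<lambda>n. poly (q n)) f sequentially"
    and L': "(\<lambda>n. poly_op (q n) T) \<longlonglongrightarrow> L'" for q L'
  proof -
    have lim: "(\<lambda>n. poly_op (p n) T - poly_op (q n) T) \<longlonglongrightarrow> L - L'" by (intro tendsto_diff L L')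
    have "norm (L - L') \<le> e" if e: "0 < e" for e
      using Lim_norm_ubound [OF _ lim, of e] poly_op_uniform_Cauchy [OF T p q e]
      by (auto simp: eventually_sequentially)
    then have "norm (L - L') \<le> 0" by (meson dense not_le_imp_less order.strict_iff_not)
    then show ?thesis by simp
  qed
  have "cfc f T = L"
    unfolding cfc_def real_spectrum_def [symmetric]
  proof (intro the_equality exI conjI)
    show "\<And>L'. \<exists>q :: nat \<Rightarrow> real poly. uniform_limit (real_spectrum T) (\<lambda>n. poly (q n)) f sequentially
        \<and> (\<lambda>n. poly_op (q n) T) \<longlonglongrightarrow> L' \<Longrightarrow> L' = L"
      using unique by blast
  qed (rule p, rule L)
  then show ?thesis using L by simp
qed

lemma cfc_approx:
  assumes T: "form_between a b T" and f: "continuous_on {a..b} f"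
  obtains p where "uniform_limit {a..b} (\<lambda>n. poly (p n)) f sequentially"
    "(\<lambda>n. poly_op (p n) T) \<longlonglongrightarrow> cfc f T"
proof -
  obtain p :: "nat \<Rightarrow> real poly" where p: "uniform_limit {a..b} (\<lambda>n. poly (p n)) f sequentially"
    using poly_approx [OF f] by blast
  then show ?thesis
    using cfc_limit [OF form_between_selfadjoint [OF T] uniform_limit_on_subset [OF p real_spectrum_between [OF T]]] that
    by blast
qed

lemma selfadjoint_cfc:
  assumes "form_between a b T" "continuous_on {a..b} f"
  shows "selfadjoint_op (cfc f T)"
  using cfc_approx [OF assms] selfadjoint_op_limit selfadjoint_poly_op form_between_selfadjoint [OF assms(1)]
  by metis

lemma cfc_poly:
  assumes "selfadjoint_op T"
  shows "cfc (poly p) T = poly_op p T"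
  using cfc_limit [OF assms, of "\<lambda>_. p" "poly p"] by (simp add: LIMSEQ_const_iff uniform_limit_const)

lemma cfc_cong:
  assumes T: "form_between a b T" and "\<And>t. t \<in> {a..b} \<Longrightarrow> f t = g t"
  shows "cfc f T = cfc g T"
proof -
  have "uniform_limit {t. complex_of_real t \<in> spectrum T} h f sequentially
      = uniform_limit {t. complex_of_real t \<in> spectrum T} h g sequentially" for h :: "nat \<Rightarrow> real \<Rightarrow> real"
    using real_spectrum_between [OF T] assms(2)
    by (intro uniform_limit_cong) (auto simp: real_spectrum_def)
  then show ?thesis by (simp add: cfc_def)
qed

lemma cfc_add:
  assumes T: "form_between a b T" and f: "continuous_on {a..b} f" and g: "continuous_on {a..b} g"
  shows "cfc (\<lambda>t. f t + g t) T = cfc f T + cfc g T"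
proof -
  note sa = form_between_selfadjoint [OF T]
  obtain p where p: "uniform_limit {a..b} (\<lambda>n. poly (p n)) f sequentially"
      "(\<lambda>n. poly_op (p n) T) \<longlonglongrightarrow> cfc f T" using cfc_approx [OF T f] by blast
  obtain q where q: "uniform_limit {a..b} (\<lambda>n. poly (q n)) g sequentially"
      "(\<lambda>n. poly_op (q n) T) \<longlonglongrightarrow> cfc g T" using cfc_approx [OF T g] by blast
  have "uniform_limit {a..b} (\<lambda>n. poly (p n + q n)) (\<lambda>t. f t + g t) sequentially"
    unfolding fun_eq_iff [THEN iffD2, OF allI, OF poly_add] by (rule uniform_limit_add [OF p(1) q(1)])
  then have "(\<lambda>n. poly_op (p n + q n) T) \<longlonglongrightarrow> cfc (\<lambda>t. f t + g t) T"
    by (rule cfc_limit [OF sa uniform_limit_on_subset [OF _ real_spectrum_between [OF T]]])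
  moreover have "(\<lambda>n. poly_op (p n + q n) T) \<longlonglongrightarrow> cfc f T + cfc g T"
    unfolding poly_op_add by (intro tendsto_add p q)
  ultimately show ?thesis by (rule LIMSEQ_unique)
qed

lemma cfc_mult:
  assumes T: "form_between a b T" and f: "continuous_on {a..b} f" and g: "continuous_on {a..b} g"
  shows "cfc (\<lambda>t. f t * g t) T = cfc f T o\<^sub>L cfc g T"
proof -
  note sa = form_between_selfadjoint [OF T]
  obtain p where p: "uniform_limit {a..b} (\<lambda>n. poly (p n)) f sequentially"
      "(\<lambda>n. poly_op (p n) T) \<longlonglongrightarrow> cfc f T" using cfc_approx [OF T f] by blast
  obtain q where q: "uniform_limit {a..b} (\<lambda>n. poly (q n)) g sequentially"
      "(\<lambda>n. poly_op (q n) T) \<longlonglongrightarrow> cfc g T" using cfc_approx [OF T g] by blast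
  have "bounded (f ` {a..b})" "bounded (g ` {a..b})"
    by (intro compact_imp_bounded compact_continuous_image f g compact_Icc)+
  then have "uniform_limit {a..b} (\<lambda>n t. poly (p n) t * poly (q n) t) (\<lambda>t. f t * g t) sequentially"
    by (intro bounded_bilinear.bounded_uniform_limit [OF bounded_bilinear_mult] p q)
  then have "uniform_limit {a..b} (\<lambda>n. poly (p n * q n)) (\<lambda>t. f t * g t) sequentially"
    unfolding fun_eq_iff [THEN iffD2, OF allI, OF poly_mult] .
  then have "(\<lambda>n. poly_op (p n * q n) T) \<longlonglongrightarrow> cfc (\<lambda>t. f t * g t) T"
    by (rule cfc_limit [OF sa uniform_limit_on_subset [OF _ real_spectrum_between [OF T]]])
  moreover have "(\<lambda>n. poly_op (p n * q n) T) \<longlonglongrightarrow> (cfc f T o\<^sub>L cfc g T)"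
    unfolding poly_op_mult by (intro bounded_bilinear.tendsto [OF bounded_bilinear_blinfun_compose] p q)
  ultimately show ?thesis by (rule LIMSEQ_unique)
qed

lemma cfc_const:
  assumes "selfadjoint_op T"
  shows "cfc (\<lambda>_. c) T = c *\<^sub>R id_blinfun"
proof -
  have "poly [:c:] = (\<lambda>_. c)" by auto
  then show ?thesis using cfc_poly [OF assms, of "[:c:]"] by (simp add: poly_op_const)
qed

lemma cfc_ident:
  assumes "selfadjoint_op T"
  shows "cfc (\<lambda>t. t) T = T"
proof -
  have "poly [:0, 1:] = (\<lambda>t. t :: real)" by auto
  then show ?thesis using cfc_poly [OF assms, of "[:0, 1:]"] by (simp add: poly_op_X)
qed

lemma cfc_scale:
  assumes T: "form_between a b T" and f: "continuous_on {a..b} f"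
  shows "cfc (\<lambda>t. c * f t) T = c *\<^sub>R cfc f T"
  using cfc_mult [OF T continuous_on_const f, of c]
  by (simp add: cfc_const [OF form_between_selfadjoint [OF T]] compose_simps)

lemma cfc_norm_le:
  assumes T: "form_between a b T" and f: "continuous_on {a..b} f"
    and c: "\<And>t. t \<in> {a..b} \<Longrightarrow> \<bar>f t\<bar> \<le> c" and "0 \<le> c"
  shows "norm (cfc f T) \<le> c"
proof (rule field_le_epsilon)
  fix e :: real assume e: "0 < e"
  obtain p where p: "uniform_limit {a..b} (\<lambda>n. poly (p n)) f sequentially"
      "(\<lambda>n. poly_op (p n) T) \<longlonglongrightarrow> cfc f T" using cfc_approx [OF T f] by blast
  have "\<forall>\<^sub>F n in sequentially. norm (poly_op (p n) T) \<le> c + e"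
    using uniform_limitD [OF p(1) e]
  proof eventually_elim
    case (elim n)
    show ?case
    proof (rule norm_poly_op_le [OF form_between_selfadjoint [OF T]])
      fix t assume "t \<in> real_spectrum T"
      then have "t \<in> {a..b}" using real_spectrum_between [OF T] by blast
      then show "\<bar>poly (p n) t\<bar> \<le> c + e"
        using elim c [of t] by (auto simp: dist_real_def) (smt (verit) atLeastAtMost_iff)
    qed (use e \<open>0 \<le> c\<close> in simp)
  qed
  then show "norm (cfc f T) \<le> c + e"
    using Lim_norm_ubound [OF _ p(2)] by simp
qed

lemma cfc_eigenvector:
  assumes T: "form_between a b T" and f: "continuous_on {a..b} f" and t: "t \<in> {a..b}" and x: "T x = t *\<^sub>R x"
  shows "cfc f T x = f t *\<^sub>R x"
proof -
  obtain p where p: "uniform_limit {a..b} (\<lambda>n. poly (p n)) f sequentially"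
      "(\<lambda>n. poly_op (p n) T) \<longlonglongrightarrow> cfc f T" using cfc_approx [OF T f] by blast
  have "(\<lambda>n. poly (p n) t) \<longlonglongrightarrow> f t" by (rule tendsto_uniform_limitI [OF p(1) t])
  then have "(\<lambda>n. poly (p n) t *\<^sub>R x) \<longlonglongrightarrow> f t *\<^sub>R x" by (intro tendsto_intros)
  moreover have "(\<lambda>n. poly_op (p n) T x) \<longlonglongrightarrow> cfc f T x" by (rule tendsto_blinfun_apply_left [OF p(2)])
  ultimately show ?thesis unfolding poly_op_eigenvector [of T, OF x] by (blast intro: LIMSEQ_unique)
qed

section \<open>Operator means and weighted harmonic means\<close>

lemma form_between_mono:
  "form_between a b T \<Longrightarrow> a' \<le> a \<Longrightarrow> b \<le> b' \<Longrightarrow> form_between a' b' T"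
  unfolding form_between_def by (meson mult_right_mono order_trans zero_le_power2)

lemma form_between_norm: "positive_op T \<Longrightarrow> form_between 0 (norm T) T"
  using qform_abs_le [of T] by (auto simp: form_between_def positive_op_iff abs_le_iff)

lemma strictly_positive_form_between:
  assumes "strictly_positive_op T"
  obtains a b where "0 < a" "a \<le> 1" "1 \<le> b" "form_between a b T"
proof -
  have pos: "positive_op T" and inv: "invertible_op T"
    using assms by (auto simp: strictly_positive_op_def)
  obtain d where d: "0 < d" "\<And>x. d * (norm x)\<^sup>2 \<le> qform T x"
    using positive_invertible_coercive [OF pos inv] by blast
  then have "form_between d (norm T) T"
    using form_between_norm [OF pos] by (auto simp: form_between_def)
  then have "form_between (min d 1) (max (norm T) 1) T" by (rule form_between_mono) auto
  then show ?thesis using d by (intro that [of "min d 1" "max (norm T) 1"]) auto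
qed

lemma strictly_positive_if_form_between:
  assumes T: "form_between a b T" and a: "0 < a"
  shows "strictly_positive_op T"
proof -
  have "0 \<le> qform T x" for x
    using T a by (meson form_between_def less_imp_le mult_nonneg_nonneg order_trans zero_le_power2)
  then have "positive_op T" using T by (simp add: positive_op_iff form_between_def)
  moreover have "invertible_op T"
    using T by (intro coercive_invertible [OF _ a]) (auto simp: form_between_def selfadjoint_clinear)
  ultimately show ?thesis by (simp add: strictly_positive_op_def)
qed

lemma strictly_positive_inverse:
  assumes T: "strictly_positive_op T"
  obtains K where "selfadjoint_op K" "K o\<^sub>L T = id_blinfun" "T o\<^sub>L K = id_blinfun"
proof -
  have sa: "selfadjoint_op T" using T by (simp add: strictly_positive_op_def positive_op_iff)
  obtain K where K: "clinear_op K" "T o\<^sub>L K = id_blinfun" "K o\<^sub>L T = id_blinfun"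
    using T by (auto simp: strictly_positive_op_def invertible_op_def)
  have TK: "T (K x) = x" for x
    by (metis K(2) blinfun_apply_blinfun_compose blinfun_apply_id_blinfun)
  have "selfadjoint_op K"
    unfolding selfadjoint_op_def by (metis K(1) TK sa selfadjoint_opD)
  then show ?thesis using K that by blast
qed

lemma strictly_positive_compl:
  assumes A: "selfadjoint_op A" and "A \<preceq> (1/2) *\<^sub>R id_blinfun"
  shows "strictly_positive_op (id_blinfun - A)"
proof -
  have q: "qform A x \<le> 1 / 2 * (norm x)\<^sup>2" for x
    using assms(2) by (auto simp: op_le_def positive_op_iff qform_simps)
  have "(1 / 2) * (norm x)\<^sup>2 \<le> qform (id_blinfun - A) x" for x
    using q [of x] by (simp add: qform_simps)
  moreover have "qform (id_blinfun - A) x \<le> norm (id_blinfun - A) * (norm x)\<^sup>2" for x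
    using qform_abs_le [of "id_blinfun - A" x] by linarith
  ultimately have "form_between (1 / 2) (norm (id_blinfun - A)) (id_blinfun - A)"
    by (simp add: form_between_def selfadjoint_op_intros A)
  then show ?thesis by (rule strictly_positive_if_form_between) simp
qed

text \<open>
  The factors \<open>R = A\<^sup>1\<^sup>/\<^sup>2\<close> and \<open>T = A\<^sup>-\<^sup>1\<^sup>/\<^sup>2 B A\<^sup>-\<^sup>1\<^sup>/\<^sup>2\<close> do not depend on \<open>f\<close>. All properties of the mean needed below
  follow from the listed relations, without reference to powers of \<open>A\<close>.
\<close>

lemma op_mean_sandwich:
  assumes A: "strictly_positive_op A" and B: "strictly_positive_op B"
  obtains R R' T where "selfadjoint_op R" "R o\<^sub>L R = A" "R' o\<^sub>L R = id_blinfun"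
    "strictly_positive_op T" "R o\<^sub>L T o\<^sub>L R = B" "\<And>f. op_mean f A B = R o\<^sub>L cfc f T o\<^sub>L R"
proof -
  obtain a b where ab: "0 < a" "form_between a b A" using strictly_positive_form_between [OF A] by metis
  let ?R = "op_powr A (1/2)" and ?Q = "op_powr A (-1/2)"
  have c: "continuous_on {a..b} (\<lambda>t. t powr r)" for r
    using ab(1) by (intro continuous_on_powr' continuous_intros) auto
  have R: "selfadjoint_op ?R" and Q: "selfadjoint_op ?Q"
    unfolding op_powr_def by (intro selfadjoint_cfc [OF ab(2)] c)+
  have prod: "op_powr A r o\<^sub>L op_powr A s = op_powr A (r + s)" for r s
    unfolding op_powr_def powr_add by (rule cfc_mult [OF ab(2) c c, symmetric])
  have "op_powr A 1 = cfc (\<lambda>t. t) A"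
    unfolding op_powr_def by (rule cfc_cong [OF ab(2)]) (use ab(1) in auto)
  then have pow1: "op_powr A 1 = A"
    by (simp add: cfc_ident [OF form_between_selfadjoint [OF ab(2)]])
  have "op_powr A 0 = cfc (\<lambda>t. 1) A"
    unfolding op_powr_def by (rule cfc_cong [OF ab(2)]) (use ab(1) in auto)
  then have pow0: "op_powr A 0 = id_blinfun"
    by (simp add: cfc_const [OF form_between_selfadjoint [OF ab(2)]])
  have RR: "?R o\<^sub>L ?R = A" and QR: "?Q o\<^sub>L ?R = id_blinfun" and RQ: "?R o\<^sub>L ?Q = id_blinfun"
    by (simp_all add: prod pow0 pow1)
  let ?T = "?Q o\<^sub>L B o\<^sub>L ?Q"
  have "positive_op ?T"
    unfolding positive_op_iff qform_sandwich [OF Q]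
    by (intro conjI allI selfadjoint_op_sandwich [OF Q])
      (use B in \<open>auto simp: strictly_positive_op_def positive_op_iff\<close>)
  moreover have "invertible_op ?Q"
    unfolding invertible_op_def using selfadjoint_clinear [OF R] QR RQ by blast
  ultimately have T: "strictly_positive_op ?T"
    using B by (auto simp: strictly_positive_op_def intro!: invertible_op_compose)
  have "?R o\<^sub>L ?T o\<^sub>L ?R = (?R o\<^sub>L ?Q) o\<^sub>L B o\<^sub>L (?Q o\<^sub>L ?R)" by (simp only: compose_assoc)
  also have "\<dots> = B" unfolding RQ QR by simp
  finally show ?thesis using that R RR QR T by (simp add: op_mean_def)
qed

definition mean_gap :: "(real \<Rightarrow> real) \<Rightarrow> real \<Rightarrow>
    ('h :: chilbert_space \<Rightarrow>\<^sub>L 'h) \<Rightarrow> ('h \<Rightarrow>\<^sub>L 'h) \<Rightarrow> 'h \<Rightarrow>\<^sub>L 'h" where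
  "mean_gap f \<mu> A B = weighted_arith_mean \<mu> A B - op_mean f A B"

text \<open>
  The representing function of the weighted harmonic mean; \<open>l = 0\<close> and \<open>l = 1\<close> give the two trivial means.
\<close>

definition harmonic_fun :: "real \<Rightarrow> real \<Rightarrow> real" where
  "harmonic_fun l t = t / ((1 - l) * t + l)"

lemma harmonic_denominator_ge: "0 \<le> l \<Longrightarrow> l \<le> 1 \<Longrightarrow> min 1 t \<le> (1 - l) * t + l" for t :: real
  using mult_left_mono [of "min 1 t" t "1 - l"] mult_left_mono [of "min 1 t" 1 l]
  by (simp add: algebra_simps)

lemma harmonic_denominator_pos: "0 \<le> l \<Longrightarrow> l \<le> 1 \<Longrightarrow> 0 < t \<Longrightarrow> 0 < (1 - l) * t + l" for t :: real
  using harmonic_denominator_ge [of l t] by linarith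

lemma continuous_on_harmonic_fun:
  "0 \<le> l \<Longrightarrow> l \<le> 1 \<Longrightarrow> 0 < a \<Longrightarrow> continuous_on {a..b} (harmonic_fun l)"
  unfolding harmonic_fun_def
  by (intro continuous_intros ballI) (metis atLeastAtMost_iff harmonic_denominator_pos less_irrefl order_less_le_trans)

text \<open>
  With \<open>X = (1 - l) B + l A\<close> and \<open>D = A - B\<close> one has \<open>A = X + (1 - l) D\<close> and \<open>B = X - l D\<close>. The
  weighted harmonic mean is \<open>B X\<^sup>-\<^sup>1 A\<close>, and expanding this product gives the identity.
\<close>

lemma mean_gap_harmonic:
  fixes A B :: "'h :: chilbert_space \<Rightarrow>\<^sub>L 'h"
  assumes A: "strictly_positive_op A" and B: "strictly_positive_op B" and l: "0 \<le> l" "l \<le> 1"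
    and X: "X = (1 - l) *\<^sub>R B + l *\<^sub>R A" and KX: "K o\<^sub>L X = id_blinfun" and XK: "X o\<^sub>L K = id_blinfun"
  shows "mean_gap (harmonic_fun l) l A B = (l * (1 - l)) *\<^sub>R ((A - B) o\<^sub>L K o\<^sub>L (A - B))"
proof -
  obtain R R' T where R: "selfadjoint_op R" "R o\<^sub>L R = A" "R' o\<^sub>L R = id_blinfun"
    and T: "strictly_positive_op T" "R o\<^sub>L T o\<^sub>L R = B"
    and mean: "\<And>f. op_mean f A B = R o\<^sub>L cfc f T o\<^sub>L R"
    using op_mean_sandwich [OF A B] by metis
  obtain a b where ab: "0 < a" "form_between a b T" using strictly_positive_form_between [OF T(1)] by metis
  note sa = form_between_selfadjoint [OF ab(2)]
  let ?H = "cfc (harmonic_fun l) T"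
  let ?W = "(1 - l) *\<^sub>R T + l *\<^sub>R id_blinfun"
  have c: "continuous_on {a..b} (harmonic_fun l)" by (rule continuous_on_harmonic_fun [OF l ab(1)])
  have "T = cfc (\<lambda>t. harmonic_fun l t * ((1 - l) * t + l)) T"
  proof -
    have "cfc (\<lambda>t. harmonic_fun l t * ((1 - l) * t + l)) T = cfc (\<lambda>t. t) T"
    proof (rule cfc_cong [OF ab(2)])
      fix t assume "t \<in> {a..b}"
      then have "0 < (1 - l) * t + l" using ab(1) l by (intro harmonic_denominator_pos) auto
      then show "harmonic_fun l t * ((1 - l) * t + l) = t" by (simp add: harmonic_fun_def)
    qed
    then show ?thesis by (simp add: cfc_ident [OF sa])
  qed
  also have "\<dots> = ?H o\<^sub>L cfc (\<lambda>t. (1 - l) * t + l) T"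
    by (intro cfc_mult [OF ab(2)] c continuous_intros)
  also have "cfc (\<lambda>t. (1 - l) * t + l) T = ?W"
    using cfc_add [OF ab(2), of "\<lambda>t. (1 - l) * t" "\<lambda>_. l"] cfc_scale [OF ab(2), of "\<lambda>t. t" "1 - l"]
    by (simp add: cfc_const [OF sa] cfc_ident [OF sa] continuous_on_mult_left)
  finally have HW: "T = ?H o\<^sub>L ?W" .
  have XW: "X = R o\<^sub>L (?W o\<^sub>L R)"
    unfolding X R(2) [symmetric] T(2) [symmetric] by (simp add: compose_simps compose_assoc)
  have cancel: "?W o\<^sub>L (R o\<^sub>L (K o\<^sub>L R)) = id_blinfun"
  proof -
    have "R' o\<^sub>L (X o\<^sub>L K) o\<^sub>L R = (R' o\<^sub>L R) o\<^sub>L (?W o\<^sub>L (R o\<^sub>L (K o\<^sub>L R)))"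
      unfolding XW by (simp only: compose_assoc)
    then show ?thesis by (simp add: XK R(3))
  qed
  have "B o\<^sub>L K o\<^sub>L A = R o\<^sub>L (T o\<^sub>L R) o\<^sub>L K o\<^sub>L (R o\<^sub>L R)"
    unfolding R(2) T(2) [symmetric] by (simp only: compose_assoc)
  also have "\<dots> = R o\<^sub>L ((?H o\<^sub>L ?W) o\<^sub>L R) o\<^sub>L K o\<^sub>L (R o\<^sub>L R)" by (simp only: HW [symmetric])
  also have "\<dots> = R o\<^sub>L (?H o\<^sub>L ((?W o\<^sub>L (R o\<^sub>L (K o\<^sub>L R))) o\<^sub>L R))" by (simp only: compose_assoc)
  also have "\<dots> = op_mean (harmonic_fun l) A B" by (simp add: cancel mean compose_assoc)
  finally have BKA: "op_mean (harmonic_fun l) A B = B o\<^sub>L K o\<^sub>L A" ..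
  define D where "D = A - B"
  have Aeq: "A = X + (1 - l) *\<^sub>R D" and Beq: "B = X - l *\<^sub>R D"
    by (simp_all add: X D_def algebra_simps)
  have XKZ: "X o\<^sub>L (K o\<^sub>L Z) = Z" for Z
    by (simp add: compose_assoc [symmetric] XK)
  have "B o\<^sub>L K o\<^sub>L A = X + (1 - l) *\<^sub>R D - l *\<^sub>R D - (l * (1 - l)) *\<^sub>R (D o\<^sub>L K o\<^sub>L D)"
    unfolding Aeq Beq by (simp add: compose_simps compose_assoc XKZ KX XK) (simp add: algebra_simps)
  moreover have "weighted_arith_mean l A B = X + (1 - l) *\<^sub>R D - l *\<^sub>R D"
    unfolding weighted_arith_mean_def Aeq Beq by (simp add: algebra_simps)
  ultimately show ?thesis
    unfolding mean_gap_def BKA D_def by (simp add: D_def [symmetric])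
qed

text \<open>
  This is \<open>X\<^sup>-\<^sup>1 - 4 + 4 X = (1 - 2 X) X\<^sup>-\<^sup>1 (1 - 2 X) \<ge> 0\<close>, written with \<open>z = X\<^sup>-\<^sup>1 y\<close>.
\<close>

lemma inverse_ge_affine:
  assumes X: "positive_op X" and K: "X o\<^sub>L K = id_blinfun"
  shows "4 * (norm y)\<^sup>2 - 4 * qform X y \<le> qform K y"
proof -
  have sa: "selfadjoint_op X" using X by (simp add: positive_op_iff)
  define z where "z = K y"
  have y: "X z = y" unfolding z_def by (metis K blinfun_apply_blinfun_compose blinfun_apply_id_blinfun)
  have 1: "cinner (X y) z = of_real ((norm y)\<^sup>2)"
    by (simp add: selfadjoint_opD [OF sa] y cinner_self)
  have "0 \<le> qform X (z - 2 *\<^sub>R y)" using X by (simp add: positive_op_iff)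
  also have "\<dots> = Re (cinner y z) - 4 * (norm y)\<^sup>2 + 4 * qform X y"
    unfolding qform_def
    by (simp add: blinfun.bilinear_simps cinner_simps y 1 cinner_self del: of_real_power)
  also have "Re (cinner y z) = qform K y"
    unfolding qform_def z_def [symmetric] cinner_commute [of y z] by simp
  finally show ?thesis by simp
qed

text \<open>
  With \<open>y = Y z\<close>, the difference of the two sides is
  \<open>\<parallel>2 y - z\<parallel>\<^sup>2 / 2 + (2 \<langle>y, z\<rangle> - \<parallel>z\<parallel>\<^sup>2) / 2\<close>.
\<close>

lemma inverse_le_two:
  assumes sa: "selfadjoint_op Y" and Y: "\<And>x. (norm x)\<^sup>2 \<le> 2 * qform Y x" and K: "Y o\<^sub>L K = id_blinfun"
  shows "qform K y \<le> 2 * (norm y)\<^sup>2"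
proof -
  define z where "z = K y"
  have y: "Y z = y" unfolding z_def by (metis K blinfun_apply_blinfun_compose blinfun_apply_id_blinfun)
  have zy: "Re (cinner z y) = Re (cinner y z)" by (subst cinner_commute) simp
  have "complex_of_real ((norm (2 *\<^sub>R y - z))\<^sup>2) = 4 * of_real ((norm y)\<^sup>2) - 2 * (cinner y z + cinner z y) + of_real ((norm z)\<^sup>2)"
    unfolding cinner_self [symmetric] by (simp add: cinner_simps algebra_simps)
  then have "Re (complex_of_real ((norm (2 *\<^sub>R y - z))\<^sup>2)) = Re (4 * of_real ((norm y)\<^sup>2) - 2 * (cinner y z + cinner z y) + of_real ((norm z)\<^sup>2))"
    by simp
  then have "(norm (2 *\<^sub>R y - z))\<^sup>2 = 4 * (norm y)\<^sup>2 - 4 * Re (cinner y z) + (norm z)\<^sup>2"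
    by (simp add: zy del: of_real_power)
  then have "0 \<le> 4 * (norm y)\<^sup>2 - 4 * Re (cinner y z) + (norm z)\<^sup>2"
    by (metis zero_le_power2)
  moreover have "(norm z)\<^sup>2 \<le> 2 * Re (cinner y z)" using Y [of z] by (simp add: qform_def y)
  moreover have "qform K y = Re (cinner y z)" by (simp add: qform_def z_def [symmetric] zy)
  ultimately show ?thesis by linarith
qed

text \<open>
  Write \<open>K\<close> and \<open>K'\<close> for the inverses of \<open>X\<close> and \<open>1 - X\<close>. From \<open>K \<ge> 4 - 4 X\<close> and \<open>K' \<le> 2\<close> one gets
  \<open>K - K' \<ge> 2 (1 - 2 X)\<close>. Finally \<open>1 - 2 X = (1 - l) (1 - 2 B) + l (1 - 2 A)\<close>, where both coefficients are at
  least \<open>u = l (1 - l)\<close>, so \<open>1 - 2 X \<ge> 2 u (1 - A - B)\<close>. The operator in this last bound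
  does not depend on \<open>l\<close>, so the bound survives averaging over \<open>l\<close>.
\<close>

lemma mean_gap_harmonic_compl:
  fixes A B :: "'h :: chilbert_space \<Rightarrow>\<^sub>L 'h"
  assumes A: "strictly_positive_op A" "A \<preceq> (1/2) *\<^sub>R id_blinfun"
    and B: "strictly_positive_op B" "B \<preceq> (1/2) *\<^sub>R id_blinfun"
    and l: "0 \<le> l" "l \<le> 1"
  shows "4 * (l * (1 - l))\<^sup>2 * qform (id_blinfun - A - B) ((A - B) x) \<le>
    qform (mean_gap (harmonic_fun l) l A B - mean_gap (harmonic_fun l) l (id_blinfun - A) (id_blinfun - B)) x"
proof -
  have saA: "selfadjoint_op A" and saB: "selfadjoint_op B"
    using A B by (auto simp: strictly_positive_op_def positive_op_iff)
  have hA: "2 * qform A y \<le> (norm y)\<^sup>2" and hB: "2 * qform B y \<le> (norm y)\<^sup>2" for y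
  proof -
    have "0 \<le> qform ((1/2) *\<^sub>R id_blinfun - A) y" "0 \<le> qform ((1/2) *\<^sub>R id_blinfun - B) y"
      using A(2) B(2) by (simp_all add: op_le_def positive_op_iff)
    then show "2 * qform A y \<le> (norm y)\<^sup>2" "2 * qform B y \<le> (norm y)\<^sup>2"
      by (simp_all add: qform_simps)
  qed
  define X where "X = (1 - l) *\<^sub>R B + l *\<^sub>R A"
  define D where "D = A - B"
  define u where "u = l * (1 - l)"
  have u: "0 \<le> u" "u \<le> l" "u \<le> 1 - l"
    using l mult_left_mono [of "1 - l" 1 l] mult_right_mono [of l 1 "1 - l"] by (auto simp: u_def)
  have saX: "selfadjoint_op X" unfolding X_def by (intro selfadjoint_op_intros saA saB)
  obtain a b where a: "0 < a" "form_between a b A" using strictly_positive_form_between [OF A(1)] by metis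
  obtain a' b' where a': "0 < a'" "form_between a' b' B" using strictly_positive_form_between [OF B(1)] by metis
  have hX: "2 * qform X y \<le> (norm y)\<^sup>2" for y
  proof -
    have "(1 - l) * (2 * qform B y) + l * (2 * qform A y) \<le> (1 - l) * (norm y)\<^sup>2 + l * (norm y)\<^sup>2"
      by (intro add_mono mult_left_mono hA hB) (use l in auto)
    then show ?thesis by (simp add: X_def qform_simps algebra_simps)
  qed
  have Xlow: "min a a' * (norm y)\<^sup>2 \<le> qform X y" for y
  proof -
    have "min a a' * (norm y)\<^sup>2 \<le> qform B y" "min a a' * (norm y)\<^sup>2 \<le> qform A y"
      using form_between_mono [OF a(2), of "min a a'" b] form_between_mono [OF a'(2), of "min a a'" b']
      by (auto simp: form_between_def)
    then have "(1 - l) * (min a a' * (norm y)\<^sup>2) + l * (min a a' * (norm y)\<^sup>2) \<le> (1 - l) * qform B y + l * qform A y"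
      by (intro add_mono mult_left_mono) (use l in auto)
    then show ?thesis by (simp add: X_def qform_simps algebra_simps)
  qed
  have "form_between (min a a') (1 / 2) X"
    using Xlow hX by (auto simp: form_between_def saX mult.commute)
  then have X: "strictly_positive_op X" by (rule strictly_positive_if_form_between) (use a a' in auto)
  have "0 \<le> qform ((1/2) *\<^sub>R id_blinfun - X) y" for y
    using hX [of y] by (simp add: qform_simps)
  then have "X \<preceq> (1/2) *\<^sub>R id_blinfun"
    by (simp add: op_le_def positive_op_iff selfadjoint_op_intros saX)
  then have Y: "strictly_positive_op (id_blinfun - X)" by (rule strictly_positive_compl [OF saX])
  obtain K where K: "K o\<^sub>L X = id_blinfun" "X o\<^sub>L K = id_blinfun" using strictly_positive_inverse [OF X] by metis
  obtain K' where K': "K' o\<^sub>L (id_blinfun - X) = id_blinfun" "(id_blinfun - X) o\<^sub>L K' = id_blinfun"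
    using strictly_positive_inverse [OF Y] by metis
  have saD: "selfadjoint_op D" unfolding D_def by (intro selfadjoint_op_intros saA saB)
  have gap: "mean_gap (harmonic_fun l) l A B = u *\<^sub>R (D o\<^sub>L K o\<^sub>L D)"
    unfolding D_def u_def by (rule mean_gap_harmonic [OF A(1) B(1) l X_def K])
  have "mean_gap (harmonic_fun l) l (id_blinfun - A) (id_blinfun - B)
      = u *\<^sub>R ((id_blinfun - A - (id_blinfun - B)) o\<^sub>L K' o\<^sub>L (id_blinfun - A - (id_blinfun - B)))"
    unfolding u_def
    by (rule mean_gap_harmonic [OF strictly_positive_compl [OF saA A(2)] strictly_positive_compl [OF saB B(2)] l _ K'])
      (simp add: X_def algebra_simps)
  also have "id_blinfun - A - (id_blinfun - B) = (- 1) *\<^sub>R D" by (simp add: D_def)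
  finally have gap': "mean_gap (harmonic_fun l) l (id_blinfun - A) (id_blinfun - B) = u *\<^sub>R (D o\<^sub>L K' o\<^sub>L D)"
    by (simp only: compose_simps) simp
  define y where "y = D x"
  define n where "n = (norm y)\<^sup>2"
  have "4 * n - 4 * qform X y \<le> qform K y"
    using X K unfolding n_def by (intro inverse_ge_affine) (auto simp: strictly_positive_op_def)
  moreover have "qform K' y \<le> 2 * n"
    unfolding n_def
    by (rule inverse_le_two [OF _ _ K'(2)]) (use hX in \<open>auto simp: qform_simps intro!: selfadjoint_op_intros saX\<close>)
  ultimately have "2 * (n - 2 * qform X y) \<le> qform K y - qform K' y" by (simp add: algebra_simps)
  then have "u * (2 * (n - 2 * qform X y)) \<le> u * (qform K y - qform K' y)"
    by (intro mult_left_mono u)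
  moreover have "u * (n - 2 * qform B y) + u * (n - 2 * qform A y) \<le> (1 - l) * (n - 2 * qform B y) + l * (n - 2 * qform A y)"
    by (intro add_mono mult_right_mono u) (use hA [of y] hB [of y] in \<open>auto simp: n_def\<close>)
  then have "u * (2 * (u * (n - 2 * qform B y) + u * (n - 2 * qform A y))) \<le> u * (2 * (n - 2 * qform X y))"
    by (intro mult_left_mono u) (auto simp: X_def qform_simps algebra_simps)
  ultimately have "4 * u\<^sup>2 * (n - qform A y - qform B y) \<le> u * (qform K y - qform K' y)"
    by (simp add: algebra_simps power2_eq_square)
  then show ?thesis
    unfolding gap gap' D_def [symmetric] y_def [symmetric] u_def [symmetric]
    by (simp add: qform_simps qform_sandwich [OF saD] y_def n_def right_diff_distrib)
qed

section \<open>Mixtures of weighted harmonic means\<close>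

text \<open>
  \<open>harmonic_mixture g \<mu> \<kappa> m\<close> says that \<open>g\<close> is a finite convex combination of the functions
  \<open>harmonic_fun l\<close>; the parameters are the means of \<open>l\<close>, \<open>l (1 - l)\<close> and \<open>(l (1 - l))\<^sup>2\<close> with
  respect to the weights. Functionals that are affine in \<open>g\<close> can then be treated by induction.
\<close>

inductive harmonic_mixture :: "(real \<Rightarrow> real) \<Rightarrow> real \<Rightarrow> real \<Rightarrow> real \<Rightarrow> bool" where
  single: "0 \<le> l \<Longrightarrow> l \<le> 1 \<Longrightarrow> harmonic_mixture (harmonic_fun l) l (l * (1 - l)) ((l * (1 - l))\<^sup>2)"
| convex: "harmonic_mixture g \<mu> \<kappa> m \<Longrightarrow> harmonic_mixture g' \<mu>' \<kappa>' m' \<Longrightarrow> 0 \<le> s \<Longrightarrow> s \<le> 1 \<Longrightarrow>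
    harmonic_mixture (\<lambda>t. (1 - s) * g t + s * g' t) ((1 - s) * \<mu> + s * \<mu>')
      ((1 - s) * \<kappa> + s * \<kappa>') ((1 - s) * m + s * m')"

lemma harmonic_mixture_continuous:
  "harmonic_mixture g \<mu> \<kappa> m \<Longrightarrow> 0 < a \<Longrightarrow> continuous_on {a..b} g"
  by (induction rule: harmonic_mixture.induct)
    (auto intro!: continuous_intros continuous_on_harmonic_fun)

lemma convex_comb_mono: "0 \<le> s \<Longrightarrow> s \<le> 1 \<Longrightarrow> a \<le> b \<Longrightarrow> c \<le> d \<Longrightarrow> (1 - s) * a + s * c \<le> (1 - s) * b + s * d"
  for s :: real by (intro add_mono mult_left_mono) auto

lemma harmonic_mixture_mono:
  "harmonic_mixture g \<mu> \<kappa> m \<Longrightarrow> 0 < t \<Longrightarrow> t \<le> t' \<Longrightarrow> g t \<le> g t'"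
proof (induction rule: harmonic_mixture.induct)
  case (single l)
  have "0 < (1 - l) * t + l" "0 < (1 - l) * t' + l"
    using single by (auto intro: harmonic_denominator_pos)
  moreover have "t * l \<le> t' * l" using single by (intro mult_right_mono) auto
  ultimately show ?case by (simp add: harmonic_fun_def divide_simps algebra_simps)
qed (auto intro: convex_comb_mono)

lemma harmonic_tangent:
  assumes "0 \<le> l" "l \<le> 1" "0 < t"
  shows "1 + l * (t - 1) - harmonic_fun l t = l * (1 - l) * (t - 1)\<^sup>2 / ((1 - l) * t + l)"
proof -
  have "(1 - l) * t + l \<noteq> 0" using harmonic_denominator_pos [OF assms] by simp
  then show ?thesis by (simp add: harmonic_fun_def field_simps power2_eq_square)
qed

lemma harmonic_mixture_le_tangent:
  "harmonic_mixture g \<mu> \<kappa> m \<Longrightarrow> 0 < t \<Longrightarrow> g t \<le> 1 + \<mu> * (t - 1)"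
proof (induction rule: harmonic_mixture.induct)
  case (single l)
  have "0 \<le> l * (1 - l) * (t - 1)\<^sup>2 / ((1 - l) * t + l)"
    using single harmonic_denominator_pos [of l t] by (intro divide_nonneg_pos mult_nonneg_nonneg) auto
  then show ?case using harmonic_tangent [of l t] single by linarith
next
  case (convex g \<mu> \<kappa> m g' \<mu>' \<kappa>' m' s)
  then have "(1 - s) * g t + s * g' t \<le> (1 - s) * (1 + \<mu> * (t - 1)) + s * (1 + \<mu>' * (t - 1))"
    by (intro convex_comb_mono) auto
  then show ?case by (simp add: algebra_simps)
qed

text \<open>
  A distance between \<open>g\<close> and its tangent at a single point forces \<open>\<kappa>\<close> to be bounded away from zero.
\<close>

lemma harmonic_mixture_tangent_gap:
  "harmonic_mixture g \<mu> \<kappa> m \<Longrightarrow> 0 < t \<Longrightarrow> (1 + \<mu> * (t - 1) - g t) * min 1 t \<le> \<kappa> * (t - 1)\<^sup>2"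
proof (induction rule: harmonic_mixture.induct)
  case (single l)
  have pos: "0 < (1 - l) * t + l" using single by (auto intro: harmonic_denominator_pos)
  have nn: "0 \<le> l * (1 - l) * (t - 1)\<^sup>2" using single by simp
  have "l * (1 - l) * (t - 1)\<^sup>2 / ((1 - l) * t + l) * min 1 t
      \<le> l * (1 - l) * (t - 1)\<^sup>2 / ((1 - l) * t + l) * ((1 - l) * t + l)"
    using nn pos single by (intro mult_left_mono harmonic_denominator_ge divide_nonneg_pos) auto
  then show ?case using harmonic_tangent [of l t] single pos by simp
next
  case (convex g \<mu> \<kappa> m g' \<mu>' \<kappa>' m' s)
  then have "(1 - s) * ((1 + \<mu> * (t - 1) - g t) * min 1 t) + s * ((1 + \<mu>' * (t - 1) - g' t) * min 1 t)
      \<le> (1 - s) * (\<kappa> * (t - 1)\<^sup>2) + s * (\<kappa>' * (t - 1)\<^sup>2)"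
    by (intro convex_comb_mono) auto
  moreover have "(1 - s) * ((1 + \<mu> * (t - 1) - g t) * M) + s * ((1 + \<mu>' * (t - 1) - g' t) * M)
      = (1 + ((1 - s) * \<mu> + s * \<mu>') * (t - 1) - ((1 - s) * g t + s * g' t)) * M" for M
    by (simp add: algebra_simps)
  ultimately show ?case by (simp add: distrib_right mult.assoc)
qed

text \<open>
  Jensen's inequality for the square.
\<close>

lemma harmonic_mixture_moments: "harmonic_mixture g \<mu> \<kappa> m \<Longrightarrow> \<kappa>\<^sup>2 \<le> m"
proof (induction rule: harmonic_mixture.induct)
  case (convex g \<mu> \<kappa> m g' \<mu>' \<kappa>' m' s)
  have "(1 - s) * \<kappa>\<^sup>2 + s * \<kappa>'\<^sup>2 - ((1 - s) * \<kappa> + s * \<kappa>')\<^sup>2 = s * (1 - s) * (\<kappa> - \<kappa>')\<^sup>2"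
    by (simp add: algebra_simps power2_eq_square)
  then have "((1 - s) * \<kappa> + s * \<kappa>')\<^sup>2 \<le> (1 - s) * \<kappa>\<^sup>2 + s * \<kappa>'\<^sup>2"
    using convex.hyps by (smt (verit) mult_nonneg_nonneg zero_le_power2)
  also have "\<dots> \<le> (1 - s) * m + s * m'" using convex by (intro convex_comb_mono) auto
  finally show ?case .
qed simp

lemma op_mean_convex_comb:
  assumes A: "strictly_positive_op A" and B: "strictly_positive_op B"
    and g: "\<And>a b. 0 < a \<Longrightarrow> continuous_on {a..b} g" and g': "\<And>a b. 0 < a \<Longrightarrow> continuous_on {a..b} g'"
  shows "op_mean (\<lambda>t. (1 - s) * g t + s * g' t) A B = (1 - s) *\<^sub>R op_mean g A B + s *\<^sub>R op_mean g' A B"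
proof -
  obtain R R' T where T: "strictly_positive_op T" and mean: "\<And>f. op_mean f A B = R o\<^sub>L cfc f T o\<^sub>L R"
    using op_mean_sandwich [OF A B] by metis
  obtain a b where ab: "0 < a" "form_between a b T" using strictly_positive_form_between [OF T] by metis
  have "cfc (\<lambda>t. (1 - s) * g t + s * g' t) T = (1 - s) *\<^sub>R cfc g T + s *\<^sub>R cfc g' T"
    using cfc_add [OF ab(2), of "\<lambda>t. (1 - s) * g t" "\<lambda>t. s * g' t"] cfc_scale [OF ab(2)] g [OF ab(1)] g' [OF ab(1)]
    by (simp add: continuous_on_mult_left)
  then show ?thesis by (simp add: mean compose_simps)
qed

lemma mean_gap_mixture_compl:
  fixes A B :: "'h :: chilbert_space \<Rightarrow>\<^sub>L 'h"
  assumes "harmonic_mixture g \<mu> \<kappa> m"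
    and A: "strictly_positive_op A" "A \<preceq> (1/2) *\<^sub>R id_blinfun"
    and B: "strictly_positive_op B" "B \<preceq> (1/2) *\<^sub>R id_blinfun"
  shows "4 * m * qform (id_blinfun - A - B) ((A - B) x) \<le>
    qform (mean_gap g \<mu> A B - mean_gap g \<mu> (id_blinfun - A) (id_blinfun - B)) x"
  using assms(1)
proof (induction rule: harmonic_mixture.induct)
  case (single l)
  then show ?case by (intro mean_gap_harmonic_compl A B)
next
  case (convex g \<mu> \<kappa> m g' \<mu>' \<kappa>' m' s)
  have sa: "selfadjoint_op A" "selfadjoint_op B"
    using A B by (auto simp: strictly_positive_op_def positive_op_iff)
  have lin: "mean_gap (\<lambda>t. (1 - s) * g t + s * g' t) ((1 - s) * \<mu> + s * \<mu>') P Q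
      = (1 - s) *\<^sub>R mean_gap g \<mu> P Q + s *\<^sub>R mean_gap g' \<mu>' P Q"
    if "strictly_positive_op P" "strictly_positive_op Q" for P Q :: "'h \<Rightarrow>\<^sub>L 'h"
    unfolding mean_gap_def weighted_arith_mean_def
    by (subst op_mean_convex_comb [OF that])
      (auto intro: harmonic_mixture_continuous convex.hyps simp: algebra_simps)
  let ?q = "qform (id_blinfun - A - B) ((A - B) x)"
  have "(1 - s) * (4 * m * ?q) + s * (4 * m' * ?q) \<le> (1 - s) *
      qform (mean_gap g \<mu> A B - mean_gap g \<mu> (id_blinfun - A) (id_blinfun - B)) x + s *
      qform (mean_gap g' \<mu>' A B - mean_gap g' \<mu>' (id_blinfun - A) (id_blinfun - B)) x"
    using convex by (intro convex_comb_mono) auto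
  also have "\<dots> = qform (mean_gap (\<lambda>t. (1 - s) * g t + s * g' t) ((1 - s) * \<mu> + s * \<mu>') A B
      - mean_gap (\<lambda>t. (1 - s) * g t + s * g' t) ((1 - s) * \<mu> + s * \<mu>') (id_blinfun - A) (id_blinfun - B)) x"
    unfolding lin [OF A(1) B(1)] qform_simps
      lin [OF strictly_positive_compl [OF sa(1) A(2)] strictly_positive_compl [OF sa(2) B(2)]]
    by (simp add: algebra_simps)
  finally show ?case by (simp add: algebra_simps)
qed

section \<open>Rank-one perturbations and divided differences\<close>

definition ell2_basis :: "nat \<Rightarrow> ell2" where
  "ell2_basis n = Ell2 (\<lambda>k. if k = n then 1 else 0)"

lemma coord_ell2_basis: "coord (ell2_basis n) = (\<lambda>k. if k = n then 1 else 0)"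
proof -
  have "summable (\<lambda>k. (norm (if k = n then 1 else 0 :: complex))\<^sup>2)"
    by (rule summable_finite [of "{n}"]) auto
  then show ?thesis by (simp add: ell2_basis_def Ell2_inverse)
qed

lemma cinner_ell2_basis: "cinner (ell2_basis m) (ell2_basis n) = (if m = n then 1 else 0)"
proof -
  have "cinner (ell2_basis m) (ell2_basis n)
      = (\<Sum>k\<in>{m}. coord (ell2_basis m) k * cnj (coord (ell2_basis n) k))"
    unfolding cinner_ell2_def by (rule suminf_finite) (auto simp: coord_ell2_basis)
  then show ?thesis by (simp add: coord_ell2_basis)
qed

lift_definition dyad :: "'h :: chilbert_space \<Rightarrow> 'h \<Rightarrow>\<^sub>L 'h" is "\<lambda>u x. cinner x u *\<^sub>C u"
proof (rule bounded_linear_intro)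
  fix u x y :: 'h and r :: real
  show "cinner (x + y) u *\<^sub>C u = cinner x u *\<^sub>C u + cinner y u *\<^sub>C u"
    by (simp add: cinner_simps scaleC_add_left)
  show "cinner (r *\<^sub>R x) u *\<^sub>C u = r *\<^sub>R (cinner x u *\<^sub>C u)"
    by (simp add: cinner_simps scaleR_scaleC scaleC_scaleC)
  show "norm (cinner x u *\<^sub>C u) \<le> norm x * (norm u * norm u)"
    using mult_right_mono [OF Cauchy_Schwarz_cinner [of x u], of "norm u"] by (simp add: norm_scaleC mult.assoc)
qed

lemma positive_dyad: "positive_op (dyad u)"
proof -
  have "selfadjoint_op (dyad u)"
    by (auto simp: selfadjoint_op_def clinear_op_def dyad.rep_eq cinner_simps scaleC_scaleC
        cinner_commute [of _ u])
  moreover have "qform (dyad u) x = (cmod (cinner x u))\<^sup>2" for x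
  proof -
    have "cinner (dyad u x) x = cinner x u * cnj (cinner x u)"
      by (simp add: dyad.rep_eq cinner_simps cinner_commute [of u x])
    also have "\<dots> = of_real ((cmod (cinner x u))\<^sup>2)" by (rule complex_norm_square [symmetric])
    finally show ?thesis by (simp add: qform_def del: of_real_power)
  qed
  ultimately show ?thesis by (simp add: positive_op_iff)
qed

lemma positive_op_add: "positive_op A \<Longrightarrow> positive_op B \<Longrightarrow> positive_op (A + B)"
  by (simp add: positive_op_iff selfadjoint_op_intros qform_simps)

lemma positive_op_scaleR: "positive_op A \<Longrightarrow> 0 \<le> r \<Longrightarrow> positive_op (r *\<^sub>R A)"
  by (simp add: positive_op_iff selfadjoint_op_intros qform_simps)

lemma positive_op_zero: "positive_op 0"
  using positive_op_scaleR [OF positive_op_id, of 0] by simp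

lemma positive_op_sum: "(\<And>i. i \<in> S \<Longrightarrow> positive_op (X i)) \<Longrightarrow> positive_op (\<Sum>i\<in>S. X i)"
  by (induction S rule: infinite_finite_induct) (auto intro: positive_op_add positive_op_zero)

text \<open>
  The Lagrange interpolation formula for \<open>q\<close> at the nodes \<open>S\<close>, divided by \<open>\<Prod>(z - s)\<close>.
\<close>

lemma lagrange_partial_fractions:
  fixes q :: "real poly"
  assumes S: "finite S" and deg: "degree q < card S" and z: "z \<notin> S"
  shows "(\<Sum>s\<in>S. poly q s / ((\<Prod>s'\<in>S - {s}. s - s') * (z - s))) = poly q z / (\<Prod>s\<in>S. z - s)"
proof -
  define N where "N s = (\<Prod>s'\<in>S - {s}. [:- s', 1:])" for s
  define L where "L = (\<Sum>s\<in>S. smult (poly q s / (\<Prod>s'\<in>S - {s}. s - s')) (N s))"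
  have N: "poly (N s) x = (\<Prod>s'\<in>S - {s}. x - s')" for s x
    by (simp add: N_def poly_prod)
  have nz: "(\<Prod>s'\<in>S - {s}. s - s') \<noteq> 0" for s
    using S by simp
  have card: "0 < card S" using deg by simp
  have degN: "degree (N s) \<le> card S - 1" if "s \<in> S" for s
  proof -
    have "degree (N s) = (\<Sum>s'\<in>S - {s}. degree [:- s', 1:])"
      unfolding N_def by (rule degree_prod_sum_eq) simp
    then show ?thesis using S that by simp
  qed
  have "degree L \<le> card S - 1"
    unfolding L_def by (rule degree_sum_le [OF S]) (meson degN degree_smult_le order_trans)
  then have "degree L < card S" using card by linarith
  moreover have "poly L s = poly q s" if s: "s \<in> S" for s
  proof -
    have "poly L s = (\<Sum>r\<in>S. poly q r / (\<Prod>s'\<in>S - {r}. r - s') * (\<Prod>s'\<in>S - {r}. s - s'))"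
      by (simp add: L_def poly_sum N)
    also have "\<dots> = (\<Sum>r\<in>S. if r = s then poly q s else 0)"
    proof (rule sum.cong [OF refl])
      fix r assume "r \<in> S"
      show "poly q r / (\<Prod>s'\<in>S - {r}. r - s') * (\<Prod>s'\<in>S - {r}. s - s') = (if r = s then poly q s else 0)"
      proof (cases "r = s")
        case True
        then show ?thesis using nz [of s] by simp
      next
        case False
        then have "(\<Prod>s'\<in>S - {r}. s - s') = 0" using S s by (intro prod_zero) auto
        then show ?thesis using False by simp
      qed
    qed
    also have "\<dots> = poly q s" using S s by simp
    finally show ?thesis .
  qed
  ultimately have "q = L" using deg by (intro poly_eqI_degree [of S]) auto
  then have "poly q z = poly L z" by simp
  also have "poly L z = (\<Sum>s\<in>S. poly q s / (\<Prod>s'\<in>S - {s}. s - s') * (\<Prod>s'\<in>S - {s}. z - s'))"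
    by (simp add: L_def poly_sum N)
  finally have "poly q z / (\<Prod>s\<in>S. z - s)
      = (\<Sum>s\<in>S. poly q s / (\<Prod>s'\<in>S - {s}. s - s') * (\<Prod>s'\<in>S - {s}. z - s') / (\<Prod>s\<in>S. z - s))"
    by (simp only: sum_divide_distrib)
  also have "\<dots> = (\<Sum>s\<in>S. poly q s / ((\<Prod>s'\<in>S - {s}. s - s') * (z - s)))"
  proof (rule sum.cong [OF refl])
    fix s assume s: "s \<in> S"
    have "(\<Prod>s\<in>S. z - s) = (z - s) * (\<Prod>s'\<in>S - {s}. z - s')" by (rule prod.remove [OF S s])
    moreover have "(\<Prod>s'\<in>S - {s}. z - s') \<noteq> 0" using S z by auto
    ultimately show "poly q s / (\<Prod>s'\<in>S - {s}. s - s') * (\<Prod>s'\<in>S - {s}. z - s') / (\<Prod>s\<in>S. z - s)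
        = poly q s / ((\<Prod>s'\<in>S - {s}. s - s') * (z - s))"
      by simp
  qed
  finally show ?thesis ..
qed

definition divided_diff :: "(real \<Rightarrow> real) \<Rightarrow> real set \<Rightarrow> real" where
  "divided_diff g U = (\<Sum>u\<in>U. g u / (\<Prod>w\<in>U - {u}. u - w))"

text \<open>
  Let \<open>A\<close> be the diagonal operator with eigenvalues \<open>S\<close>. The sign condition says that \<open>S\<close> and \<open>T\<close>
  interlace, so there is a rank-one perturbation \<open>B \<ge> A\<close> with eigenvalues \<open>T\<close>; the squares of its weights are
  explicit rational expressions. For a suitable vector \<open>x\<close> depending on \<open>q\<close>, the inequality
  \<open>\<langle>f(A) x, x\<rangle> \<le> \<langle>f(B) x, x\<rangle>\<close> is the assertion. The expansions
  of \<open>x\<close> in both eigenbases are instances of Lagrange interpolation.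
\<close>

lemma interlacing_divided_diff_nonneg:
  assumes mono: "operator_monotone_on {0..} f"
    and S: "finite S" "S \<subseteq> {0..}" and T: "finite T" "T \<subseteq> {0..}" and disj: "S \<inter> T = {}"
    and card: "card T = card S" and deg: "degree q < card S"
    and sign: "\<And>s. s \<in> S \<Longrightarrow> (\<Prod>t\<in>T. s - t) / (\<Prod>s'\<in>S - {s}. s - s') < 0"
  shows "0 \<le> divided_diff (\<lambda>u. f u * (poly q u)\<^sup>2) (S \<union> T)"
proof -
  obtain \<phi> :: "real \<Rightarrow> nat" where \<phi>: "inj_on \<phi> S"
    using S(1) finite_imp_inj_to_nat_seg by metis
  define e where "e s = ell2_basis (\<phi> s)" for s
  have ortho: "cinner (e s) (e s') = (if s = s' then 1 else 0)" if "s \<in> S" "s' \<in> S" for s s'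
    using \<phi> that by (auto simp: e_def cinner_ell2_basis inj_on_def)
  define vec where "vec a = (\<Sum>s\<in>S. a s *\<^sub>R e s)" for a :: "real \<Rightarrow> real"
  have cinner_e: "cinner (vec a) (e s) = of_real (a s)" if "s \<in> S" for a s
  proof -
    have "cinner (vec a) (e s) = (\<Sum>r\<in>S. if r = s then of_real (a s) else 0)"
      unfolding vec_def cinner_sum_left
      by (intro sum.cong refl) (use that in \<open>auto simp: cinner_simps ortho\<close>)
    then show ?thesis using S(1) that by simp
  qed
  have cinner_vec: "cinner (vec a) (vec c) = of_real (\<Sum>s\<in>S. a s * c s)" for a c
  proof -
    have "cinner (vec a) (vec c) = (\<Sum>s\<in>S. of_real (c s) * cinner (vec a) (e s))"
      by (simp add: vec_def [of c] cinner_sum_right cinner_simps)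
    also have "\<dots> = (\<Sum>s\<in>S. of_real (c s) * of_real (a s))"
      by (intro sum.cong refl) (simp add: cinner_e)
    finally show ?thesis by (simp add: mult.commute)
  qed
  have vec_add: "vec a + vec c = vec (\<lambda>s. a s + c s)" and vec_scale: "r *\<^sub>R vec a = vec (\<lambda>s. r * a s)" for a c r
    by (simp_all add: vec_def scaleR_add_left sum.distrib scaleR_sum_right)
  have vec_cong: "vec a = vec c" if "\<And>s. s \<in> S \<Longrightarrow> a s = c s" for a c
    unfolding vec_def by (intro sum.cong refl) (simp add: that)
  define A where "A = (\<Sum>s\<in>S. s *\<^sub>R dyad (e s))"
  have posA: "positive_op A"
    unfolding A_def using S(2) by (intro positive_op_sum positive_op_scaleR positive_dyad) auto
  have A_vec: "A (vec a) = vec (\<lambda>s. s * a s)" for a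
  proof -
    have "A (vec a) = (\<Sum>s\<in>S. s *\<^sub>R (cinner (vec a) (e s) *\<^sub>C e s))"
      by (simp add: A_def blinfun.sum_left blinfun.scaleR_left dyad.rep_eq)
    also have "\<dots> = (\<Sum>s\<in>S. (s * a s) *\<^sub>R e s)"
      by (intro sum.cong refl) (simp add: cinner_e flip: scaleR_scaleC)
    finally show ?thesis by (simp add: vec_def)
  qed
  \<comment> \<open>The squared weights of the perturbation are the residues of \<open>- \<Prod>(z - t) / \<Prod>(z - s)\<close>;
    this choice makes the elements of \<open>T\<close> the new eigenvalues.\<close>
  define v where "v s = sqrt (- ((\<Prod>t\<in>T. s - t) / (\<Prod>s'\<in>S - {s}. s - s')))" for s
  have v2: "(v s)\<^sup>2 = - ((\<Prod>t\<in>T. s - t) / (\<Prod>s'\<in>S - {s}. s - s'))" if "s \<in> S" for s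
    using sign [OF that] by (simp add: v_def)
  define B where "B = A + dyad (vec v)"
  have posB: "positive_op B" unfolding B_def by (intro positive_op_add posA positive_dyad)
  have AB: "A \<preceq> B" by (simp add: op_le_def B_def positive_dyad)
  have notin: "t \<notin> S" if "t \<in> T" for t using disj that by auto
  \<comment> \<open>The secular equation: it says that \<open>b t\<close>, defined below, is an eigenvector of \<open>B\<close> for \<open>t\<close>.\<close>
  have secular: "(\<Sum>s\<in>S. (v s)\<^sup>2 / (t - s)) = 1" if t: "t \<in> T" for t
  proof -
    define Q where "Q = (\<Prod>s\<in>S. [:- s, 1:]) - (\<Prod>t\<in>T. [:- t, 1:])"
    have d: "degree (\<Prod>s\<in>X. [:- s, 1:]) = card X" "lead_coeff (\<Prod>s\<in>X. [:- s, 1:]) = 1" for X :: "real set"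
      by (subst degree_prod_eq_sum_degree; simp) (simp add: lead_coeff_prod)
    have "degree Q < card S"
    proof (rule degree_lessI)
      show "\<forall>k\<ge>card S. coeff Q k = 0"
      proof (intro allI impI)
        fix k assume k: "card S \<le> k"
        show "coeff Q k = 0"
        proof (cases "k = card S")
          case True
          then show ?thesis using d [of S] d [of T] card by (simp add: Q_def)
        next
          case False
          then show ?thesis using d [of S] d [of T] card k by (simp add: Q_def coeff_eq_0)
        qed
      qed
    qed (use deg in auto)
    from lagrange_partial_fractions [OF S(1) this notin [OF t]]
    have "(\<Sum>s\<in>S. poly Q s / ((\<Prod>s'\<in>S - {s}. s - s') * (t - s))) = poly Q t / (\<Prod>s\<in>S. t - s)" .
    also have "poly Q t = (\<Prod>s\<in>S. t - s)"
      using prod_zero [OF T(1), of "\<lambda>t'. t - t'"] t by (auto simp: Q_def poly_prod)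
    also have "(\<Sum>s\<in>S. poly Q s / ((\<Prod>s'\<in>S - {s}. s - s') * (t - s))) = (\<Sum>s\<in>S. (v s)\<^sup>2 / (t - s))"
    proof (intro sum.cong refl)
      fix s assume s: "s \<in> S"
      have "(\<Prod>s'\<in>S. s - s') = 0" using S(1) s by (intro prod_zero) auto
      then show "poly Q s / ((\<Prod>s'\<in>S - {s}. s - s') * (t - s)) = (v s)\<^sup>2 / (t - s)"
        by (simp add: v2 [OF s] Q_def poly_prod)
    qed
    also have "(\<Prod>s\<in>S. t - s) / (\<Prod>s\<in>S. t - s) = 1"
      using S(1) notin [OF t] by (intro divide_self) auto
    finally show ?thesis .
  qed
  define b where "b t = vec (\<lambda>s. v s / (t - s))" for t
  have B_b: "B (b t) = t *\<^sub>R b t" if t: "t \<in> T" for t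
  proof -
    have "cinner (b t) (vec v) = of_real (\<Sum>s\<in>S. (v s)\<^sup>2 / (t - s))"
      by (simp add: b_def cinner_vec power2_eq_square)
    then have "cinner (b t) (vec v) = 1" by (simp add: secular [OF t])
    then have "B (b t) = vec (\<lambda>s. s * (v s / (t - s))) + vec v"
      by (simp add: B_def blinfun.add_left dyad.rep_eq b_def A_vec)
    also have "\<dots> = vec (\<lambda>s. t * (v s / (t - s)))"
      unfolding vec_add
    proof (rule vec_cong)
      fix s assume "s \<in> S"
      then have "t - s \<noteq> 0" using notin [OF t] by auto
      then show "s * (v s / (t - s)) + v s = t * (v s / (t - s))" by (simp add: field_simps)
    qed
    finally show ?thesis by (simp add: b_def vec_scale)
  qed
  \<comment> \<open>The coordinates of \<open>x\<close> with respect to the eigenvectors of \<open>A\<close> and of \<open>B\<close>.\<close>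
  define \<xi> where "\<xi> s = - (v s * poly q s / (\<Prod>t\<in>T. s - t))" for s
  define \<beta> where "\<beta> t = poly q t / (\<Prod>t'\<in>T - {t}. t - t')" for t
  have prodT: "(\<Prod>t\<in>T. s - t) \<noteq> 0" if "s \<in> S" for s
    using T(1) disj that by auto
  have prodS: "(\<Prod>s'\<in>S - {s}. s - s') \<noteq> 0" for s
    using S(1) by auto
  have vec_sum: "(\<Sum>t\<in>T. r t *\<^sub>R vec (a t)) = vec (\<lambda>s. \<Sum>t\<in>T. r t * a t s)" for r a
    unfolding vec_def scaleR_sum_right scaleR_sum_left by (subst sum.swap) simp
  have x_b: "vec \<xi> = (\<Sum>t\<in>T. \<beta> t *\<^sub>R b t)"
    unfolding b_def vec_sum
  proof (rule vec_cong)
    fix s assume s: "s \<in> S"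
    have "(\<Sum>t\<in>T. \<beta> t * (v s / (t - s))) = - v s * (\<Sum>t\<in>T. poly q t / ((\<Prod>t'\<in>T - {t}. t - t') * (s - t)))"
      unfolding sum_distrib_left
    proof (intro sum.cong refl)
      fix t assume "t \<in> T"
      have "v s / (t - s) = - v s / (s - t)" by (simp add: divide_simps algebra_simps)
      then show "\<beta> t * (v s / (t - s)) = - v s * (poly q t / ((\<Prod>t'\<in>T - {t}. t - t') * (s - t)))"
        by (simp add: \<beta>_def)
    qed
    also have "\<dots> = - v s * (poly q s / (\<Prod>t\<in>T. s - t))"
      by (subst lagrange_partial_fractions [OF T(1)]) (use deg card disj s in auto)
    finally show "\<xi> s = (\<Sum>t\<in>T. \<beta> t * (v s / (t - s)))" by (simp add: \<xi>_def)
  qed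
  have b_x: "cinner (b t) (vec \<xi>) = of_real (poly q t / (\<Prod>s\<in>S. t - s))" if t: "t \<in> T" for t
  proof -
    have "(\<Sum>s\<in>S. v s / (t - s) * \<xi> s) = (\<Sum>s\<in>S. poly q s / ((\<Prod>s'\<in>S - {s}. s - s') * (t - s)))"
    proof (intro sum.cong refl)
      fix s assume s: "s \<in> S"
      have "v s / (t - s) * \<xi> s = - ((v s)\<^sup>2 * poly q s / ((\<Prod>t\<in>T. s - t) * (t - s)))"
        by (simp add: \<xi>_def power2_eq_square mult_ac)
      also have "\<dots> = poly q s / ((\<Prod>s'\<in>S - {s}. s - s') * (t - s))"
        using prodT [OF s] by (simp add: v2 [OF s])
      finally show "v s / (t - s) * \<xi> s = poly q s / ((\<Prod>s'\<in>S - {s}. s - s') * (t - s))" .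
    qed
    then show ?thesis
      using lagrange_partial_fractions [OF S(1) deg notin [OF t]] by (simp add: b_def cinner_vec)
  qed
  define M where "M = norm A + norm B + (\<Sum>u\<in>S \<union> T. u)"
  have nnU: "0 \<le> (\<Sum>u\<in>S \<union> T. u)" by (rule sum_nonneg) (use S T in auto)
  have M: "u \<in> {0..M}" if "u \<in> S \<union> T" for u
  proof -
    have "u \<le> (\<Sum>u\<in>S \<union> T. u)"
      using member_le_sum [OF that, of "\<lambda>u. u"] S T by auto
    then show ?thesis using that S(2) T(2) by (auto simp: M_def intro: add_increasing)
  qed
  have fA: "form_between 0 M A" and fB: "form_between 0 M B"
    using form_between_norm [OF posA] form_between_norm [OF posB] nnU
    by (auto intro: form_between_mono simp: M_def)
  have cont: "continuous_on {0..M} f" and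
    le: "\<And>A B :: ell2 \<Rightarrow>\<^sub>L ell2. selfadjoint_op A \<Longrightarrow> selfadjoint_op B \<Longrightarrow>
        spectrum A \<subseteq> complex_of_real ` {0..} \<Longrightarrow> spectrum B \<subseteq> complex_of_real ` {0..} \<Longrightarrow>
        A \<preceq> B \<Longrightarrow> cfc f A \<preceq> cfc f B"
    using mono by (auto simp: operator_monotone_on_def operator_monotone_on_space_def
        intro: continuous_on_subset)
  have "complex_of_real ` {0..M} \<subseteq> complex_of_real ` {0..}" by auto
  then have "cfc f A \<preceq> cfc f B"
    using spectrum_between [OF fA] spectrum_between [OF fB] AB
    by (intro le form_between_selfadjoint [OF fA] form_between_selfadjoint [OF fB]) auto
  then have "0 \<le> qform (cfc f B - cfc f A) (vec \<xi>)"
    by (auto simp: op_le_def positive_op_iff)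
  then have nonneg: "qform (cfc f A) (vec \<xi>) \<le> qform (cfc f B) (vec \<xi>)" by (simp add: qform_simps)
  have "cfc f A (e s) = f s *\<^sub>R e s" if s: "s \<in> S" for s
  proof (rule cfc_eigenvector [OF fA cont])
    have e: "e s = vec (\<lambda>r. if r = s then 1 else 0)"
      using S(1) s by (simp add: vec_def if_distrib [of "\<lambda>c. c *\<^sub>R _"] cong: if_cong)
    show "A (e s) = s *\<^sub>R e s"
      unfolding e A_vec vec_scale by (rule vec_cong) auto
  qed (use M s in auto)
  then have "cfc f A (vec \<xi>) = vec (\<lambda>s. f s * \<xi> s)"
    by (simp add: vec_def blinfun.sum_right blinfun.scaleR_right mult.commute)
  then have qA: "qform (cfc f A) (vec \<xi>) = (\<Sum>s\<in>S. f s * (\<xi> s)\<^sup>2)"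
    by (simp add: qform_def cinner_vec power2_eq_square mult.assoc)
  have "cfc f B (vec \<xi>) = (\<Sum>t\<in>T. (\<beta> t * f t) *\<^sub>R b t)"
    unfolding x_b blinfun.sum_right
  proof (intro sum.cong refl)
    fix t assume "t \<in> T"
    then show "cfc f B (\<beta> t *\<^sub>R b t) = (\<beta> t * f t) *\<^sub>R b t"
      using cfc_eigenvector [OF fB cont M B_b, of t] by (simp add: blinfun.scaleR_right)
  qed
  then have "qform (cfc f B) (vec \<xi>) = (\<Sum>t\<in>T. Re (cinner ((\<beta> t * f t) *\<^sub>R b t) (vec \<xi>)))"
    by (simp add: qform_def cinner_sum_left)
  also have "\<dots> = (\<Sum>t\<in>T. \<beta> t * f t * (poly q t / (\<Prod>s\<in>S. t - s)))"
    by (intro sum.cong refl) (simp only: cinner_scaleR_left b_x of_real_mult [symmetric] Re_complex_of_real)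
  finally have qB: "qform (cfc f B) (vec \<xi>) = (\<Sum>t\<in>T. \<beta> t * f t * (poly q t / (\<Prod>s\<in>S. t - s)))" .
  have "divided_diff (\<lambda>u. f u * (poly q u)\<^sup>2) (S \<union> T)
      = (\<Sum>s\<in>S. f s * (poly q s)\<^sup>2 / (\<Prod>w\<in>(S \<union> T) - {s}. s - w))
      + (\<Sum>t\<in>T. f t * (poly q t)\<^sup>2 / (\<Prod>w\<in>(S \<union> T) - {t}. t - w))"
    unfolding divided_diff_def by (rule sum.union_disjoint [OF S(1) T(1) disj])
  also have "(\<Sum>s\<in>S. f s * (poly q s)\<^sup>2 / (\<Prod>w\<in>(S \<union> T) - {s}. s - w)) = (\<Sum>s\<in>S. - (f s * (\<xi> s)\<^sup>2))"
  proof (intro sum.cong refl)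
    fix s assume s: "s \<in> S"
    have "(S \<union> T) - {s} = (S - {s}) \<union> T" using s disj by auto
    then have "(\<Prod>w\<in>(S \<union> T) - {s}. s - w) = (\<Prod>w\<in>S - {s}. s - w) * (\<Prod>w\<in>T. s - w)"
      by (simp only:) (rule prod.union_disjoint; use S(1) T(1) disj in auto)
    moreover have "(\<xi> s)\<^sup>2 = - ((poly q s)\<^sup>2 / ((\<Prod>w\<in>S - {s}. s - w) * (\<Prod>w\<in>T. s - w)))"
      using prodT [OF s] by (simp add: \<xi>_def power_divide power_mult_distrib v2 [OF s] power2_eq_square [of "\<Prod>t\<in>T. _ t"])
    ultimately show "f s * (poly q s)\<^sup>2 / (\<Prod>w\<in>(S \<union> T) - {s}. s - w) = - (f s * (\<xi> s)\<^sup>2)" by simp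
  qed
  also have "(\<Sum>t\<in>T. f t * (poly q t)\<^sup>2 / (\<Prod>w\<in>(S \<union> T) - {t}. t - w))
      = (\<Sum>t\<in>T. \<beta> t * f t * (poly q t / (\<Prod>s\<in>S. t - s)))"
  proof (intro sum.cong refl)
    fix t assume t: "t \<in> T"
    have "(S \<union> T) - {t} = S \<union> (T - {t})" using t disj by auto
    then have "(\<Prod>w\<in>(S \<union> T) - {t}. t - w) = (\<Prod>w\<in>S. t - w) * (\<Prod>w\<in>T - {t}. t - w)"
      by (simp only:) (rule prod.union_disjoint; use S(1) T(1) disj in auto)
    then show "f t * (poly q t)\<^sup>2 / (\<Prod>w\<in>(S \<union> T) - {t}. t - w) = \<beta> t * f t * (poly q t / (\<Prod>s\<in>S. t - s))"
      by (simp add: \<beta>_def power2_eq_square mult_ac)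
  qed
  finally show ?thesis using nonneg by (simp add: qA qB sum_negf)
qed

text \<open>
  Splitting \<open>U\<close> according to the parity of the number of larger elements produces two interlacing
  sets: for \<open>s\<close> with an odd number of larger elements, the product of all differences \<open>s - w\<close> is
  negative.
\<close>

lemma interlacing_split:
  fixes U :: "real set"
  assumes U: "finite U" and card: "card U = 2 * k"
  obtains S T where "S \<union> T = U" "S \<inter> T = {}" "card S = k" "card T = k"
    "\<And>s. s \<in> S \<Longrightarrow> (\<Prod>t\<in>T. s - t) / (\<Prod>s'\<in>S - {s}. s - s') < 0"
proof -
  define r where "r u = card {w \<in> U. u < w}" for u
  define S where "S = {u \<in> U. odd (r u)}"
  define T where "T = {u \<in> U. even (r u)}"
  have ST: "S \<union> T = U" "S \<inter> T = {}" by (auto simp: S_def T_def)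
  then have fin: "finite S" "finite T" using U by (metis finite_Un)+
  have less: "r u' < r u" if "u < u'" "u' \<in> U" for u u'
    unfolding r_def by (rule psubset_card_mono) (use U that in auto)
  have inj: "inj_on r U"
    by (rule inj_onI) (metis less less_irrefl linorder_neqE_linordered_idom)
  have "r ` U \<subseteq> {..<2 * k}"
  proof safe
    fix u assume "u \<in> U"
    then have "r u < card U" unfolding r_def by (intro psubset_card_mono U) auto
    then show "r u < 2 * k" by (simp add: card)
  qed
  moreover have "card (r ` U) = 2 * k" by (simp add: card_image inj card)
  ultimately have range: "r ` U = {..<2 * k}" by (intro card_subset_eq) auto
  have "r ` S = {i \<in> {..<2 * k}. odd i}" unfolding S_def range [symmetric] by auto
  also have "\<dots> = (\<lambda>i. 2 * i + 1) ` {..<k}"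
    by (auto elim!: oddE simp: image_iff)
  finally have "card (r ` S) = k" by (simp add: card_image inj_on_def)
  then have cS: "card S = k"
    using inj by (metis card_image inj_on_subset ST(1) Un_upper1)
  have "card U = card S + card T" using card_Un_disjoint [OF fin ST(2)] ST(1) by simp
  then have cT: "card T = k" using cS card by simp
  have sgn: "sgn (\<Prod>w\<in>W. u - w) = (- 1) ^ card {w \<in> W. u < w}"
    if "finite W" "u \<notin> W" for W and u :: real
    using that
  proof (induction W rule: finite_induct)
    case (insert w W)
    have "{x \<in> insert w W. u < x} = (if u < w then insert w {x \<in> W. u < x} else {x \<in> W. u < x})" by auto
    moreover have "sgn (u - w) = (if u < w then - 1 else 1)" using insert.prems by (simp add: sgn_if)
    moreover have "sgn (\<Prod>x\<in>insert w W. u - x) = sgn (u - w) * sgn (\<Prod>x\<in>W. u - x)"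
      using insert.hyps by (simp add: sgn_mult)
    moreover have "sgn (\<Prod>x\<in>W. u - x) = (- 1) ^ card {x \<in> W. u < x}"
      using insert by simp
    ultimately show ?case using insert.hyps by simp
  qed simp
  have "(\<Prod>t\<in>T. s - t) / (\<Prod>s'\<in>S - {s}. s - s') < 0" if s: "s \<in> S" for s
  proof -
    have "U - {s} = T \<union> (S - {s})" using ST s by auto
    then have "(\<Prod>w\<in>U - {s}. s - w) = (\<Prod>t\<in>T. s - t) * (\<Prod>s'\<in>S - {s}. s - s')"
      by (simp only:) (rule prod.union_disjoint; use fin ST(2) in auto)
    moreover have "sgn (\<Prod>w\<in>U - {s}. s - w) = (- 1) ^ r s"
    proof -
      have "{w \<in> U - {s}. s < w} = {w \<in> U. s < w}" by auto
      then show ?thesis using sgn [of "U - {s}" s] U by (simp add: r_def)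
    qed
    moreover have "odd (r s)" using s by (simp add: S_def)
    ultimately have "sgn ((\<Prod>t\<in>T. s - t) * (\<Prod>s'\<in>S - {s}. s - s')) < 0" by simp
    then have "(\<Prod>t\<in>T. s - t) * (\<Prod>s'\<in>S - {s}. s - s') < 0"
      by (simp only: sgn_less)
    then show ?thesis by (simp add: divide_less_0_iff mult_less_0_iff)
  qed
  then show ?thesis using that ST cS cT by blast
qed

text \<open>
  The sign of the divided differences of \<open>f q\<^sup>2\<close> for an operator monotone \<open>f\<close>. An odd number of
  points is reduced to an even one by adding a point \<open>M\<close> and replacing \<open>q\<close> by \<open>q (x - M)\<close>,
  which vanishes there; then let \<open>M\<close> tend to infinity.
\<close>

lemma divided_diff_sign:
  assumes mono: "operator_monotone_on {0..} f" and U: "finite U" "U \<subseteq> {0..}"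
    and deg: "2 * degree q + 2 \<le> card U"
  shows "0 \<le> (- 1) ^ card U * divided_diff (\<lambda>u. f u * (poly q u)\<^sup>2) U"
proof -
  have even_case: "0 \<le> divided_diff (\<lambda>u. f u * (poly q u)\<^sup>2) U"
    if U: "finite U" "U \<subseteq> {0..}" and deg: "2 * degree q + 2 \<le> card U" and ev: "even (card U)" for U q
  proof -
    obtain k where k: "card U = 2 * k" using ev by (rule evenE)
    obtain S T where "S \<union> T = U" "S \<inter> T = {}" "card S = k" "card T = k"
      "\<And>s. s \<in> S \<Longrightarrow> (\<Prod>t\<in>T. s - t) / (\<Prod>s'\<in>S - {s}. s - s') < 0"
      using interlacing_split [OF U(1) k] by metis
    moreover from this have "finite S" "finite T" "S \<subseteq> {0..}" "T \<subseteq> {0..}" using U by auto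
    ultimately show ?thesis
      using interlacing_divided_diff_nonneg [OF mono, of S T q] deg k by auto
  qed
  show ?thesis
  proof (cases "even (card U)")
    case True
    then show ?thesis using even_case [OF U deg] by simp
  next
    case False
    define a where "a u = f u * (poly q u)\<^sup>2 / (\<Prod>w\<in>U - {u}. u - w)" for u
    define m where "m = 1 + (\<Sum>u\<in>U. u)"
    have m: "u < m" if "u \<in> U" for u
    proof -
      have "u \<le> (\<Sum>u\<in>U. u)" by (rule member_le_sum [OF that]) (use U in auto)
      then show ?thesis by (simp add: m_def)
    qed
    have m0: "0 \<le> m" unfolding m_def using U(2) by (intro add_nonneg_nonneg sum_nonneg) auto
    have large: "0 \<le> (\<Sum>u\<in>U. a u * (u - M))" if M: "m \<le> M" for M
    proof -
      have MU: "M \<notin> U" using m M by force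
      let ?q = "q * [:- M, 1:]"
      have "degree ?q \<le> degree q + 1"
        using degree_mult_le [of q "[:- M, 1:]"] by simp
      moreover have "card (insert M U) = Suc (card U)" using MU U(1) by simp
      moreover from this have "2 * degree q + 2 \<noteq> card U" using False by presburger
      ultimately have "0 \<le> divided_diff (\<lambda>u. f u * (poly ?q u)\<^sup>2) (insert M U)"
        using U m0 M deg False by (intro even_case) auto
      also have "\<dots> = (\<Sum>u\<in>U. f u * (poly ?q u)\<^sup>2 / (\<Prod>w\<in>insert M U - {u}. u - w))"
        using U(1) MU by (simp add: divided_diff_def)
      also have "\<dots> = (\<Sum>u\<in>U. a u * (u - M))"
      proof (intro sum.cong refl)
        fix u assume u: "u \<in> U"
        then have uM: "u - M \<noteq> 0" using MU by auto
        have "insert M U - {u} = insert M (U - {u})" using u MU by auto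
        then have "(\<Prod>w\<in>insert M U - {u}. u - w) = (u - M) * (\<Prod>w\<in>U - {u}. u - w)"
          using U(1) MU by simp
        moreover have "poly ?q u = poly q u * (u - M)" by (simp add: algebra_simps)
        ultimately show "f u * (poly ?q u)\<^sup>2 / (\<Prod>w\<in>insert M U - {u}. u - w) = a u * (u - M)"
          using uM by (simp only: a_def power_mult_distrib) (simp add: power2_eq_square)
      qed
      finally show ?thesis .
    qed
    have "(\<Sum>u\<in>U. a u) \<le> 0"
    proof (rule ccontr)
      assume "\<not> (\<Sum>u\<in>U. a u) \<le> 0"
      then have pos: "0 < (\<Sum>u\<in>U. a u)" by simp
      define M where "M = max m ((\<Sum>u\<in>U. a u * u) / (\<Sum>u\<in>U. a u) + 1)"
      have "0 \<le> (\<Sum>u\<in>U. a u * u) - (\<Sum>u\<in>U. a u) * M"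
        using large [of M] by (simp add: M_def right_diff_distrib sum_subtractf sum_distrib_right)
      then have "M \<le> (\<Sum>u\<in>U. a u * u) / (\<Sum>u\<in>U. a u)" using pos by (simp add: pos_le_divide_eq mult.commute)
      then show False by (simp add: M_def)
    qed
    then show ?thesis using False by (simp add: divided_diff_def a_def)
  qed
qed

section \<open>Polynomials that are nonnegative on a half-line\<close>

text \<open>
  Sums of terms \<open>q\<^sup>2\<close> and \<open>y q\<^sup>2\<close>, each of degree at most \<open>d\<close>. The degree bound matters because the
  sign of the divided difference of \<open>f q\<^sup>2\<close> is known only if \<open>q\<close> has small degree compared with the number of points.
\<close>

inductive halfline_sos :: "nat \<Rightarrow> real poly \<Rightarrow> bool" for d where
  square: "2 * degree q \<le> d \<Longrightarrow> halfline_sos d (q\<^sup>2)"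
| X_square: "2 * degree q + 1 \<le> d \<Longrightarrow> halfline_sos d ([:0, 1:] * q\<^sup>2)"
| add: "halfline_sos d p \<Longrightarrow> halfline_sos d p' \<Longrightarrow> halfline_sos d (p + p')"

lemma halfline_sos_mult_square:
  assumes "halfline_sos e p" "2 * degree q \<le> d"
  shows "halfline_sos (d + e) (q\<^sup>2 * p)"
  using assms(1)
proof (induction rule: halfline_sos.induct)
  case (square r)
  have "halfline_sos (d + e) ((q * r)\<^sup>2)"
    using square assms(2) degree_mult_le [of q r] by (intro halfline_sos.square) simp
  then show ?case by (simp add: power_mult_distrib)
next
  case (X_square r)
  have "halfline_sos (d + e) ([:0, 1:] * (q * r)\<^sup>2)"
    using X_square assms(2) degree_mult_le [of q r] by (intro halfline_sos.X_square) simp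
  also have "[:0, 1:] * (q * r)\<^sup>2 = q\<^sup>2 * ([:0, 1:] * r\<^sup>2)" by (simp only: power_mult_distrib mult_ac)
  finally show ?case .
next
  case (add p p')
  then show ?case unfolding distrib_left by (intro halfline_sos.add)
qed

lemma halfline_sos_mult_X_square:
  assumes "halfline_sos e p" "2 * degree q + 1 \<le> d"
  shows "halfline_sos (d + e) ([:0, 1:] * q\<^sup>2 * p)"
  using assms(1)
proof (induction rule: halfline_sos.induct)
  case (square r)
  have "halfline_sos (d + e) ([:0, 1:] * (q * r)\<^sup>2)"
    using square assms(2) degree_mult_le [of q r] by (intro halfline_sos.X_square) simp
  then show ?case by (simp only: power_mult_distrib mult_ac)
next
  case (X_square r)
  have "degree ([:0, 1:] * (q * r)) \<le> 1 + (degree q + degree r)"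
    using degree_mult_le [of "[:0, 1:]" "q * r"] degree_mult_le [of q r] by simp
  then have "halfline_sos (d + e) (([:0, 1:] * (q * r))\<^sup>2)"
    using X_square assms(2) by (intro halfline_sos.square) linarith
  also have "([:0, 1:] * (q * r))\<^sup>2 = [:0, 1:] * q\<^sup>2 * ([:0, 1:] * r\<^sup>2)"
    by (simp only: power2_eq_square mult_ac)
  finally show ?case .
next
  case (add p p')
  then show ?case unfolding distrib_left by (intro halfline_sos.add)
qed

lemma halfline_sos_mult:
  assumes "halfline_sos d p" "halfline_sos e p'"
  shows "halfline_sos (d + e) (p * p')"
  using assms(1)
proof (induction rule: halfline_sos.induct)
  case (square q)
  then show ?case by (intro halfline_sos_mult_square assms)
next
  case (X_square q)
  then show ?case by (intro halfline_sos_mult_X_square assms)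
next
  case (add p q)
  then show ?case unfolding distrib_right by (intro halfline_sos.add)
qed

lemma halfline_sos_mono: "halfline_sos d p \<Longrightarrow> d \<le> e \<Longrightarrow> halfline_sos e p"
  by (induction rule: halfline_sos.induct) (auto intro: halfline_sos.intros simp del: mult_pCons_left)

lemma halfline_sos_const: "0 \<le> c \<Longrightarrow> halfline_sos 0 [:c:]"
  using halfline_sos.square [of "[:sqrt c:]" 0] by (simp add: power2_eq_square)

lemma poly_nonneg_limit_right:
  assumes "\<And>y. c < y \<Longrightarrow> 0 \<le> poly p y"
  shows "0 \<le> poly p (c :: real)"
proof (rule tendsto_lowerbound)
  show "(poly p \<longlongrightarrow> poly p c) (at_right c)"
    using continuous_within_poly by (simp only: continuous_within)
  show "\<forall>\<^sub>F y in at_right c. 0 \<le> poly p y"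
    unfolding eventually_at_right_field by (intro exI [of _ "c + 1"]) (use assms in auto)
qed simp

lemma poly_nonpos_limit_left:
  assumes "a < c" "\<And>y. a < y \<Longrightarrow> y < c \<Longrightarrow> poly p y \<le> 0"
  shows "poly p (c :: real) \<le> 0"
proof (rule tendsto_upperbound)
  show "(poly p \<longlongrightarrow> poly p c) (at_left c)"
    using continuous_within_poly by (simp only: continuous_within)
  show "\<forall>\<^sub>F y in at_left c. poly p y \<le> 0"
    using assms by (auto simp: eventually_at_left_field)
qed simp

text \<open>
  Factor over the reals. A factor \<open>y - c\<close> with \<open>c \<le> 0\<close> and a factor \<open>(y - a)\<^sup>2 + b\<^sup>2\<close> are of the
  required form themselves; a root \<open>c > 0\<close> has even multiplicity because \<open>p\<close> does not change sign
  there, so that \<open>(y - c)\<^sup>2\<close> can be split off.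
\<close>

lemma halfline_sos_if_nonneg:
  assumes "\<And>y. 0 \<le> y \<Longrightarrow> 0 \<le> poly p y"
  shows "halfline_sos (degree p) p"
  using assms
proof (induction "degree p" arbitrary: p rule: less_induct)
  case less
  show ?case
  proof (cases "degree p = 0")
    case True
    then obtain c where c: "p = [:c:]" by (rule degree_eq_zeroE)
    then show ?thesis using less.prems [of 0] halfline_sos_const by simp
  next
    case False
    then have p0: "p \<noteq> 0" by auto
    from False have "0 < degree p" by simp
    then show ?thesis
    proof (cases rule: real_poly_factor)
      case (1 c r)
      have r0: "r \<noteq> 0" using p0 1 by auto
      have deg: "degree p = 1 + degree r" unfolding 1 by (subst degree_mult_eq) (use r0 in auto)
      have val: "poly p y = (y - c) * poly r y" for y unfolding 1 by (simp add: algebra_simps)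
      have r_right: "0 \<le> poly r y" if "0 \<le> y" "c < y" for y
        using less.prems [OF that(1)] that(2) by (simp add: val zero_le_mult_iff)
      show ?thesis
      proof (cases "c \<le> 0")
        case True
        have "0 \<le> poly r y" if "0 \<le> y" for y
        proof (rule poly_nonneg_limit_right)
          show "0 \<le> poly r z" if "y < z" for z using r_right [of z] that \<open>0 \<le> y\<close> True by simp
        qed
        then have "halfline_sos (degree r) r" using deg by (intro less.hyps) auto
        moreover have "halfline_sos 1 [:- c, 1:]"
        proof -
          have "[:- c, 1:] = [:- c:] + [:0, 1:] * 1\<^sup>2" by simp
          also have "halfline_sos 1 \<dots>"
            using True by (intro halfline_sos.add halfline_sos.X_square halfline_sos_mono [OF halfline_sos_const]) auto
          finally show ?thesis .
        qed
        ultimately show ?thesis unfolding deg unfolding 1 by (intro halfline_sos_mult)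
      next
        case False
        have "poly r c \<le> 0"
        proof (rule poly_nonpos_limit_left [of 0])
          show "poly r y \<le> 0" if "0 < y" "y < c" for y
            using less.prems [of y] that by (simp add: val zero_le_mult_iff)
        qed (use False in simp)
        moreover have "0 \<le> poly r c" by (rule poly_nonneg_limit_right) (use r_right False in auto)
        ultimately have "poly r c = 0" by simp
        then have "[:- c, 1:] dvd r" by (rule poly_eq_0_iff_dvd [THEN iffD1])
        then obtain r' where r': "r = [:- c, 1:] * r'" by (rule dvdE)
        have "r' \<noteq> 0" using r0 unfolding r' by (intro notI) simp
        then have degr: "degree r = 1 + degree r'" unfolding r' by (subst degree_mult_eq) auto
        have val': "poly p y = (y - c)\<^sup>2 * poly r' y" for y
          unfolding val r' by (simp add: algebra_simps power2_eq_square)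
        have nn: "0 \<le> poly r' y" if "0 \<le> y" "y \<noteq> c" for y
          using less.prems [OF that(1)] that(2) by (simp add: val' zero_le_mult_iff)
        have "0 \<le> poly r' c" by (rule poly_nonneg_limit_right) (use nn False in auto)
        then have "0 \<le> poly r' y" if "0 \<le> y" for y using nn [OF that] by (cases "y = c") auto
        then have "halfline_sos (degree r') r'" using deg degr by (intro less.hyps) auto
        then have "halfline_sos (2 + degree r') ([:- c, 1:]\<^sup>2 * r')"
          by (intro halfline_sos_mult_square) auto
        moreover have "degree p = 2 + degree r'" using deg degr by simp
        moreover have "p = [:- c, 1:]\<^sup>2 * r'"
          unfolding 1 r' by (simp only: power2_eq_square mult.assoc)
        ultimately show ?thesis by metis
      qed
    next
      case (2 a b r)
      define Q where "Q = [:a\<^sup>2 + b\<^sup>2, - 2 * a, 1:]"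
      have p: "p = Q * r" unfolding Q_def by (rule 2(2))
      have Q: "Q = [:- a, 1:]\<^sup>2 + [:b:]\<^sup>2" by (simp add: Q_def power2_eq_square)
      have "poly Q y = (y - a)\<^sup>2 + b\<^sup>2" for y by (simp add: Q power2_eq_square algebra_simps)
      then have Qpos: "0 < poly Q y" for y using 2 by (simp add: add_nonneg_pos)
      have r0: "r \<noteq> 0" "Q \<noteq> 0" using p0 by (auto simp: p)
      have "degree Q = 2" by (simp add: Q_def)
      then have deg: "degree p = 2 + degree r" by (simp add: p degree_mult_eq r0)
      have "0 \<le> poly r y" if "0 \<le> y" for y
        using less.prems [OF that] Qpos [of y] by (simp add: p zero_le_mult_iff)
      then have "halfline_sos (degree r) r" using deg by (intro less.hyps) auto
      moreover have "halfline_sos 2 Q"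
        unfolding Q by (intro halfline_sos.add halfline_sos.square) auto
      ultimately show ?thesis unfolding deg unfolding p by (intro halfline_sos_mult)
    qed
  qed
qed

section \<open>Approximation by mixtures\<close>

text \<open>
  Any functional \<open>\<Sum> c t * g t\<close> is encoded in the numerator \<open>P\<close> of
  \<open>\<Sum> c t * t / (t + y) = P y / \<Prod> (t + y)\<close>. If it is nonnegative on all weighted harmonic means,
  then \<open>P \<ge> 0\<close> on the half-line, so \<open>P\<close> is a sum of terms \<open>q\<^sup>2\<close> and \<open>y q\<^sup>2\<close>. For \<open>y q\<^sup>2\<close>
  the functional is, up to sign, the divided difference of \<open>f t * (q (- t))\<^sup>2\<close> over \<open>S\<close>. For \<open>q\<^sup>2\<close> it is the
  one over \<open>S\<close> together with \<open>0\<close>, plus a nonnegative multiple of \<open>f 0\<close>.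
\<close>

lemma functional_nonneg:
  assumes mono: "operator_monotone_on {0..} f" and f0: "0 \<le> f 0"
    and S: "finite S" "S \<subseteq> {0<..}" "S \<noteq> {}"
    and dual: "\<And>l. 0 \<le> l \<Longrightarrow> l \<le> 1 \<Longrightarrow> 0 \<le> (\<Sum>t\<in>S. c t * harmonic_fun l t)"
  shows "0 \<le> (\<Sum>t\<in>S. c t * f t)"
proof -
  define n where "n = card S"
  have n: "0 < n" using S by (simp add: n_def card_gt_0_iff)
  define N where "N t = (\<Prod>w\<in>S - {t}. [:w, 1:])" for t :: real
  define P where "P = (\<Sum>t\<in>S. smult (c t * t) (N t))"
  have N: "poly (N t) y = (\<Prod>w\<in>S - {t}. w + y)" for t y
    by (simp add: N_def poly_prod)
  have "degree (N t) \<le> n - 1" if "t \<in> S" for t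
  proof -
    have "degree (N t) = (\<Sum>w\<in>S - {t}. degree [:w, 1:])"
      unfolding N_def by (rule degree_prod_sum_eq) simp
    then show ?thesis using S that by (simp add: n_def)
  qed
  then have degP: "degree P \<le> n - 1"
    unfolding P_def by (intro degree_sum_le S(1)) (meson degree_smult_le order_trans)
  have pos: "0 < t" if "t \<in> S" for t using S that by auto
  have "0 \<le> poly P y" if y: "0 \<le> y" for y
  proof -
    \<comment> \<open>The parameter \<open>l = y / (1 + y)\<close> turns \<open>harmonic_fun l t\<close> into \<open>(1 + y) t / (t + y)\<close>.\<close>
    have "poly P y = (\<Sum>t\<in>S. (\<Prod>w\<in>S. w + y) / (1 + y) * (c t * harmonic_fun (y / (1 + y)) t))"
      unfolding P_def poly_sum poly_smult N
    proof (intro sum.cong refl)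
      fix t assume t: "t \<in> S"
      have prod: "(\<Prod>w\<in>S. w + y) = (t + y) * (\<Prod>w\<in>S - {t}. w + y)" by (rule prod.remove [OF S(1) t])
      have "1 - y / (1 + y) = 1 / (1 + y)" using y by (simp add: field_simps)
      then have "(1 - y / (1 + y)) * t + y / (1 + y) = (t + y) / (1 + y)"
        by (simp only: add_divide_distrib) simp
      then have "harmonic_fun (y / (1 + y)) t = t * (1 + y) / (t + y)" by (simp add: harmonic_fun_def)
      then show "c t * t * (\<Prod>w\<in>S - {t}. w + y)
          = (\<Prod>w\<in>S. w + y) / (1 + y) * (c t * harmonic_fun (y / (1 + y)) t)"
        using y pos [OF t] unfolding prod by simp
    qed
    also have "\<dots> = (\<Prod>w\<in>S. w + y) / (1 + y) * (\<Sum>t\<in>S. c t * harmonic_fun (y / (1 + y)) t)"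
      by (simp only: sum_distrib_left)
    also have "0 \<le> \<dots>"
      using y S(2) by (intro mult_nonneg_nonneg divide_nonneg_nonneg prod_nonneg dual) (auto intro: add_nonneg_nonneg less_imp_le)
    finally show ?thesis .
  qed
  then have sos: "halfline_sos (n - 1) P"
    using halfline_sos_mono [OF halfline_sos_if_nonneg degP] by blast
  define \<Lambda> where "\<Lambda> p = (\<Sum>t\<in>S. poly p (- t) / (t * (\<Prod>w\<in>S - {t}. w - t)) * f t)" for p
  have swap: "(\<Prod>w\<in>S - {t}. t - w) = (- 1) ^ (n - 1) * (\<Prod>w\<in>S - {t}. w - t)" if "t \<in> S" for t
  proof -
    have "(\<Prod>w\<in>S - {t}. t - w) = (\<Prod>w\<in>S - {t}. (- 1) * (w - t))" by (intro prod.cong) auto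
    also have "\<dots> = (- 1) ^ (n - 1) * (\<Prod>w\<in>S - {t}. w - t)"
      unfolding prod.distrib using S that by (simp add: n_def)
    finally show ?thesis .
  qed
  have sgn: "(- 1) ^ (n - 1) * (- 1) ^ (n - 1) = (1 :: real)" "(- 1) ^ n = - ((- 1) ^ (n - 1) :: real)"
    using n by (cases n, simp_all flip: power_mult_distrib)+
  have nonneg: "0 \<le> \<Lambda> p" if "halfline_sos (n - 1) p" for p
    using that
  proof (induction rule: halfline_sos.induct)
    case (square q)
    let ?q = "pcompose q [:0, - 1:]" and ?U = "insert 0 S"
    have q: "poly ?q u = poly q (- u)" for u by (simp add: poly_pcompose)
    have zero: "0 \<notin> S" using S(2) by auto
    have card: "card ?U = Suc n" using S(1) zero by (simp add: n_def)
    have "0 \<le> (- 1) ^ card ?U * divided_diff (\<lambda>u. f u * (poly ?q u)\<^sup>2) ?U"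
    proof (rule divided_diff_sign [OF mono])
      have "degree ?q \<le> degree q" using degree_pcompose_le [of q "[:0, - 1:]"] by simp
      then show "2 * degree ?q + 2 \<le> card ?U" using square n unfolding card by linarith
    qed (use S in \<open>auto intro: less_imp_le\<close>)
    also have "divided_diff (\<lambda>u. f u * (poly ?q u)\<^sup>2) ?U
        = f 0 * (poly q 0)\<^sup>2 / (\<Prod>w\<in>S. - w)
        + (\<Sum>t\<in>S. f t * (poly q (- t))\<^sup>2 / (\<Prod>w\<in>?U - {t}. t - w))"
      using S(1) zero by (simp add: divided_diff_def q)
    also have "(\<Sum>t\<in>S. f t * (poly q (- t))\<^sup>2 / (\<Prod>w\<in>?U - {t}. t - w)) = (- 1) ^ (n - 1) * \<Lambda> (q\<^sup>2)"
      unfolding \<Lambda>_def sum_distrib_left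
    proof (intro sum.cong refl)
      fix t assume t: "t \<in> S"
      have "?U - {t} = insert 0 (S - {t})" using zero t by auto
      then have "(\<Prod>w\<in>?U - {t}. t - w) = t * (\<Prod>w\<in>S - {t}. t - w)"
        using S(1) zero by simp
      then have "(\<Prod>w\<in>?U - {t}. t - w) = t * ((- 1) ^ (n - 1) * (\<Prod>w\<in>S - {t}. w - t))"
        by (simp only: swap [OF t])
      then show "f t * (poly q (- t))\<^sup>2 / (\<Prod>w\<in>?U - {t}. t - w)
          = (- 1) ^ (n - 1) * (poly (q\<^sup>2) (- t) / (t * (\<Prod>w\<in>S - {t}. w - t)) * f t)"
        by (cases "even (n - 1)") simp_all
    qed
    also have "(\<Prod>w\<in>S. - w) = (- 1) ^ n * (\<Prod>w\<in>S. w)"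
      using prod.distrib [of "\<lambda>_. - 1" "\<lambda>w. w" S] by (simp add: n_def)
    \<comment> \<open>The extra point \<open>0\<close> contributes with a negative sign, so that \<open>f 0 \<ge> 0\<close> helps.\<close>
    finally have "0 \<le> \<Lambda> (q\<^sup>2) - f 0 * (poly q 0)\<^sup>2 / (\<Prod>w\<in>S. w)"
      unfolding card by (cases "even (n - 1)") (simp_all add: sgn)
    moreover have "0 \<le> f 0 * (poly q 0)\<^sup>2 / (\<Prod>w\<in>S. w)"
      using f0 pos by (intro divide_nonneg_nonneg mult_nonneg_nonneg prod_nonneg) (auto intro: less_imp_le)
    ultimately show ?case by linarith
  next
    case (X_square q)
    let ?q = "pcompose q [:0, - 1:]"
    have q: "poly ?q u = poly q (- u)" for u by (simp add: poly_pcompose)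
    have "0 \<le> (- 1) ^ card S * divided_diff (\<lambda>u. f u * (poly ?q u)\<^sup>2) S"
    proof (rule divided_diff_sign [OF mono S(1)])
      have "degree ?q \<le> degree q" using degree_pcompose_le [of q "[:0, - 1:]"] by simp
      then show "2 * degree ?q + 2 \<le> card S" using X_square n unfolding n_def [symmetric] by linarith
    qed (use S in \<open>auto intro: less_imp_le\<close>)
    also have "(- 1) ^ card S * divided_diff (\<lambda>u. f u * (poly ?q u)\<^sup>2) S = \<Lambda> ([:0, 1:] * q\<^sup>2)"
      unfolding \<Lambda>_def divided_diff_def sum_distrib_left
    proof (intro sum.cong refl)
      fix t assume t: "t \<in> S"
      show "(- 1) ^ card S * (f t * (poly ?q t)\<^sup>2 / (\<Prod>w\<in>S - {t}. t - w))
          = poly ([:0, 1:] * q\<^sup>2) (- t) / (t * (\<Prod>w\<in>S - {t}. w - t)) * f t"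
        unfolding n_def [symmetric] sgn(2) swap [OF t] using pos [OF t]
        by (cases "even (n - 1)") (simp_all add: q)
    qed
    finally show ?case .
  next
    case (add p p')
    then show ?case by (simp add: \<Lambda>_def add_divide_distrib distrib_right sum.distrib)
  qed
  have "0 \<le> \<Lambda> P" by (rule nonneg [OF sos])
  also have "\<Lambda> P = (\<Sum>t\<in>S. c t * f t)"
    unfolding \<Lambda>_def
  proof (intro sum.cong refl)
    fix t assume t: "t \<in> S"
    have "poly P (- t) = (\<Sum>r\<in>S. if r = t then c t * t * (\<Prod>w\<in>S - {t}. w - t) else 0)"
      unfolding P_def poly_sum poly_smult N
    proof (intro sum.cong refl)
      fix r assume "r \<in> S"
      show "c r * r * (\<Prod>w\<in>S - {r}. w + - t) = (if r = t then c t * t * (\<Prod>w\<in>S - {t}. w - t) else 0)"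
      proof (cases "r = t")
        case False
        then have "(\<Prod>w\<in>S - {r}. w + - t) = 0" using S(1) t by (intro prod_zero) auto
        then show ?thesis using False by simp
      qed simp
    qed
    also have "\<dots> = c t * t * (\<Prod>w\<in>S - {t}. w - t)" using S(1) t by simp
    finally show "poly P (- t) / (t * (\<Prod>w\<in>S - {t}. w - t)) * f t = c t * f t"
      using pos [OF t] S(1) by simp
  qed
  finally show ?thesis .
qed

lemma harmonic_mixture_bounds:
  "harmonic_mixture g \<mu> \<kappa> m \<Longrightarrow> 0 < t \<Longrightarrow> 0 \<le> g t \<and> g t \<le> 1 + t"
proof (induction rule: harmonic_mixture.induct)
  case (single l)
  have d: "min 1 t \<le> (1 - l) * t + l" "0 < (1 - l) * t + l"
    using single by (auto intro: harmonic_denominator_ge harmonic_denominator_pos)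
  have "t \<le> (1 + t) * min 1 t" using single by (auto simp: min_def algebra_simps)
  also have "\<dots> \<le> (1 + t) * ((1 - l) * t + l)" using d single by (intro mult_left_mono) auto
  finally show ?case using d single by (simp add: harmonic_fun_def pos_divide_le_eq)
next
  case (convex g \<mu> \<kappa> m g' \<mu>' \<kappa>' m' s)
  then show ?case
    using convex_comb_mono [of s 0 "g t" 0 "g' t"] convex_comb_mono [of s "g t" "1 + t" "g' t" "1 + t"]
    by (simp add: algebra_simps)
qed

text \<open>
  Take a mixture \<open>g\<close> whose squared distance to \<open>f\<close> on \<open>S\<close> is nearly minimal. Moving from \<open>g\<close>
  a little towards \<open>harmonic_fun l\<close> cannot decrease the distance much, which says that the functional
  with coefficients \<open>g - f\<close> is almost as small at \<open>g\<close> as at any \<open>harmonic_fun l\<close>. By duality it is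
  then almost as small at \<open>g\<close> as at \<open>f\<close>, and the difference of these two values is the squared distance.
\<close>

lemma mixture_approx_finite:
  assumes mono: "operator_monotone_on {0..} f" and f0: "0 \<le> f 0" and f1: "f 1 = 1"
    and S: "finite S" "S \<subseteq> {0<..}" "1 \<in> S" and e: "0 < e"
  obtains g \<mu> \<kappa> m where "harmonic_mixture g \<mu> \<kappa> m" "(\<Sum>t\<in>S. (g t - f t)\<^sup>2) \<le> e"
proof -
  define F where "F g = (\<Sum>t\<in>S. (g t - f t)\<^sup>2)" for g
  define D where "D = {F g | g \<mu> \<kappa> m. harmonic_mixture g \<mu> \<kappa> m}"
  have ne: "D \<noteq> {}" using harmonic_mixture.single [of 0] by (auto simp: D_def)
  have bdd: "bdd_below D" by (rule bdd_belowI [of _ 0]) (auto simp: D_def F_def intro: sum_nonneg)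
  define C where "C = 1 + (\<Sum>t\<in>S. (1 + t)\<^sup>2)"
  have C: "0 < C" unfolding C_def by (intro add_pos_nonneg sum_nonneg) auto
  define s where "s = min 1 (e / C)"
  have s: "0 < s" "s \<le> 1" "s * C \<le> e" using e C by (auto simp: s_def min_def field_simps)
  have "Inf D < Inf D + s * e" using s e by simp
  then obtain x where "x \<in> D" "x < Inf D + s * e" using cInf_lessD [OF ne] by blast
  then obtain g \<mu> \<kappa> m where g: "harmonic_mixture g \<mu> \<kappa> m" and Fg: "F g < Inf D + s * e"
    by (auto simp: D_def)
  define c where "c t = g t - f t" for t
  define k where "k = (\<Sum>t\<in>S. c t * g t) - e"
  \<comment> \<open>The step length \<open>s\<close> is chosen so that the quadratic term is at most \<open>s e\<close>, like the defect of \<open>g\<close>.\<close>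
  have low: "k \<le> (\<Sum>t\<in>S. c t * harmonic_fun l t)" if l: "0 \<le> l" "l \<le> 1" for l
  proof -
    let ?h = "harmonic_fun l"
    let ?g = "\<lambda>t. (1 - s) * g t + s * ?h t"
    have "F ?g \<in> D"
      unfolding D_def using harmonic_mixture.convex [OF g harmonic_mixture.single [OF l], of s] s by auto
    then have "Inf D \<le> F ?g" by (rule cInf_lower [OF _ bdd])
    also have "F ?g = (\<Sum>t\<in>S. (c t)\<^sup>2 + 2 * s * (c t * ?h t - c t * g t) + s\<^sup>2 * (?h t - g t)\<^sup>2)"
      unfolding F_def c_def by (intro sum.cong refl) (simp add: power2_eq_square algebra_simps)
    also have "\<dots> = F g + 2 * s * ((\<Sum>t\<in>S. c t * ?h t) - (\<Sum>t\<in>S. c t * g t)) + s\<^sup>2 * (\<Sum>t\<in>S. (?h t - g t)\<^sup>2)"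
      by (simp add: F_def c_def sum.distrib sum_subtractf sum_distrib_left right_diff_distrib)
    also have "(\<Sum>t\<in>S. (?h t - g t)\<^sup>2) \<le> C"
    proof -
      have "(\<Sum>t\<in>S. (?h t - g t)\<^sup>2) \<le> (\<Sum>t\<in>S. (1 + t)\<^sup>2)"
      proof (rule sum_mono)
        fix t assume "t \<in> S"
        then have t: "0 < t" using S by auto
        have "\<bar>?h t - g t\<bar> \<le> 1 + t"
          using harmonic_mixture_bounds [OF harmonic_mixture.single [OF l] t] harmonic_mixture_bounds [OF g t]
          by (simp add: abs_le_iff)
        then show "(?h t - g t)\<^sup>2 \<le> (1 + t)\<^sup>2" using t by (simp add: abs_le_square_iff [symmetric])
      qed
      then show ?thesis by (simp add: C_def)
    qed
    finally have "Inf D \<le> F g + 2 * s * ((\<Sum>t\<in>S. c t * ?h t) - (\<Sum>t\<in>S. c t * g t)) + s\<^sup>2 * C"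
      by (simp add: mult_left_mono)
    moreover have "s\<^sup>2 * C \<le> s * e" using s by (simp add: power2_eq_square mult.assoc)
    ultimately have "0 < 2 * s * ((\<Sum>t\<in>S. c t * ?h t) - (\<Sum>t\<in>S. c t * g t)) + s * e + s * e"
      using Fg by linarith
    also have "\<dots> = 2 * s * ((\<Sum>t\<in>S. c t * ?h t) - k)" by (simp add: k_def algebra_simps)
    finally show ?thesis using s by (simp add: zero_less_mult_iff)
  qed
  \<comment> \<open>Since all functions in question are \<open>1\<close> at \<open>1\<close>, the bound \<open>k\<close> can be absorbed into the coefficient there.\<close>
  let ?c = "\<lambda>t. c t - (if t = 1 then k else 0)"
  have split: "(\<Sum>t\<in>S. ?c t * h t) = (\<Sum>t\<in>S. c t * h t) - k * h 1" for h :: "real \<Rightarrow> real"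
  proof -
    have "(\<Sum>t\<in>S. ?c t * h t) = (\<Sum>t\<in>S. c t * h t) - (\<Sum>t\<in>S. if t = 1 then k * h 1 else 0)"
      unfolding sum_subtractf [symmetric] by (intro sum.cong refl) (simp add: algebra_simps)
    then show ?thesis using S by simp
  qed
  have "0 \<le> (\<Sum>t\<in>S. ?c t * f t)"
  proof (rule functional_nonneg [OF mono f0 S(1,2)])
    show "0 \<le> (\<Sum>t\<in>S. ?c t * harmonic_fun l t)" if "0 \<le> l" "l \<le> 1" for l
      unfolding split using low [OF that] by (simp add: harmonic_fun_def)
  qed (use S in auto)
  then have "k \<le> (\<Sum>t\<in>S. c t * f t)" unfolding split by (simp add: f1)
  moreover have "(\<Sum>t\<in>S. (g t - f t)\<^sup>2) = (\<Sum>t\<in>S. c t * g t) - (\<Sum>t\<in>S. c t * f t)"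
    unfolding sum_subtractf [symmetric] by (intro sum.cong refl) (simp add: c_def power2_eq_square algebra_simps)
  ultimately have "(\<Sum>t\<in>S. (g t - f t)\<^sup>2) \<le> e" by (simp add: k_def)
  then show ?thesis using that g by blast
qed

lemma grid_between:
  fixes a b t :: real
  assumes ab: "a < b" and N: "0 < N" and t: "t \<in> {a..b}"
  obtains i where "i < N" "a + (b - a) * real i / real N \<le> t" "t \<le> a + (b - a) * real (Suc i) / real N"
proof -
  define x where "x = (t - a) * real N / (b - a)"
  have x: "0 \<le> x" "x \<le> real N" using ab t by (auto simp: x_def field_simps mult_right_mono)
  have t_eq: "t = a + (b - a) * x / real N" using ab N by (simp add: x_def)
  define i where "i = min (nat \<lfloor>x\<rfloor>) (N - 1)"
  have "real i \<le> x" using x by (simp add: i_def min_def) linarith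
  moreover have "x \<le> real (Suc i)"
  proof (cases "nat \<lfloor>x\<rfloor> \<le> N - 1")
    case True
    then show ?thesis by (simp add: i_def) linarith
  next
    case False
    then show ?thesis using x N by (simp add: i_def)
  qed
  ultimately show ?thesis
    using that [of i] ab N unfolding t_eq
    by (simp add: i_def divide_right_mono mult_left_mono del: of_nat_Suc)
qed

text \<open>
  Since mixtures are monotone, closeness at the points of a fine grid implies closeness everywhere.
\<close>

lemma mixture_approx_interval:
  assumes mono: "operator_monotone_on {0..} f" and f0: "0 \<le> f 0" and f1: "f 1 = 1"
    and ab: "0 < a" "a < b" and e: "0 < e"
  obtains g \<mu> \<kappa> m where "harmonic_mixture g \<mu> \<kappa> m" "\<And>t. t \<in> {a..b} \<Longrightarrow> \<bar>g t - f t\<bar> \<le> e"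
proof -
  have cont: "continuous_on {a..b} f"
    using mono ab by (auto simp: operator_monotone_on_def operator_monotone_on_space_def
        intro: continuous_on_subset)
  obtain d where d: "0 < d" "\<And>t t'. t \<in> {a..b} \<Longrightarrow> t' \<in> {a..b} \<Longrightarrow> \<bar>t' - t\<bar> < d \<Longrightarrow> \<bar>f t' - f t\<bar> < e / 2"
    using uniformly_continuous_onE [OF compact_uniformly_continuous [OF cont compact_Icc], of "e / 2"] e
    by (auto simp: dist_real_def)
  obtain N :: nat where N: "(b - a) / d < real N" using reals_Archimedean2 by blast
  have N0: "0 < N" using N ab d by (cases N) (auto simp: divide_less_0_iff)
  have step: "(b - a) / real N < d" using N N0 d by (simp add: field_simps)
  define \<tau> where "\<tau> i = a + (b - a) * real i / real N" for i
  have \<tau>: "\<tau> i \<in> {a..b}" if "i \<le> N" for i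
  proof -
    have "(b - a) * real i / real N \<le> (b - a) * real N / real N"
      using that ab by (intro divide_right_mono mult_left_mono) auto
    then show ?thesis using ab N0 by (simp add: \<tau>_def)
  qed
  define S where "S = insert 1 (\<tau> ` {..N})"
  have S: "finite S" "1 \<in> S" by (auto simp: S_def)
  have "S \<subseteq> {0<..}" using \<tau> ab by (force simp: S_def)
  moreover have "0 < (e / 2)\<^sup>2" using e by simp
  ultimately obtain g \<mu> \<kappa> m where g: "harmonic_mixture g \<mu> \<kappa> m" and gS: "(\<Sum>t\<in>S. (g t - f t)\<^sup>2) \<le> (e / 2)\<^sup>2"
    using mixture_approx_finite [OF mono f0 f1 S(1) _ S(2)] by blast
  have near: "\<bar>g (\<tau> i) - f (\<tau> i)\<bar> \<le> e / 2" if "i \<le> N" for i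
  proof -
    have "(g (\<tau> i) - f (\<tau> i))\<^sup>2 \<le> (\<Sum>t\<in>S. (g t - f t)\<^sup>2)"
      by (rule member_le_sum) (use that in \<open>auto simp: S_def\<close>)
    then have "(g (\<tau> i) - f (\<tau> i))\<^sup>2 \<le> (e / 2)\<^sup>2" using gS by linarith
    then show ?thesis using e by (simp add: abs_le_square_iff [symmetric])
  qed
  have "\<bar>g t - f t\<bar> \<le> e" if t: "t \<in> {a..b}" for t
  proof -
    obtain i where i: "i < N" "\<tau> i \<le> t" "t \<le> \<tau> (Suc i)"
      using grid_between [OF ab(2) N0 t] unfolding \<tau>_def by metis
    have diff: "\<tau> (Suc i) - \<tau> i = (b - a) / real N"
      by (simp add: \<tau>_def diff_divide_distrib [symmetric] algebra_simps)
    have i': "i \<le> N" "Suc i \<le> N" using i by auto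
    have "\<bar>f (\<tau> i) - f t\<bar> < e / 2" "\<bar>f (\<tau> (Suc i)) - f t\<bar> < e / 2"
      using d(2) [OF t \<tau> [OF i'(1)]] d(2) [OF t \<tau> [OF i'(2)]] i diff step by auto
    moreover have "g (\<tau> i) \<le> g t" "g t \<le> g (\<tau> (Suc i))"
      using harmonic_mixture_mono [OF g] i \<tau> [OF i'(1)] t ab by auto
    ultimately show ?thesis using near [OF i'(1)] near [OF i'(2)] by linarith
  qed
  then show ?thesis using that g by blast
qed

text \<open>
  Closeness of the first moments comes from concavity: the graph of \<open>g\<close> lies below its tangent with
  slope \<open>\<mu>\<close> at \<open>1\<close>, so \<open>\<mu>\<close> is squeezed between difference quotients of \<open>g\<close> at \<open>1\<close>.
\<close>

lemma mixture_approx: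
  assumes mono: "operator_monotone_on {0..} f" and f0: "0 \<le> f 0" and f1: "f 1 = 1"
    and deriv: "(f has_real_derivative \<mu>f) (at 1)"
    and ab: "0 < a" "a < 1" "1 < b" and e: "0 < e"
  obtains g \<mu> \<kappa> m where "harmonic_mixture g \<mu> \<kappa> m" "\<And>t. t \<in> {a..b} \<Longrightarrow> \<bar>g t - f t\<bar> \<le> e"
    "\<bar>\<mu> - \<mu>f\<bar> \<le> e"
proof -
  have "((\<lambda>h. (f (1 + h) - f 1) / h) \<longlongrightarrow> \<mu>f) (at 0)"
    using deriv by (simp add: DERIV_def)
  then have "\<forall>\<^sub>F h in at 0. dist ((f (1 + h) - f 1) / h) \<mu>f < e / 2"
    using e by (intro tendstoD) auto
  then obtain r where r: "0 < r" "\<And>h. h \<noteq> 0 \<Longrightarrow> \<bar>h\<bar> < r \<Longrightarrow> \<bar>(f (1 + h) - 1) / h - \<mu>f\<bar> < e / 2"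
    by (auto simp: eventually_at dist_real_def f1)
  define h where "h = min (r / 2) (min (1 - a) (b - 1))"
  have h: "0 < h" "h < r" "h \<le> 1 - a" "h \<le> b - 1" using r ab by (auto simp: h_def)
  have q: "\<bar>f (1 + h) - 1 - \<mu>f * h\<bar> \<le> e / 2 * h" "\<bar>f (1 - h) - 1 + \<mu>f * h\<bar> \<le> e / 2 * h"
  proof -
    have "(f (1 + h) - 1) / h - \<mu>f = (f (1 + h) - 1 - \<mu>f * h) / h" using h by (simp add: field_simps)
    moreover have "\<bar>(f (1 + h) - 1) / h - \<mu>f\<bar> < e / 2" using r(2) [of h] h by simp
    ultimately have "\<bar>f (1 + h) - 1 - \<mu>f * h\<bar> / h < e / 2" using h by (simp add: abs_divide)
    then show "\<bar>f (1 + h) - 1 - \<mu>f * h\<bar> \<le> e / 2 * h" using h by (simp add: pos_divide_less_eq)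
    have "(f (1 - h) - 1) / (- h) - \<mu>f = - ((f (1 - h) - 1 + \<mu>f * h) / h)" using h by (simp add: field_simps)
    moreover have "\<bar>(f (1 + - h) - 1) / (- h) - \<mu>f\<bar> < e / 2" using r(2) [of "- h"] h by simp
    ultimately have "\<bar>f (1 - h) - 1 + \<mu>f * h\<bar> / h < e / 2" using h by (simp add: abs_divide)
    then show "\<bar>f (1 - h) - 1 + \<mu>f * h\<bar> \<le> e / 2 * h" using h by (simp add: pos_divide_less_eq)
  qed
  define e' where "e' = min e (e / 2 * h)"
  have e': "0 < e'" using e h by (simp add: e'_def)
  obtain g \<mu> \<kappa> m where g: "harmonic_mixture g \<mu> \<kappa> m" and gf: "\<And>t. t \<in> {a..b} \<Longrightarrow> \<bar>g t - f t\<bar> \<le> e'"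
    using mixture_approx_interval [OF mono f0 f1 ab(1) order.strict_trans [OF ab(2,3)] e'] by blast
  have "\<bar>g (1 + h) - f (1 + h)\<bar> \<le> e / 2 * h" "\<bar>g (1 - h) - f (1 - h)\<bar> \<le> e / 2 * h"
    using gf [of "1 + h"] gf [of "1 - h"] h by (auto simp: e'_def)
  moreover have "g (1 + h) \<le> 1 + \<mu> * h" "g (1 - h) \<le> 1 - \<mu> * h"
    using harmonic_mixture_le_tangent [OF g, of "1 + h"] harmonic_mixture_le_tangent [OF g, of "1 - h"] h ab
    by auto
  ultimately have "\<bar>\<mu> * h - \<mu>f * h\<bar> \<le> e * h" using q by linarith
  then have "\<bar>\<mu> - \<mu>f\<bar> * h \<le> e * h" using h by (simp add: abs_mult left_diff_distrib [symmetric])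
  then have "\<bar>\<mu> - \<mu>f\<bar> \<le> e" using h by simp
  moreover have "\<bar>g t - f t\<bar> \<le> e" if "t \<in> {a..b}" for t
    using gf [OF that] by (simp add: e'_def)
  ultimately show ?thesis using that g by blast
qed

section \<open>The inequality for complementary means\<close>

lemma cfc_diff_norm_le:
  assumes T: "form_between a b T" and f: "continuous_on {a..b} f" and g: "continuous_on {a..b} g"
    and e: "0 \<le> e" "\<And>t. t \<in> {a..b} \<Longrightarrow> \<bar>g t - f t\<bar> \<le> e"
  shows "norm (cfc g T - cfc f T) \<le> e"
proof -
  have "cfc (\<lambda>t. g t + (- 1) * f t) T = cfc g T - cfc f T"
    using cfc_add [OF T g continuous_on_mult_left [OF f, of "- 1"]] cfc_scale [OF T f, of "- 1"] by simp
  moreover have "norm (cfc (\<lambda>t. g t + (- 1) * f t) T) \<le> e"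
    by (rule cfc_norm_le [OF T _ _ e(1)]) (use e(2) in \<open>auto intro!: continuous_intros f g\<close>)
  ultimately show ?thesis by simp
qed

lemma op_mean_approx:
  assumes A: "strictly_positive_op A" and B: "strictly_positive_op B"
  obtains a b C where "0 < a" "a < 1" "1 < b" "0 \<le> C"
    "\<And>f g e. continuous_on {a..b} f \<Longrightarrow> continuous_on {a..b} g \<Longrightarrow> 0 \<le> e \<Longrightarrow>
      (\<And>t. t \<in> {a..b} \<Longrightarrow> \<bar>g t - f t\<bar> \<le> e) \<Longrightarrow> norm (op_mean g A B - op_mean f A B) \<le> C * e"
proof -
  obtain R R' T where T: "strictly_positive_op T" and mean: "\<And>f. op_mean f A B = R o\<^sub>L cfc f T o\<^sub>L R"
    using op_mean_sandwich [OF A B] by metis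
  obtain a b where ab: "0 < a" "a \<le> 1" "1 \<le> b" "form_between a b T"
    using strictly_positive_form_between [OF T] by metis
  have T': "form_between (a / 2) (b + 1) T" by (rule form_between_mono [OF ab(4)]) (use ab in auto)
  show ?thesis
  proof (rule that [of "a / 2" "b + 1" "norm R * norm R"])
    fix f g :: "real \<Rightarrow> real" and e :: real
    assume "continuous_on {a / 2..b + 1} f" "continuous_on {a / 2..b + 1} g" "0 \<le> e"
      "\<And>t. t \<in> {a / 2..b + 1} \<Longrightarrow> \<bar>g t - f t\<bar> \<le> e"
    then have "norm (cfc g T - cfc f T) \<le> e" by (rule cfc_diff_norm_le [OF T'])
    have "norm (R o\<^sub>L (cfc g T - cfc f T) o\<^sub>L R) \<le> norm (R o\<^sub>L (cfc g T - cfc f T)) * norm R"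
      by (rule norm_blinfun_compose)
    also have "\<dots> \<le> norm R * norm (cfc g T - cfc f T) * norm R"
      by (intro mult_right_mono norm_blinfun_compose) simp
    also have "\<dots> \<le> norm R * e * norm R"
      using \<open>norm (cfc g T - cfc f T) \<le> e\<close> by (intro mult_right_mono mult_left_mono) auto
    finally show "norm (op_mean g A B - op_mean f A B) \<le> norm R * norm R * e"
      by (simp add: mean compose_simps mult_ac)
  qed (use ab in auto)
qed

text \<open>
  Pass to the limit in the estimate for mixtures. The square root of the factor after \<open>4\<close> is the limit of lower bounds
  for \<open>\<kappa>\<close>, and the mean of \<open>(l (1 - l))\<^sup>2\<close> is at least \<open>\<kappa>\<^sup>2\<close>. For \<open>t = 1\<close> the factor is zero, because division by
  zero yields zero, and what remains is the inequality itself.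
\<close>

lemma mean_gap_compl_le:
  fixes A B :: "'h :: chilbert_space \<Rightarrow>\<^sub>L 'h"
  assumes f0: "0 \<le> f 0" and mono: "operator_monotone_on {0..} f" and f1: "f 1 = 1"
    and deriv: "(f has_real_derivative \<mu>) (at 1)"
    and A: "strictly_positive_op A" "A \<preceq> (1/2) *\<^sub>R id_blinfun"
    and B: "strictly_positive_op B" "B \<preceq> (1/2) *\<^sub>R id_blinfun"
    and t: "0 < t"
  shows "4 * ((1 + \<mu> * (t - 1) - f t) * min 1 t / (t - 1)\<^sup>2)\<^sup>2 * qform (id_blinfun - A - B) ((A - B) x) \<le>
    qform (mean_gap f \<mu> A B - mean_gap f \<mu> (id_blinfun - A) (id_blinfun - B)) x"
proof -
  have sa: "selfadjoint_op A" "selfadjoint_op B"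
    using A B by (auto simp: strictly_positive_op_def positive_op_iff)
  let ?A = "id_blinfun - A" and ?B = "id_blinfun - B"
  have A': "strictly_positive_op ?A" by (rule strictly_positive_compl [OF sa(1) A(2)])
  have B': "strictly_positive_op ?B" by (rule strictly_positive_compl [OF sa(2) B(2)])
  obtain a b C where ab: "0 < a" "a < 1" "1 < b" "0 \<le> C"
    and lim: "\<And>f g e. continuous_on {a..b} f \<Longrightarrow> continuous_on {a..b} g \<Longrightarrow> 0 \<le> e \<Longrightarrow>
      (\<And>t. t \<in> {a..b} \<Longrightarrow> \<bar>g t - f t\<bar> \<le> e) \<Longrightarrow> norm (op_mean g A B - op_mean f A B) \<le> C * e"
    using op_mean_approx [OF A(1) B(1)] by blast
  obtain a' b' C' where ab': "0 < a'" "a' < 1" "1 < b'" "0 \<le> C'"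
    and lim': "\<And>f g e. continuous_on {a'..b'} f \<Longrightarrow> continuous_on {a'..b'} g \<Longrightarrow> 0 \<le> e \<Longrightarrow>
      (\<And>t. t \<in> {a'..b'} \<Longrightarrow> \<bar>g t - f t\<bar> \<le> e) \<Longrightarrow> norm (op_mean g ?A ?B - op_mean f ?A ?B) \<le> C' * e"
    using op_mean_approx [OF A' B'] by blast
  define p where "p = min t (min a a')"
  define r where "r = max t (max b b')"
  have pr: "0 < p" "p < 1" "1 < r" "t \<in> {p..r}" "{a..b} \<subseteq> {p..r}" "{a'..b'} \<subseteq> {p..r}"
    using ab ab' t by (auto simp: p_def r_def)
  define e where "e n = inverse (real (Suc n))" for n
  have e: "0 < e n" for n by (simp add: e_def)
  have e_lim: "e \<longlonglongrightarrow> 0" unfolding e_def by (rule LIMSEQ_inverse_real_of_nat)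
  have "\<exists>g \<mu>' \<kappa> m. harmonic_mixture g \<mu>' \<kappa> m \<and> (\<forall>s\<in>{p..r}. \<bar>g s - f s\<bar> \<le> e n) \<and> \<bar>\<mu>' - \<mu>\<bar> \<le> e n" for n
    using mixture_approx [OF mono f0 f1 deriv pr(1-3) e [of n]] by metis
  then obtain g \<nu> \<kappa> m where g: "\<And>n. harmonic_mixture (g n) (\<nu> n) (\<kappa> n) (m n)"
    and gf: "\<And>n s. s \<in> {p..r} \<Longrightarrow> \<bar>g n s - f s\<bar> \<le> e n" and \<nu>: "\<And>n. \<bar>\<nu> n - \<mu>\<bar> \<le> e n"
    by metis
  have "continuous_on {p..r} f"
    using mono pr by (auto simp: operator_monotone_on_def operator_monotone_on_space_def
        intro: continuous_on_subset)
  then have f_cont: "continuous_on {a..b} f" "continuous_on {a'..b'} f"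
    using pr by (auto intro: continuous_on_subset)
  have g_cont: "continuous_on {a..b} (g n)" "continuous_on {a'..b'} (g n)" for n
    using harmonic_mixture_continuous [OF g] ab ab' by auto
  have squeeze: "X \<longlonglongrightarrow> L" if "\<And>n. norm (X n - L) \<le> c * e n"
    for X :: "nat \<Rightarrow> 'a :: real_normed_vector" and L c
  proof -
    have "(\<lambda>n. c * e n) \<longlonglongrightarrow> 0" by (rule tendsto_mult_right_zero [OF e_lim])
    then have "(\<lambda>n. X n - L) \<longlonglongrightarrow> 0"
      by (rule Lim_null_comparison [rotated]) (use that in simp)
    then show ?thesis by (simp add: LIM_zero_iff)
  qed
  have \<nu>_lim: "\<nu> \<longlonglongrightarrow> \<mu>" by (rule squeeze [of _ _ 1]) (use \<nu> in simp)
  have gt_lim: "(\<lambda>n. g n t) \<longlonglongrightarrow> f t" by (rule squeeze [of _ _ 1]) (use gf [OF pr(4)] in simp)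
  have "(\<lambda>n. op_mean (g n) A B) \<longlonglongrightarrow> op_mean f A B"
    by (rule squeeze [OF lim [OF f_cont(1) g_cont(1)]]) (use e gf pr in \<open>auto simp: less_imp_le\<close>)
  then have gap: "(\<lambda>n. mean_gap (g n) (\<nu> n) A B) \<longlonglongrightarrow> mean_gap f \<mu> A B"
    unfolding mean_gap_def weighted_arith_mean_def by (intro tendsto_intros \<nu>_lim)
  have "(\<lambda>n. op_mean (g n) ?A ?B) \<longlonglongrightarrow> op_mean f ?A ?B"
    by (rule squeeze [OF lim' [OF f_cont(2) g_cont(2)]]) (use e gf pr in \<open>auto simp: less_imp_le\<close>)
  then have gap': "(\<lambda>n. mean_gap (g n) (\<nu> n) ?A ?B) \<longlonglongrightarrow> mean_gap f \<mu> ?A ?B"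
    unfolding mean_gap_def weighted_arith_mean_def by (intro tendsto_intros \<nu>_lim)
  define q where "q = qform (id_blinfun - A - B) ((A - B) x)"
  have q: "0 \<le> q"
  proof -
    have "0 \<le> qform ((1/2) *\<^sub>R id_blinfun - A) y" "0 \<le> qform ((1/2) *\<^sub>R id_blinfun - B) y" for y
      using A(2) B(2) by (simp_all add: op_le_def positive_op_iff)
    from this [of "(A - B) x"] show ?thesis by (simp add: q_def qform_simps)
  qed
  define c where "c n = (1 + \<nu> n * (t - 1) - g n t) * min 1 t / (t - 1)\<^sup>2" for n
  have c_lim: "c \<longlonglongrightarrow> (1 + \<mu> * (t - 1) - f t) * min 1 t / (t - 1)\<^sup>2"
    unfolding c_def divide_inverse by (intro tendsto_intros \<nu>_lim gt_lim)
  have cm: "(c n)\<^sup>2 \<le> m n" for n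
  proof -
    have "0 \<le> (1 + \<nu> n * (t - 1) - g n t) * min 1 t"
      using harmonic_mixture_le_tangent [OF g [of n] t] t by (intro mult_nonneg_nonneg) auto
    then have c0: "0 \<le> c n" by (simp add: c_def)
    have "(c n)\<^sup>2 \<le> (\<kappa> n)\<^sup>2"
    proof (cases "t = 1")
      case False
      then have "c n \<le> \<kappa> n"
        using harmonic_mixture_tangent_gap [OF g [of n] t] by (simp add: c_def pos_divide_le_eq)
      then show ?thesis using c0 by (intro power_mono)
    qed (simp add: c_def)
    also have "\<dots> \<le> m n" by (rule harmonic_mixture_moments [OF g])
    finally show ?thesis .
  qed
  have "4 * (c n)\<^sup>2 * q \<le> qform (mean_gap (g n) (\<nu> n) A B - mean_gap (g n) (\<nu> n) ?A ?B) x" for n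
  proof -
    have "4 * (c n)\<^sup>2 * q \<le> 4 * m n * q" using cm q by (intro mult_right_mono mult_left_mono) auto
    also have "\<dots> \<le> qform (mean_gap (g n) (\<nu> n) A B - mean_gap (g n) (\<nu> n) ?A ?B) x"
      unfolding q_def by (rule mean_gap_mixture_compl [OF g A B])
    finally show ?thesis .
  qed
  moreover have "(\<lambda>n. 4 * (c n)\<^sup>2 * q) \<longlonglongrightarrow> 4 * ((1 + \<mu> * (t - 1) - f t) * min 1 t / (t - 1)\<^sup>2)\<^sup>2 * q"
    by (intro tendsto_intros c_lim)
  moreover have "(\<lambda>n. qform (mean_gap (g n) (\<nu> n) A B - mean_gap (g n) (\<nu> n) ?A ?B) x)
      \<longlonglongrightarrow> qform (mean_gap f \<mu> A B - mean_gap f \<mu> ?A ?B) x"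
    by (intro tendsto_qform tendsto_diff gap gap')
  ultimately show "4 * ((1 + \<mu> * (t - 1) - f t) * min 1 t / (t - 1)\<^sup>2)\<^sup>2 * qform (id_blinfun - A - B) ((A - B) x) \<le>
    qform (mean_gap f \<mu> A B - mean_gap f \<mu> ?A ?B) x"
    unfolding q_def by (intro LIMSEQ_le) auto
qed

lemma nonlinear_off_tangent:
  assumes mono: "operator_monotone_on {0..} f" and nonlinear: "\<not> linear_on_nonneg f"
  obtains t where "0 < t" "f t \<noteq> 1 + \<mu> * (t - 1)"
proof (rule ccontr)
  assume "\<not> thesis"
  then have eq: "\<And>t. 0 < t \<Longrightarrow> f t = 1 + \<mu> * (t - 1)" using that by blast
  have "continuous_on {0..} f"
    using mono by (simp add: operator_monotone_on_def operator_monotone_on_space_def)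
  then have "(f \<longlongrightarrow> f 0) (at_right 0)"
    by (auto simp: continuous_on_def intro: tendsto_within_subset)
  moreover have "((\<lambda>t. 1 + \<mu> * (t - 1)) \<longlongrightarrow> 1 + \<mu> * (0 - 1)) (at_right 0)"
    by (intro tendsto_intros)
  moreover have "\<forall>\<^sub>F t in at_right 0. 1 + \<mu> * (t - 1) = f t"
    unfolding eventually_at_right_field by (intro exI [of _ 1]) (use eq in auto)
  ultimately have "f 0 = 1 + \<mu> * (0 - 1)"
    by (metis tendsto_cong tendsto_unique trivial_limit_at_right_real)
  then have "f t = (1 - \<mu>) + \<mu> * t" if "0 \<le> t" for t
    using eq [of t] that by (cases "t = 0") (auto simp: algebra_simps)
  then show False using nonlinear by (auto simp: linear_on_nonneg_def)
qed

lemma positive_op_kernel: "positive_op P \<Longrightarrow> qform P x \<le> 0 \<Longrightarrow> P x = 0"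
  using positive_op_norm_le [of P x] mult_nonneg_nonpos [of "norm P" "qform P x"]
  by (smt (verit) norm_ge_zero norm_eq_zero power2_less_eq_zero_iff)

text \<open>
  A vector \<open>y = (A - B) x\<close> at which the form of \<open>1 - A - B = (1/2 - A) + (1/2 - B)\<close> vanishes
  satisfies \<open>A y = y / 2 = B y\<close>, hence \<open>(A - B)\<^sup>2 x = 0\<close>.
\<close>

lemma eq_if_compl_form_vanishes:
  assumes sa: "selfadjoint_op A" "selfadjoint_op B"
    and A: "A \<preceq> (1/2) *\<^sub>R id_blinfun" and B: "B \<preceq> (1/2) *\<^sub>R id_blinfun"
    and vanish: "\<And>x. qform (id_blinfun - A - B) ((A - B) x) \<le> 0"
  shows "A = B"
proof -
  have pos: "positive_op ((1/2) *\<^sub>R id_blinfun - A)" "positive_op ((1/2) *\<^sub>R id_blinfun - B)"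
    using A B by (simp_all add: op_le_def)
  have saD: "selfadjoint_op (A - B)" by (intro selfadjoint_op_intros sa)
  have "(A - B) x = 0" for x
  proof -
    define y where "y = (A - B) x"
    have "0 \<le> qform ((1/2) *\<^sub>R id_blinfun - A) y" "0 \<le> qform ((1/2) *\<^sub>R id_blinfun - B) y"
      using pos by (simp_all add: positive_op_iff)
    moreover have "qform ((1/2) *\<^sub>R id_blinfun - A) y + qform ((1/2) *\<^sub>R id_blinfun - B) y \<le> 0"
      using vanish [of x] by (simp add: qform_simps y_def)
    ultimately have "((1/2) *\<^sub>R id_blinfun - A) y = 0" "((1/2) *\<^sub>R id_blinfun - B) y = 0"
      by (intro positive_op_kernel pos; linarith)+
    then have "(A - B) y = 0" by (simp add: blinfun.diff_left)
    then have "cinner y y = 0"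
      unfolding y_def by (simp add: selfadjoint_opD [OF saD])
    then show ?thesis by (simp add: cinner_self y_def)
  qed
  then show ?thesis by (intro blinfun_eqI) (simp add: blinfun.diff_left)
qed

text \<open>
  Here \<open>R T R = R R\<close>, so \<open>T\<close> acts as the identity on the range of \<open>R\<close>.
\<close>

lemma mean_gap_same:
  assumes A: "strictly_positive_op A" and mono: "operator_monotone_on {0..} f" and f: "f 1 = 1"
  shows "mean_gap f \<mu> A A = 0"
proof -
  obtain R R' T where R: "R o\<^sub>L R = A" "R' o\<^sub>L R = id_blinfun" "selfadjoint_op R"
    and T: "strictly_positive_op T" "R o\<^sub>L T o\<^sub>L R = A" and mean: "\<And>f. op_mean f A A = R o\<^sub>L cfc f T o\<^sub>L R"
    using op_mean_sandwich [OF A A] by metis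
  have TR: "T o\<^sub>L R = R"
  proof -
    have "R' o\<^sub>L (R o\<^sub>L T o\<^sub>L R) = R' o\<^sub>L (R o\<^sub>L R)" by (simp add: T(2) R(1))
    then have "(R' o\<^sub>L R) o\<^sub>L (T o\<^sub>L R) = (R' o\<^sub>L R) o\<^sub>L R" by (simp only: compose_assoc)
    then show ?thesis by (simp add: R(2))
  qed
  obtain a b where ab: "0 < a" "a \<le> 1" "1 \<le> b" "form_between a b T"
    using strictly_positive_form_between [OF T(1)] by metis
  have "cfc f T (R x) = R x" for x
  proof -
    have "continuous_on {a..b} f" using mono ab
      by (auto simp: operator_monotone_on_def operator_monotone_on_space_def intro: continuous_on_subset)
    moreover have "T (R x) = 1 *\<^sub>R R x" by (metis TR blinfun_apply_blinfun_compose scaleR_one)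
    ultimately have "cfc f T (R x) = f 1 *\<^sub>R R x"
      using ab by (intro cfc_eigenvector [OF ab(4)]) auto
    then show ?thesis by (simp add: f)
  qed
  then have "op_mean f A A = R o\<^sub>L R" by (intro blinfun_eqI) (simp add: mean)
  then show ?thesis by (simp add: mean_gap_def weighted_arith_mean_def R(1) flip: scaleR_add_left)
qed

lemma selfadjoint_mean_gap:
  assumes A: "strictly_positive_op A" and B: "strictly_positive_op B"
    and mono: "operator_monotone_on {0..} f"
  shows "selfadjoint_op (mean_gap f \<mu> A B)"
proof -
  obtain R R' T where R: "selfadjoint_op R"
    and T: "strictly_positive_op T" and mean: "\<And>f. op_mean f A B = R o\<^sub>L cfc f T o\<^sub>L R"
    using op_mean_sandwich [OF A B] by metis
  obtain a b where ab: "0 < a" "form_between a b T"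
    using strictly_positive_form_between [OF T] by metis
  have "continuous_on {a..b} f" using mono ab
    by (auto simp: operator_monotone_on_def operator_monotone_on_space_def intro: continuous_on_subset)
  then have "selfadjoint_op (op_mean f A B)"
    unfolding mean by (intro selfadjoint_op_sandwich R selfadjoint_cfc [OF ab(2)])
  then show ?thesis
    unfolding mean_gap_def weighted_arith_mean_def
    using A B by (intro selfadjoint_op_intros) (auto simp: strictly_positive_op_def positive_op_iff)
qed

theorem theorem3p1:
  fixes f :: "real \<Rightarrow> real" and \<mu> :: real
    and A B :: "'h :: chilbert_space \<Rightarrow>\<^sub>L 'h"
  assumes "f ` {0..} \<subseteq> {0..}"
    and "operator_monotone_on {0..} f"
    and "f 1 = 1"
    and "(f has_real_derivative \<mu>) (at 1)"
    and "strictly_positive_op A" and "A \<preceq> (1/2) *\<^sub>R id_blinfun"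
    and "strictly_positive_op B" and "B \<preceq> (1/2) *\<^sub>R id_blinfun"
  shows "weighted_arith_mean \<mu> (id_blinfun - A) (id_blinfun - B)
           - op_mean f (id_blinfun - A) (id_blinfun - B)
         \<preceq> weighted_arith_mean \<mu> A B - op_mean f A B
    \<and> (\<not> linear_on_nonneg f \<longrightarrow>
        (weighted_arith_mean \<mu> (id_blinfun - A) (id_blinfun - B)
           - op_mean f (id_blinfun - A) (id_blinfun - B)
         = weighted_arith_mean \<mu> A B - op_mean f A B
         \<longleftrightarrow> A = B))"
proof -
  have f0: "0 \<le> f 0" using assms(1) by auto
  have sa: "selfadjoint_op A" "selfadjoint_op B"
    using assms(5,7) by (auto simp: strictly_positive_op_def positive_op_iff)
  let ?A = "id_blinfun - A" and ?B = "id_blinfun - B"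
  have A': "strictly_positive_op ?A" by (rule strictly_positive_compl [OF sa(1) assms(6)])
  have B': "strictly_positive_op ?B" by (rule strictly_positive_compl [OF sa(2) assms(8)])
  note bound = mean_gap_compl_le [OF f0 assms(2-8)]
  let ?G = "mean_gap f \<mu> A B - mean_gap f \<mu> ?A ?B"
  have "0 \<le> qform ?G x" for x
    using bound [of 1 x] by simp
  then have "positive_op ?G"
    using selfadjoint_mean_gap [OF assms(5,7,2)] selfadjoint_mean_gap [OF A' B' assms(2)]
    by (simp add: positive_op_iff selfadjoint_op_intros)
  then have le: "mean_gap f \<mu> ?A ?B \<preceq> mean_gap f \<mu> A B" by (simp add: op_le_def)
  have "A = B" if nonlinear: "\<not> linear_on_nonneg f" and eq: "mean_gap f \<mu> ?A ?B = mean_gap f \<mu> A B"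
  proof (rule eq_if_compl_form_vanishes [OF sa assms(6,8)])
    fix x
    obtain t where t: "0 < t" "f t \<noteq> 1 + \<mu> * (t - 1)"
      using nonlinear_off_tangent [OF assms(2) nonlinear] by blast
    then have "t \<noteq> 1" using assms(3) by auto
    then have "0 < 4 * ((1 + \<mu> * (t - 1) - f t) * min 1 t / (t - 1)\<^sup>2)\<^sup>2" using t by simp
    moreover have "4 * ((1 + \<mu> * (t - 1) - f t) * min 1 t / (t - 1)\<^sup>2)\<^sup>2 * qform (id_blinfun - A - B) ((A - B) x) \<le> 0"
      using bound [OF t(1), of x] by (simp add: eq qform_def)
    ultimately show "qform (id_blinfun - A - B) ((A - B) x) \<le> 0"
      by (meson mult_pos_pos not_le)
  qed
  moreover have "mean_gap f \<mu> ?A ?B = mean_gap f \<mu> A B" if "A = B"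
    using mean_gap_same [OF assms(5,2,3)] mean_gap_same [OF A' assms(2,3)] that by simp
  ultimately show ?thesis
    using le unfolding mean_gap_def by blast
qed

end
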